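(* Let $G=\mathbf{SL}(2,\mathbb{R})$ and let $n,m\in\mathbb{Z}\cong\widehat{K}$ be two $K$-types with $n\equiv m\pmod 2$, so that $\mathrm{Hom}_M(E_n,E_m)\cong\mathbb{C}$. A function $\varphi\in\mathrm{Hol}(\mathfrak{a}^*_{\mathbb{C}},\mathrm{Hom}_M(E_n,E_m))$ satisfies the intertwining condition (D.3) (with $\gamma=\delta_n$, $\tau=\delta_m$) if and only if there exists an even holomorphic function $h$ on $\mathfrak{a}^*_{\mathbb{C}}\cong\mathbb{C}$ such that $$\varphi(\lambda)=h(\lambda)\cdot q_{n,m}(\lambda),\qquad \lambda\in\mathfrak{a}^*_{\mathbb{C}},$$ where $$q_{n,m}(\lambda)=\begin{cases}1,&n=m,\\(\lambda+\frac{|m|+1}2)(\lambda+\frac{|m|+3}2)\cdots(\lambda+\frac{|n|-1}2),&|n|>|m|\text{ and same signs},\\(\lambda-\frac{|n|+1}2)(\lambda-\frac{|n|+3}2)\cdots(\lambda-\frac{|m|-1}2),&|n|<|m|\text{ and same signs},\\(\lambda+\frac{|n|-1}2)(\lambda+\frac{|n|-3}2)\cdots(\lambda-\frac{|m|-1}2),&\text{else (different signs)},\end{cases}$$ each product running over consecutive factors whose constant terms differ by $1$.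
   Context: Setting. $G=\mathbf{SL}(2,\mathbb{R})=KAN$ with $K=\mathbf{SO}(2)=\{k_\theta=\begin{pmatrix}\cos\theta&\sin\theta\\-\sin\theta&\cos\theta\end{pmatrix}\}$, $A=\{\mathrm{diag}(e^t,e^{-t})\}$, $N$ upper triangular unipotent, $M=\{\pm\mathrm{Id}\}$, $\widehat{K}=\{\delta_n:n\in\mathbb{Z}\}$, $\delta_n(k_\theta)=e^{in\theta}$ on $E_n=\mathbb{C}$. With $\alpha(\mathrm{diag}(t,-t))=2t$ identify $\mathfrak{a}^*_{\mathbb{C}}\cong\mathbb{C}$ via $z\alpha\mapsto z$, so $\rho=\frac12$; $a^\nu=e^{\nu(\log a)}$. (If one of $n,m$ is $0$, the "same signs" and "different signs" formulas agree.) Principal series. For $\sigma\in\widehat{M}$ on $E_\sigma$ and $\lambda\in\mathfrak{a}^*_{\mathbb{C}}$: $H^{\sigma,\lambda}_\infty$ is the space of smooth $f:G\to E_\sigma$ with $f(gman)=a^{-(\lambda+\rho)}\sigma(m)^{-1}f(g)$, $G$ acting by left translation $\pi_{\sigma,\lambda}$; restriction to $K$ identifies it with $H^\sigma_\infty=\{f\in C^\infty(K,E_\sigma):f(km)=\sigma(m)^{-1}f(k)\}$. Derived representations. For $d\in\mathbb{N}_0$ let $H^\sigma_{[\lambda]}$ be the germs at $\lambda$ of holomorphic maps $\mu\mapsto\phi_\mu\in H^\sigma_\infty$ with $(g\phi)_\mu=\pi_{\sigma,\mu}(g)\phi_\mu$, $m_\lambda$ the maximal ideal of the ring of holomorphic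 germs at $\lambda$, $H^{\sigma,\lambda}_{\infty,(d)}:=H^\sigma_{[\lambda]}/m_\lambda^{d+1}H^\sigma_{[\lambda]}$. Similarly $\mathrm{Hom}_M(E_\tau,E_\sigma)^\lambda_{(d)}$ is the space of holomorphic $\mathrm{Hom}_M(E_\tau,E_\sigma)$-valued functions modulo $m_\lambda^{d+1}$. Intertwining data. An intertwining datum $(\xi,W)$ is a finite sequence $\xi=((\sigma_i,\lambda_i,d_i))_{i=1}^s$ with $\sigma_i\in\widehat{M}$, $\lambda_i\in\mathfrak{a}^*_{\mathbb{C}}$, $d_i\in\mathbb{N}_0$, with a proper closed $G$-subrepresentation $W\subset H_\xi:=\bigoplus_iH^{\sigma_i,\lambda_i}_{\infty,(d_i)}$. For a $K$-representation $\tau$, $D^\tau_W$ is the set of $t=(t_1,\dots,t_s)\in\bigoplus_i\mathrm{Hom}_M(E_\tau,E_{\sigma_i})^{\lambda_i}_{(d_i)}$ whose Frobenius partner $T\in\mathrm{Hom}_K(E_\tau,H_\xi)$, $T(v)_i=[\mu\mapsto(k\mapsto t_{i,\mu}\tau(k)^{-1}v)]$, takes values in $W$. Condition (D.3) for $\varphi\in\mathrm{Hol}(\mathfrak{a}^*_{\mathbb{C}},\mathrm{Hom}_M(E_\gamma,E_\tau))$: for each intertwining datum $(\xi,W)$ and each non-zero $t\in D^\tau_W$, $(t_1\circ\varphi_1,\dots,t_s\circ\varphi_s)\in D^\gamma_W$, where $\varphi_i$ is the class of the germ of $\varphi$ at $\lambda_i$ modulo $m_{\lambda_i}^{d_i+1}$.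 *)

theory Defs
  imports "HOL-Complex_Analysis.Complex_Analysis" "HOL-Number_Theory.Cong"
begin

(* otherwise x $ i $ j is ambiguous between vectors and formal power series *)
no_notation fps_nth (infixl \<open>$\<close> 75)

section \<open>The group and its Iwasawa decomposition\<close>

type_synonym mat2 = "real^2^2"

definition SL2 :: "mat2 set" where
  "SL2 = {g. det g = 1}"

definition rot :: "real \<Rightarrow> mat2" where
  "rot \<theta> = vector [vector [cos \<theta>, sin \<theta>], vector [- sin \<theta>, cos \<theta>]]"

definition diagm :: "real \<Rightarrow> mat2" where
  "diagm t = vector [vector [exp t, 0], vector [0, exp (- t)]]"

definition unip :: "real \<Rightarrow> mat2" where
  "unip u = vector [vector [1, u], vector [0, 1]]"

definition Kgrp :: "mat2 set" where "Kgrp = range rot"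
definition Agrp :: "mat2 set" where "Agrp = range diagm"
definition Ngrp :: "mat2 set" where "Ngrp = range unip"
definition Mgrp :: "mat2 set" where "Mgrp = {mat 1, - mat 1}"

text \<open>The weight \<open>a\<^sup>\<nu> = exp (\<nu> (log a))\<close> for \<open>\<nu> = z\<alpha>\<close>; since \<open>\<alpha> (diag(t,-t)) = 2t\<close>,
  it is \<open>exp (2tz)\<close> for \<open>a = diagm t\<close>. In this coordinate \<open>\<rho> = 1/2\<close>.\<close>
definition Apow :: "mat2 \<Rightarrow> complex \<Rightarrow> complex" where
  "Apow a z = exp (z * of_real (2 * ln (a$1$1)))"

text \<open>The components \<open>k\<close> and \<open>a\<close> of \<open>x = kan\<close>, read off from the first column of \<open>x\<close>, which
  is \<open>exp t\<close> times the first column of \<open>k\<close> if \<open>a = diagm t\<close>; see \<open>iwasawa\<close> and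
  \<open>iwasawa_unique\<close> below.\<close>
definition iwA :: "mat2 \<Rightarrow> mat2" where
  "iwA x = diagm (ln (sqrt ((x$1$1)\<^sup>2 + (x$2$1)\<^sup>2)))"

definition iwK :: "mat2 \<Rightarrow> mat2" where
  "iwK x = (let r = sqrt ((x$1$1)\<^sup>2 + (x$2$1)\<^sup>2) in
     vector [vector [x$1$1 / r, - (x$2$1 / r)], vector [x$2$1 / r, x$1$1 / r]])"

section \<open>Characters of \<open>K\<close> and \<open>M\<close>\<close>

text \<open>\<open>\<delta>\<^sub>n (rot \<theta>) = exp (i n \<theta>)\<close>, see \<open>delta_rot\<close> below.\<close>
definition delta :: "int \<Rightarrow> mat2 \<Rightarrow> complex" where
  "delta n k = Complex (k$1$1) (k$1$2) powi n"

text \<open>The two irreducible representations of \<open>M = {\<plusminus>Id}\<close>.\<close>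
datatype Mhat = MTriv | MSign

fun Mchar :: "Mhat \<Rightarrow> mat2 \<Rightarrow> complex" where
  "Mchar MTriv x = 1"
| "Mchar MSign x = of_real (x$1$1)"

text \<open>\<open>M\<close>-equivariant linear maps between the one-dimensional spaces of the characters \<open>\<omega>\<close> and
  \<open>\<psi>\<close>; a linear map \<open>\<complex> \<rightarrow> \<complex>\<close> is identified with a scalar.\<close>
definition Hom_M :: "(mat2 \<Rightarrow> complex) \<Rightarrow> (mat2 \<Rightarrow> complex) \<Rightarrow> complex set" where
  "Hom_M \<omega> \<psi> = {c. \<forall>x\<in>Mgrp. c * \<omega> x = \<psi> x * c}"

section \<open>Principal series\<close>

definition K_deriv :: "nat \<Rightarrow> (mat2 \<Rightarrow> complex) \<Rightarrow> real \<Rightarrow> complex" where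
  "K_deriv j f = ((\<lambda>F t. vector_derivative F (at t)) ^^ j) (\<lambda>\<theta>. f (rot \<theta>))"

definition smooth_K :: "(mat2 \<Rightarrow> complex) \<Rightarrow> bool" where
  "smooth_K f \<longleftrightarrow> (\<forall>j \<theta>. K_deriv j f differentiable (at \<theta>))"

text \<open>A function on \<open>K\<close> is represented by its extension by \<open>0\<close> to all matrices.\<close>
definition H_inf :: "Mhat \<Rightarrow> (mat2 \<Rightarrow> complex) set" where
  "H_inf \<sigma> = {f. (\<forall>x. x \<notin> Kgrp \<longrightarrow> f x = 0) \<and> smooth_K f \<and>
      (\<forall>k\<in>Kgrp. \<forall>x\<in>Mgrp. f (k ** x) = inverse (Mchar \<sigma> x) * f k)}"

text \<open>The function on \<open>G\<close> with \<open>f(gman) = a\<^bsup>-(\<zeta>+\<rho>)\<^esup> \<sigma>(m)\<^sup>-\<^sup>1 f(g)\<close> whose restriction to \<open>K\<close> is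
  the given \<open>f\<close>; see \<open>ps_extend_equivariant\<close> below.\<close>
definition ps_extend :: "complex \<Rightarrow> (mat2 \<Rightarrow> complex) \<Rightarrow> mat2 \<Rightarrow> complex" where
  "ps_extend \<zeta> f x = Apow (iwA x) (- (\<zeta> + 1/2)) * f (iwK x)"

text \<open>Left translation by \<open>g\<close>, transported to functions on \<open>K\<close>.\<close>
definition ps_act :: "complex \<Rightarrow> mat2 \<Rightarrow> (mat2 \<Rightarrow> complex) \<Rightarrow> mat2 \<Rightarrow> complex" where
  "ps_act \<zeta> g f = (\<lambda>k. if k \<in> Kgrp then ps_extend \<zeta> f (matrix_inv g ** k) else 0)"

section \<open>Derived representations\<close>

text \<open>Convergence in the topology of uniform convergence of all derivatives on \<open>K\<close>.\<close>
definition tendsto_Cinf ::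
    "('a \<Rightarrow> mat2 \<Rightarrow> complex) \<Rightarrow> (mat2 \<Rightarrow> complex) \<Rightarrow> 'a filter \<Rightarrow> bool" where
  "tendsto_Cinf F f \<F> \<longleftrightarrow> (\<forall>j. uniform_limit UNIV (\<lambda>x. K_deriv j (F x)) (K_deriv j f) \<F>)"

type_synonym family = "complex \<Rightarrow> mat2 \<Rightarrow> complex"

text \<open>Families holomorphic near \<open>\<zeta>\<close>, as maps into the Frechet space \<open>H_inf \<sigma>\<close>. Their values away
  from \<open>\<zeta>\<close> are irrelevant; families with the same germ are identified in \<open>jet_rel\<close>.\<close>
definition H_germ :: "Mhat \<Rightarrow> complex \<Rightarrow> family set" where
  "H_germ \<sigma> \<zeta> = {\<phi>. \<exists>U. open U \<and> \<zeta> \<in> U \<and> (\<forall>\<mu>\<in>U. \<phi> \<mu> \<in> H_inf \<sigma> \<and>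
      (\<exists>\<psi>\<in>H_inf \<sigma>. tendsto_Cinf (\<lambda>\<nu> k. (\<phi> \<nu> k - \<phi> \<mu> k) / (\<nu> - \<mu>)) \<psi> (at \<mu>)))}"

text \<open>Congruence modulo \<open>m\<^sub>\<zeta>\<^bsup>d+1\<^esup> H\<^sup>\<sigma>\<^bsub>[\<zeta>]\<^esub>\<close>; the ideal \<open>m\<^sub>\<zeta>\<close> is generated by \<open>\<mu> \<mapsto> \<mu> - \<zeta>\<close>.\<close>
definition jet_rel :: "Mhat \<Rightarrow> complex \<Rightarrow> nat \<Rightarrow> (family \<times> family) set" where
  "jet_rel \<sigma> \<zeta> d = {(\<phi>, \<psi>). \<phi> \<in> H_germ \<sigma> \<zeta> \<and> \<psi> \<in> H_germ \<sigma> \<zeta> \<and>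
      (\<exists>\<omega>\<in>H_germ \<sigma> \<zeta>. \<forall>\<^sub>F \<mu> in nhds \<zeta>. \<forall>k. \<phi> \<mu> k - \<psi> \<mu> k = (\<mu> - \<zeta>) ^ (d + 1) * \<omega> \<mu> k)}"

definition H_der :: "Mhat \<Rightarrow> complex \<Rightarrow> nat \<Rightarrow> family set set" where
  "H_der \<sigma> \<zeta> d = H_germ \<sigma> \<zeta> // jet_rel \<sigma> \<zeta> d"

type_synonym datum = "(Mhat \<times> complex \<times> nat) list"

definition H_sum :: "datum \<Rightarrow> family set list set" where
  "H_sum \<xi> = {x. list_all2 (\<lambda>(\<sigma>, \<zeta>, d) X. X \<in> H_der \<sigma> \<zeta> d) \<xi> x}"

definition germs :: "datum \<Rightarrow> family list set" where
  "germs \<xi> = {\<phi>s. list_all2 (\<lambda>(\<sigma>, \<zeta>, d) \<phi>. \<phi> \<in> H_germ \<sigma> \<zeta>) \<xi> \<phi>s}"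

definition jet_class :: "datum \<Rightarrow> family list \<Rightarrow> family set list" where
  "jet_class \<xi> \<phi>s = map2 (\<lambda>(\<sigma>, \<zeta>, d) \<phi>. jet_rel \<sigma> \<zeta> d `` {\<phi>}) \<xi> \<phi>s"

text \<open>The topology of \<open>H_der \<sigma> \<zeta> d\<close> is that of \<open>(H_inf \<sigma>)\<^sup>d\<^sup>+\<^sup>1\<close>, the Taylor coefficients of order
  at most \<open>d\<close> at \<open>\<zeta>\<close> serving as coordinates.\<close>
definition taylor_coeff :: "complex \<Rightarrow> nat \<Rightarrow> family \<Rightarrow> mat2 \<Rightarrow> complex" where
  "taylor_coeff \<zeta> l \<phi> = (\<lambda>k. (deriv ^^ l) (\<lambda>\<mu>. \<phi> \<mu> k) \<zeta> / fact l)"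

definition H_nbhd ::
    "datum \<Rightarrow> family set list \<Rightarrow> nat \<Rightarrow> real \<Rightarrow> family set list set" where
  "H_nbhd \<xi> x N \<epsilon> = {y \<in> H_sum \<xi>. \<forall>i<length \<xi>. \<forall>\<sigma> \<zeta> d. \<xi> ! i = (\<sigma>, \<zeta>, d) \<longrightarrow>
      (\<forall>\<phi>\<in>x!i. \<forall>\<psi>\<in>y!i. \<forall>l\<le>d. \<forall>j\<le>N. \<forall>\<theta>.
        norm (K_deriv j (taylor_coeff \<zeta> l \<phi>) \<theta> - K_deriv j (taylor_coeff \<zeta> l \<psi>) \<theta>) < \<epsilon>)}"

definition H_topology :: "datum \<Rightarrow> family set list topology" where
  "H_topology \<xi> = topology (\<lambda>S. S \<subseteq> H_sum \<xi> \<and> (\<forall>x\<in>S. \<exists>N. \<exists>\<epsilon>>0. H_nbhd \<xi> x N \<epsilon> \<subseteq> S))"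

section \<open>The intertwining condition\<close>

text \<open>The linear structure and the action of \<open>G\<close> on classes are expressed through representatives.\<close>
definition subrep :: "datum \<Rightarrow> family set list set \<Rightarrow> bool" where
  "subrep \<xi> W \<longleftrightarrow> W \<subseteq> H_sum \<xi> \<and>
     jet_class \<xi> (replicate (length \<xi>) (\<lambda>\<mu> k. 0)) \<in> W \<and>
     (\<forall>\<phi>s\<in>germs \<xi>. \<forall>\<psi>s\<in>germs \<xi>. \<forall>a b. jet_class \<xi> \<phi>s \<in> W \<longrightarrow> jet_class \<xi> \<psi>s \<in> W \<longrightarrow>
        jet_class \<xi> (map2 (\<lambda>\<phi> \<psi> \<mu> k. a * \<phi> \<mu> k + b * \<psi> \<mu> k) \<phi>s \<psi>s) \<in> W) \<and>
     (\<forall>\<phi>s\<in>germs \<xi>. \<forall>g\<in>SL2. jet_class \<xi> \<phi>s \<in> W \<longrightarrow>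
        jet_class \<xi> (map (\<lambda>\<phi> \<mu>. ps_act \<mu> g (\<phi> \<mu>)) \<phi>s) \<in> W)"

definition intertwining_datum :: "datum \<Rightarrow> family set list set \<Rightarrow> bool" where
  "intertwining_datum \<xi> W \<longleftrightarrow> subrep \<xi> W \<and> closedin (H_topology \<xi>) W \<and> W \<noteq> H_sum \<xi>"

definition Hom_germ :: "int \<Rightarrow> Mhat \<Rightarrow> complex \<Rightarrow> (complex \<Rightarrow> complex) set" where
  "Hom_germ m \<sigma> \<zeta> =
     {t. t analytic_on {\<zeta>} \<and> (\<forall>\<^sub>F \<mu> in nhds \<zeta>. t \<mu> \<in> Hom_M (delta m) (Mchar \<sigma>))}"

definition Hom_rel ::
    "int \<Rightarrow> Mhat \<Rightarrow> complex \<Rightarrow> nat \<Rightarrow> ((complex \<Rightarrow> complex) \<times> (complex \<Rightarrow> complex)) set" where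
  "Hom_rel m \<sigma> \<zeta> d = {(t, u). t \<in> Hom_germ m \<sigma> \<zeta> \<and> u \<in> Hom_germ m \<sigma> \<zeta> \<and>
      (\<exists>w\<in>Hom_germ m \<sigma> \<zeta>. \<forall>\<^sub>F \<mu> in nhds \<zeta>. t \<mu> - u \<mu> = (\<mu> - \<zeta>) ^ (d + 1) * w \<mu>)}"

definition Hom_germs :: "int \<Rightarrow> datum \<Rightarrow> (complex \<Rightarrow> complex) list set" where
  "Hom_germs m \<xi> = {ts. list_all2 (\<lambda>(\<sigma>, \<zeta>, d) t. t \<in> Hom_germ m \<sigma> \<zeta>) \<xi> ts}"

definition Hom_class ::
    "int \<Rightarrow> datum \<Rightarrow> (complex \<Rightarrow> complex) list \<Rightarrow> (complex \<Rightarrow> complex) set list" where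
  "Hom_class m \<xi> ts = map2 (\<lambda>(\<sigma>, \<zeta>, d) t. Hom_rel m \<sigma> \<zeta> d `` {t}) \<xi> ts"

definition frobenius :: "int \<Rightarrow> complex \<Rightarrow> (complex \<Rightarrow> complex) \<Rightarrow> family" where
  "frobenius m v t = (\<lambda>\<mu> k. if k \<in> Kgrp then t \<mu> * (inverse (delta m k) * v) else 0)"

definition D_space ::
    "datum \<Rightarrow> family set list set \<Rightarrow> int \<Rightarrow> (complex \<Rightarrow> complex) set list set" where
  "D_space \<xi> W m = {Hom_class m \<xi> ts | ts.
      ts \<in> Hom_germs m \<xi> \<and> (\<forall>v. jet_class \<xi> (map (frobenius m v) ts) \<in> W)}"

text \<open>Condition (D.3) for \<open>\<gamma> = \<delta>\<^sub>n\<close> and \<open>\<tau> = \<delta>\<^sub>m\<close>. Composition of linear maps is multiplication of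
  scalars.\<close>
definition D3 :: "int \<Rightarrow> int \<Rightarrow> (complex \<Rightarrow> complex) \<Rightarrow> bool" where
  "D3 n m \<phi> \<longleftrightarrow> (\<forall>\<xi> W. intertwining_datum \<xi> W \<longrightarrow>
     (\<forall>ts\<in>Hom_germs m \<xi>. Hom_class m \<xi> ts \<in> D_space \<xi> W m \<longrightarrow>
        Hom_class m \<xi> ts \<noteq> Hom_class m \<xi> (replicate (length \<xi>) (\<lambda>\<mu>. 0)) \<longrightarrow>
        Hom_class n \<xi> (map (\<lambda>t \<mu>. t \<mu> * \<phi> \<mu>) ts) \<in> D_space \<xi> W n))"

section \<open>The polynomials \<open>q\<^sub>n\<^sub>,\<^sub>m\<close>\<close>

text \<open>The numbers of factors are \<open>(\<bar>n\<bar> - \<bar>m\<bar>)/2\<close>, \<open>(\<bar>m\<bar> - \<bar>n\<bar>)/2\<close> and \<open>(\<bar>n\<bar> + \<bar>m\<bar>)/2\<close>, respectively.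
  If \<open>n\<close> or \<open>m\<close> is \<open>0\<close>, the signs count as equal.\<close>
definition qpoly :: "int \<Rightarrow> int \<Rightarrow> complex \<Rightarrow> complex" where
  "qpoly n m \<zeta> =
    (if n = m then 1
     else if \<bar>n\<bar> > \<bar>m\<bar> \<and> n * m \<ge> 0 then
       (\<Prod>j<nat ((\<bar>n\<bar> - \<bar>m\<bar>) div 2). \<zeta> + (of_int \<bar>m\<bar> + 1) / 2 + of_nat j)
     else if \<bar>n\<bar> < \<bar>m\<bar> \<and> n * m \<ge> 0 then
       (\<Prod>j<nat ((\<bar>m\<bar> - \<bar>n\<bar>) div 2). \<zeta> - (of_int \<bar>n\<bar> + 1) / 2 - of_nat j)
     else
       (\<Prod>j<nat ((\<bar>n\<bar> + \<bar>m\<bar>) div 2). \<zeta> + (of_int \<bar>n\<bar> - 1) / 2 - of_nat j))"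

section \<open>Consistency of the conventions\<close>

lemma mat2_eq_iff:
  "(x::mat2) = y \<longleftrightarrow> x$1$1 = y$1$1 \<and> x$1$2 = y$1$2 \<and> x$2$1 = y$2$1 \<and> x$2$2 = y$2$2"
  by (simp add: vec_eq_iff forall_2)

lemma mat2_mult_nth: "((x::mat2) ** y)$i$j = x$i$1 * y$1$j + x$i$2 * y$2$j"
  by (simp add: matrix_matrix_mult_def sum_2)

lemma rot_nth [simp]:
  "rot \<theta> $ 1 $ 1 = cos \<theta>" "rot \<theta> $ 1 $ 2 = sin \<theta>"
  "rot \<theta> $ 2 $ 1 = - sin \<theta>" "rot \<theta> $ 2 $ 2 = cos \<theta>"
  by (simp_all add: rot_def)

lemma diagm_nth [simp]:
  "diagm t $ 1 $ 1 = exp t" "diagm t $ 1 $ 2 = 0" "diagm t $ 2 $ 1 = 0" "diagm t $ 2 $ 2 = exp (- t)"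
  by (simp_all add: diagm_def)

lemma unip_nth [simp]:
  "unip u $ 1 $ 1 = 1" "unip u $ 1 $ 2 = u" "unip u $ 2 $ 1 = 0" "unip u $ 2 $ 2 = 1"
  by (simp_all add: unip_def)

lemma mat_1_nth [simp]:
  "(mat 1 :: mat2) $ 1 $ 1 = 1" "(mat 1 :: mat2) $ 1 $ 2 = 0"
  "(mat 1 :: mat2) $ 2 $ 1 = 0" "(mat 1 :: mat2) $ 2 $ 2 = 1"
  by (simp_all add: mat_def)

lemma delta_rot: "delta n (rot \<theta>) = cis (of_int n * \<theta>)"
proof -
  have "Complex (cos \<theta>) (sin \<theta>) = cis \<theta>" by (simp add: complex_eq_iff)
  then show ?thesis by (simp add: delta_def cis_power_int)
qed

lemma Apow_diagm: "Apow (diagm t) z = exp (2 * of_real t * z)"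
  by (simp add: Apow_def mult_ac)

lemma Apow_diagm_add: "Apow (diagm (s + t)) z = Apow (diagm s) z * Apow (diagm t) z"
  by (simp add: Apow_diagm distrib_left distrib_right exp_add)

lemma iwK_in_K:
  assumes "x \<in> SL2" shows "iwK x \<in> Kgrp"
proof -
  define r where "r = sqrt ((x$1$1)\<^sup>2 + (x$2$1)\<^sup>2)"
  have "x$1$1 \<noteq> 0 \<or> x$2$1 \<noteq> 0" using assms by (auto simp: SL2_def det_2)
  then have r: "r > 0" "r\<^sup>2 = (x$1$1)\<^sup>2 + (x$2$1)\<^sup>2"
    by (auto simp: r_def sum_power2_gt_zero_iff)
  have "(x$1$1 / r)\<^sup>2 + (- (x$2$1 / r))\<^sup>2 = 1"
    using zero_less_power [OF r(1), of 2] by (simp add: power_divide r(2) [symmetric] flip: add_divide_distrib)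
  then obtain t where "x$1$1 / r = cos t" "- (x$2$1 / r) = sin t"
    using sincos_total_2pi by metis
  then have "iwK x = rot t"
    by (simp add: iwK_def mat2_eq_iff r_def [symmetric] Let_def)
  then show ?thesis by (simp add: Kgrp_def)
qed

lemma iwasawa_unique:
  assumes "k \<in> Kgrp" "a \<in> Agrp" "u \<in> Ngrp"
  shows "iwK (k ** a ** u) = k" "iwA (k ** a ** u) = a"
proof -
  obtain \<theta> t s where kau: "k = rot \<theta>" "a = diagm t" "u = unip s"
    using assms by (auto simp: Kgrp_def Agrp_def Ngrp_def)
  have "(cos \<theta> * exp t)\<^sup>2 + (sin \<theta> * exp t)\<^sup>2 = ((cos \<theta>)\<^sup>2 + (sin \<theta>)\<^sup>2) * (exp t)\<^sup>2"
    by (simp only: power_mult_distrib distrib_right)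
  then have "sqrt ((cos \<theta> * exp t)\<^sup>2 + (sin \<theta> * exp t)\<^sup>2) = exp t" by simp
  then show "iwK (k ** a ** u) = k" "iwA (k ** a ** u) = a"
    by (simp_all add: kau iwK_def iwA_def mat2_eq_iff mat2_mult_nth)
qed

lemma iwasawa:
  assumes "x \<in> SL2"
  shows "iwK x \<in> Kgrp" "iwA x \<in> Agrp" "\<exists>u\<in>Ngrp. x = iwK x ** iwA x ** u"
proof -
  show "iwK x \<in> Kgrp" by (rule iwK_in_K [OF assms])
  show "iwA x \<in> Agrp" by (simp add: iwA_def Agrp_def)
  define r where "r = sqrt ((x$1$1)\<^sup>2 + (x$2$1)\<^sup>2)"
  have d: "x$1$1 * x$2$2 - x$1$2 * x$2$1 = 1" using assms by (simp add: SL2_def det_2)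
  then have "x$1$1 \<noteq> 0 \<or> x$2$1 \<noteq> 0" by auto
  then have r: "r > 0" "r * r = (x$1$1)\<^sup>2 + (x$2$1)\<^sup>2"
    by (auto simp: r_def sum_power2_gt_zero_iff)
  define s where "s = (x$1$1 * x$1$2 + x$2$1 * x$2$2) / (r * r)"
  have e: "exp (- ln r) = 1 / r" using r(1) by (simp add: exp_minus inverse_eq_divide)
  have s: "s * (r * r) = x$1$1 * x$1$2 + x$2$1 * x$2$2" using r(1) by (simp add: s_def)
  have "(x$1$1 * s * (r * r)) - x$2$1 = x$1$2 * (r * r)"
    using s r(2) d by algebra
  then have 1: "x$1$1 * s - x$2$1 / (r * r) = x$1$2" using r(1) by (simp add: field_simps)
  have "(x$2$1 * s * (r * r)) + x$1$1 = x$2$2 * (r * r)"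
    using s r(2) d by algebra
  then have 2: "x$2$1 * s + x$1$1 / (r * r) = x$2$2" using r(1) by (simp add: field_simps)
  have "x = iwK x ** iwA x ** unip s"
    using 1 2 r(1) e
    by (simp add: iwK_def iwA_def mat2_eq_iff mat2_mult_nth r_def [symmetric] Let_def)
  then show "\<exists>u\<in>Ngrp. x = iwK x ** iwA x ** u" by (auto simp: Ngrp_def)
qed

lemma ps_extend_equivariant:
  assumes "f \<in> H_inf \<sigma>" "x \<in> SL2" "e \<in> Mgrp" "a \<in> Agrp" "u \<in> Ngrp"
  shows "ps_extend \<zeta> f (x ** e ** a ** u) =
      Apow a (- (\<zeta> + 1/2)) * inverse (Mchar \<sigma> e) * ps_extend \<zeta> f x"
proof -
  obtain t s where au: "a = diagm t" "u = unip s" using assms by (auto simp: Agrp_def Ngrp_def)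
  obtain c :: real where c: "c = 1 \<or> c = -1" "e$1$1 = c" "e$1$2 = 0" "e$2$1 = 0" "e$2$2 = c"
    using assms(3) by (auto simp: Mgrp_def)
  define r where "r = sqrt ((x$1$1)\<^sup>2 + (x$2$1)\<^sup>2)"
  have "x$1$1 \<noteq> 0 \<or> x$2$1 \<noteq> 0" using assms(2) by (auto simp: SL2_def det_2)
  then have r: "r > 0" by (auto simp: r_def sum_power2_gt_zero_iff)
  define y where "y = x ** e ** a ** u"
  have y: "y$1$1 = x$1$1 * c * exp t" "y$2$1 = x$2$1 * c * exp t"
    by (simp_all add: y_def au c mat2_mult_nth)
  have "(y$1$1)\<^sup>2 + (y$2$1)\<^sup>2 = ((x$1$1)\<^sup>2 + (x$2$1)\<^sup>2) * (exp t)\<^sup>2"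
    using c(1) by (auto simp: y power_mult_distrib algebra_simps)
  then have ry: "sqrt ((y$1$1)\<^sup>2 + (y$2$1)\<^sup>2) = r * exp t"
    by (simp add: r_def real_sqrt_mult)
  have A: "iwA y = diagm (ln r + t)"
    using r by (simp add: iwA_def ry ln_mult)
  have K: "iwK y = iwK x ** e"
    using r by (simp add: iwK_def ry ry [unfolded y] mat2_eq_iff mat2_mult_nth c y Let_def r_def [symmetric])
  have "f (iwK x ** e) = inverse (Mchar \<sigma> e) * f (iwK x)"
    using assms iwK_in_K by (auto simp: H_inf_def)
  moreover have "iwA x = diagm (ln r)" by (simp add: iwA_def r_def)
  ultimately show ?thesis
    unfolding y_def [symmetric]
    by (simp add: ps_extend_def A K au Apow_diagm_add mult_ac)
qed

lemma ps_extend_on_K: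
  assumes "k \<in> Kgrp" shows "ps_extend \<zeta> f k = f k"
proof -
  obtain \<theta> where k: "k = rot \<theta>" using assms by (auto simp: Kgrp_def)
  have "sqrt ((cos \<theta>)\<^sup>2 + (sin \<theta>)\<^sup>2) = 1" by simp
  then have "iwK k = k" "iwA k = diagm 0"
    by (simp_all add: k iwK_def iwA_def mat2_eq_iff)
  then show ?thesis by (simp add: ps_extend_def Apow_diagm)
qed

lemma Hom_M_delta:
  assumes "[n = m] (mod 2)" shows "Hom_M (delta n) (delta m) = UNIV"
proof -
  have "Complex 1 0 = 1" "Complex (- 1) 0 = - 1" by (simp_all add: complex_eq_iff)
  moreover have "even n \<longleftrightarrow> even m"
    using assms by (simp add: cong_def even_iff_mod_2_eq_zero)
  then have "(-1::complex) powi n = (-1) powi m" by (simp add: power_int_minus_left)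
  ultimately show ?thesis
    by (auto simp: Hom_M_def Mgrp_def delta_def)
qed

lemma H_nbhd_mono:
  assumes "N \<le> N'" "\<epsilon>' \<le> \<epsilon>"
  shows "H_nbhd \<xi> x N' \<epsilon>' \<subseteq> H_nbhd \<xi> x N \<epsilon>"
  unfolding H_nbhd_def
  by (blast intro: less_le_trans [OF _ assms(2)] order_trans [OF _ assms(1)])

lemma istopology_H:
  "istopology (\<lambda>S. S \<subseteq> H_sum \<xi> \<and> (\<forall>x\<in>S. \<exists>N. \<exists>\<epsilon>>0. H_nbhd \<xi> x N \<epsilon> \<subseteq> S))"
  (is "istopology ?P")
proof -
  have "?P (S \<inter> T)" if S: "?P S" and T: "?P T" for S T
  proof (intro conjI ballI)
    show "S \<inter> T \<subseteq> H_sum \<xi>" using S by blast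
    fix x assume x: "x \<in> S \<inter> T"
    obtain N1 e1 where 1: "e1 > 0" "H_nbhd \<xi> x N1 e1 \<subseteq> S" using S x by blast
    obtain N2 e2 where 2: "e2 > 0" "H_nbhd \<xi> x N2 e2 \<subseteq> T" using T x by blast
    have "H_nbhd \<xi> x (max N1 N2) (min e1 e2) \<subseteq> S \<inter> T"
      using 1(2) 2(2) H_nbhd_mono [of N1 "max N1 N2" "min e1 e2" e1 \<xi> x]
        H_nbhd_mono [of N2 "max N1 N2" "min e1 e2" e2 \<xi> x] by simp blast
    moreover have "min e1 e2 > 0" using 1(1) 2(1) by simp
    ultimately show "\<exists>N. \<exists>\<epsilon>>0. H_nbhd \<xi> x N \<epsilon> \<subseteq> S \<inter> T" by blast
  qed
  moreover have "?P (\<Union>\<S>)" if S: "\<forall>S\<in>\<S>. ?P S" for \<S>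
  proof (intro conjI ballI)
    show "\<Union>\<S> \<subseteq> H_sum \<xi>" using S by blast
    fix x assume "x \<in> \<Union>\<S>"
    then obtain S where S': "S \<in> \<S>" "x \<in> S" by blast
    then obtain N \<epsilon> where "\<epsilon> > 0" "H_nbhd \<xi> x N \<epsilon> \<subseteq> S" using S by blast
    then show "\<exists>N. \<exists>\<epsilon>>0. H_nbhd \<xi> x N \<epsilon> \<subseteq> \<Union>\<S>" using S'(1) by blast
  qed
  ultimately show ?thesis unfolding istopology_def by blast
qed

lemma openin_H_topology:
  "openin (H_topology \<xi>) S \<longleftrightarrow> S \<subseteq> H_sum \<xi> \<and> (\<forall>x\<in>S. \<exists>N. \<exists>\<epsilon>>0. H_nbhd \<xi> x N \<epsilon> \<subseteq> S)"
  unfolding H_topology_def by (simp add: istopology_H)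

lemma topspace_H_topology: "topspace (H_topology \<xi>) = H_sum \<xi>"
proof -
  have "openin (H_topology \<xi>) (H_sum \<xi>)"
    unfolding openin_H_topology H_nbhd_def by (auto intro: exI[of _ 1])
  then show ?thesis unfolding topspace_def using openin_H_topology by blast
qed

end

theory Submission
  imports Defs
begin

text \<open>
  Let \<open>p\<^sub>m\<close> be the function \<open>k\<^sub>\<theta> \<mapsto> exp (- i m \<theta>)\<close> on \<open>K\<close>. The Lie algebra of \<open>A\<close> sends
  \<open>p\<^sub>m\<close> to \<open>(\<lambda> + (1 - m)/2) p\<^sub>m\<^sub>-\<^sub>2 + (\<lambda> + (m + 1)/2) p\<^sub>m\<^sub>+\<^sub>2\<close>, and \<open>q\<^sub>n\<^sub>,\<^sub>m\<close> is the product of these scalars along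
  the shortest path of weights from \<open>m\<close> to \<open>n\<close>; going up and down once costs a polynomial in \<open>\<lambda>\<^sup>2\<close>.

  Sufficiency: a closed invariant subspace \<open>W\<close> that contains \<open>(t\<^sub>i p\<^sub>m)\<^sub>i\<close> is stable under the two
  ladder operators, hence contains \<open>(t\<^sub>i q\<^sub>n\<^sub>,\<^sub>m p\<^sub>n)\<^sub>i\<close> and \<open>(t\<^sub>i P(\<lambda>\<^sup>2) p\<^sub>m)\<^sub>i\<close> for every polynomial \<open>P\<close>; on
  the finitely many jets involved an even function agrees with such a \<open>P(\<lambda>\<^sup>2)\<close>.

  Necessity: every derivative at \<open>s = 0\<close> of the matrix coefficient of \<open>diagm s\<close> between \<open>p\<^sub>m\<close> and \<open>p\<^sub>n\<close>
  is \<open>q\<^sub>n\<^sub>,\<^sub>m(\<lambda>)\<close> times an even polynomial. So if \<open>t\<^sub>1 q\<^sub>n\<^sub>,\<^sub>m(\<lambda>) + t\<^sub>2 q\<^sub>n\<^sub>,\<^sub>m(-\<lambda>) = 0\<close>, then \<open>(t\<^sub>1 p\<^sub>m, t\<^sub>2 p\<^sub>m)\<close> lies in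
  the invariant subspace of those \<open>(f, g)\<close>, with \<open>f\<close> and \<open>g\<close> in the principal series at \<open>\<lambda>\<close> and \<open>-\<lambda>\<close>,
  such that the \<open>n\<close>-th Fourier coefficients of all translates of \<open>f\<close> and \<open>g\<close> add up to \<open>0\<close>. Condition
  (D.3) then gives \<open>t\<^sub>1 \<phi>(\<lambda>) + t\<^sub>2 \<phi>(-\<lambda>) = 0\<close>: \<open>\<phi>\<close> vanishes at the zeros of \<open>q\<^sub>n\<^sub>,\<^sub>m\<close>, which are simple,
  and the quotient is even. No intertwining integral is needed.
\<close>

section \<open>Smooth functions of an angle and their convergence\<close>

text \<open>A subspace \<open>W\<close> is given as stable under the group, not under the Lie
  algebra, and its closedness refers to all angular derivatives of all Taylor coefficients in
  \<lambda>. The ladder operators are therefore reached as limits of difference quotients along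
  \<open>diagm s\<close>. Making the group parameter, the angle and \<lambda> complex turns this
  into one sup bound: the error of the quotient is O(s) on a complex neighbourhood of the real
  angles and of the parameter, and Cauchy's estimates then control every derivative in the angle and
  in \<lambda>. This works because the translates of a weight vector have a closed form.

  In the converse direction jets of order 0 at a pair \<lambda>, -\<lambda> suffice. The Cartan
  decomposition reduces all translates to \<open>diagm s\<close>, and a matrix coefficient is
  holomorphic in \<open>s\<close> on a strip, so its derivatives at 0 determine it. The pair
  \<open>t1 = q(-\<lambda>)\<close>, \<open>t2 = - q(\<lambda>)\<close> always satisfies the linear
  relation and compares the values of \<phi> at \<lambda> and -\<lambda>; where both vanish,
  evenness of the quotient follows by continuity.\<close>

definition rderiv :: "(real \<Rightarrow> complex) \<Rightarrow> real \<Rightarrow> complex" where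
  "rderiv F = (\<lambda>t. vector_derivative F (at t))"

lemma rderiv_eqI: "(\<And>t. (F has_vector_derivative G t) (at t)) \<Longrightarrow> rderiv F = G"
  by (simp add: rderiv_def vector_derivative_at fun_eq_iff)

text \<open>Boundedness is part of the notion because uniform limits of products need bounded
  limits. The functions live on the line rather than on the circle so that they can be composed with
  the lift of a circle map, which is not periodic.\<close>

fun BCk :: "nat \<Rightarrow> (real \<Rightarrow> complex) \<Rightarrow> bool" where
  "BCk 0 F \<longleftrightarrow> bounded (range F)"
| "BCk (Suc k) F \<longleftrightarrow> bounded (range F) \<and> (\<forall>t. F differentiable (at t)) \<and> BCk k (rderiv F)"

definition BCinf :: "(real \<Rightarrow> complex) \<Rightarrow> bool" where
  "BCinf F \<longleftrightarrow> (\<forall>k. BCk k F)"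

lemma BCk_SucI:
  "bounded (range F) \<Longrightarrow> (\<And>t. (F has_vector_derivative G t) (at t)) \<Longrightarrow> BCk k G \<Longrightarrow> BCk (Suc k) F"
  using rderiv_eqI[of F G] by (auto intro: differentiableI_vector)

lemma BCk_Suc_imp: "BCk (Suc k) F \<Longrightarrow> BCk k F"
  by (induction k arbitrary: F) auto

lemma BCk_bounded: "BCk k F \<Longrightarrow> bounded (range F)"
  by (cases k) auto

lemma BCk_deriv: "BCk (Suc k) F \<Longrightarrow> (F has_vector_derivative rderiv F t) (at t)"
  by (simp add: rderiv_def vector_derivative_works)

text \<open>Smoothness of a bounded function reduces to that of its derivative. This covers
  functions such as the logarithm of \<open>colsq\<close>, whose derivative is algebraic in smooth
  functions.\<close>

lemma BCinf_iff: "BCinf F \<longleftrightarrow> bounded (range F) \<and> (\<forall>t. F differentiable (at t)) \<and> BCinf (rderiv F)"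
  unfolding BCinf_def by (metis BCk.elims(3) BCk.simps(2) BCk_bounded)

lemma BCinf_bounded: "BCinf F \<Longrightarrow> bounded (range F)" and BCinf_rderiv: "BCinf F \<Longrightarrow> BCinf (rderiv F)"
  using BCinf_iff by blast+

lemma BCinf_deriv: "BCinf F \<Longrightarrow> (F has_vector_derivative rderiv F t) (at t)"
  unfolding BCinf_def using BCk_deriv by blast

lemma BCinf_funpow: "BCinf F \<Longrightarrow> BCinf ((rderiv ^^ j) F)"
  by (induction j) (auto simp: BCinf_rderiv)

lemma sbI_funpow:
  assumes "\<And>j t. (rderiv ^^ j) F differentiable (at t)" "\<And>j. bounded (range ((rderiv ^^ j) F))"
  shows "BCinf F"
proof -
  have "BCk k ((rderiv ^^ j) F)" for k j
  proof (induction k arbitrary: j)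
    case (Suc k)
    show ?case using Suc[of "Suc j"] assms by simp
  qed (use assms in simp)
  from this[of _ 0] show ?thesis by (simp add: BCinf_def)
qed

lemma BCk_add: "BCk k F \<Longrightarrow> BCk k G \<Longrightarrow> BCk k (\<lambda>t. F t + G t)"
proof (induction k arbitrary: F G)
  case (Suc k)
  show ?case
  proof (rule BCk_SucI)
    show "bounded (range (\<lambda>t. F t + G t))"
      using Suc.prems by (intro bounded_plus_comp BCk_bounded)
    show "((\<lambda>t. F t + G t) has_vector_derivative rderiv F t + rderiv G t) (at t)" for t
      by (intro derivative_intros BCk_deriv) (rule Suc.prems)+
    show "BCk k (\<lambda>t. rderiv F t + rderiv G t)" using Suc by simp
  qed
qed (auto intro: bounded_plus_comp)

lemma bounded_times_comp:
  fixes F G :: "real \<Rightarrow> complex"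
  assumes "bounded (range F)" "bounded (range G)" shows "bounded (range (\<lambda>t. F t * G t))"
proof -
  obtain a b where "\<And>t. norm (F t) \<le> a" "\<And>t. norm (G t) \<le> b"
    using assms by (auto simp: bounded_iff)
  then have "norm (F t * G t) \<le> a * b" for t
    by (simp add: norm_mult) (meson mult_mono' norm_ge_zero order_trans)
  then show ?thesis by (auto simp: bounded_iff)
qed

lemma BCk_mult: "BCk k F \<Longrightarrow> BCk k G \<Longrightarrow> BCk k (\<lambda>t. F t * G t)"
proof (induction k arbitrary: F G)
  case (Suc k)
  show ?case
  proof (rule BCk_SucI)
    show "bounded (range (\<lambda>t. F t * G t))"
      using Suc.prems by (intro bounded_times_comp BCk_bounded)
    show "((\<lambda>t. F t * G t) has_vector_derivative F t * rderiv G t + rderiv F t * G t) (at t)" for t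
      by (intro has_vector_derivative_mult BCk_deriv) (rule Suc.prems)+
    show "BCk k (\<lambda>t. F t * rderiv G t + rderiv F t * G t)"
      using Suc BCk_Suc_imp by (intro BCk_add Suc.IH) auto
  qed
qed (auto intro: bounded_times_comp)

lemma rderiv_const: "rderiv (\<lambda>t. c) = (\<lambda>t. 0)"
  by (intro rderiv_eqI) (rule derivative_intros)

lemma BCk_const: "BCk k (\<lambda>t. c)"
  by (induction k arbitrary: c) (auto simp: rderiv_const image_constant_conv)

lemma BCinf_const: "BCinf (\<lambda>t. c)" by (simp add: BCinf_def BCk_const)
lemma BCinf_add: "BCinf F \<Longrightarrow> BCinf G \<Longrightarrow> BCinf (\<lambda>t. F t + G t)" by (simp add: BCinf_def BCk_add)
lemma BCinf_mult: "BCinf F \<Longrightarrow> BCinf G \<Longrightarrow> BCinf (\<lambda>t. F t * G t)" by (simp add: BCinf_def BCk_mult)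

lemma rderiv_add: "BCinf F \<Longrightarrow> BCinf G \<Longrightarrow> rderiv (\<lambda>t. F t + G t) = (\<lambda>t. rderiv F t + rderiv G t)"
  by (intro rderiv_eqI derivative_intros BCinf_deriv)
lemma rderiv_mult: "BCinf F \<Longrightarrow> BCinf G \<Longrightarrow> rderiv (\<lambda>t. F t * G t) = (\<lambda>t. F t * rderiv G t + rderiv F t * G t)"
  by (intro rderiv_eqI has_vector_derivative_mult BCinf_deriv)
lemma rderiv_cmult: "BCinf F \<Longrightarrow> rderiv (\<lambda>t. c * F t) = (\<lambda>t. c * rderiv F t)"
  using rderiv_mult[OF BCinf_const[of c]] by (simp add: rderiv_const)

text \<open>The bounds concern the derivative \<open>b\<close> of the change of variable and not
  \<open>a\<close> itself: the lift of a circle diffeomorphism grows linearly.\<close>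

lemma BCinf_compose:
  fixes a b :: "real \<Rightarrow> real"
  assumes F: "BCinf F" and b: "BCinf (\<lambda>t. of_real (b t))"
    and a: "\<And>t. (a has_real_derivative b t) (at t)"
  shows "BCinf (\<lambda>t. F (a t))"
    and "rderiv (\<lambda>t. F (a t)) = (\<lambda>t. of_real (b t) * rderiv F (a t))"
proof -
  have deriv: "((\<lambda>t. G (a t)) has_vector_derivative of_real (b t) * rderiv G (a t)) (at t)" if "BCinf G" for G t
    using vector_diff_chain_at[of a "b t" t G "rderiv G (a t)"] a BCinf_deriv[OF that]
    by (simp add: o_def has_real_derivative_iff_has_vector_derivative scaleR_conv_of_real)
  then show "rderiv (\<lambda>t. F (a t)) = (\<lambda>t. of_real (b t) * rderiv F (a t))"
    using F by (intro rderiv_eqI)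
  have bd: "bounded (range (\<lambda>t. G (a t)))" if "BCinf G" for G
    using BCinf_bounded[OF that] by (rule bounded_subset) auto
  have "BCk k (\<lambda>t. G (a t))" if "BCinf G" for k G
    using that
  proof (induction k arbitrary: G)
    case (Suc k)
    show ?case
      by (rule BCk_SucI[OF bd deriv]) (use Suc b in \<open>auto intro!: BCk_mult BCinf_rderiv simp: BCinf_def[of "\<lambda>t. of_real (b t)"]\<close>)
  qed (use bd in simp)
  then show "BCinf (\<lambda>t. F (a t))" using F by (simp add: BCinf_def)
qed

lemma BCinf_exp: assumes A: "BCinf A" shows "BCinf (\<lambda>t. exp (A t))"
proof -
  have deriv: "((\<lambda>t. exp (A t)) has_vector_derivative rderiv A t * exp (A t)) (at t)" for t
    using field_vector_diff_chain_at[of A "rderiv A t" t exp "exp (A t)"] BCinf_deriv[OF A]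
    by (auto simp: o_def intro: DERIV_exp)
  obtain B where B: "\<And>t. norm (A t) \<le> B" using BCinf_bounded[OF A] by (auto simp: bounded_iff)
  have bd: "bounded (range (\<lambda>t. exp (A t)))"
    unfolding bounded_iff
    by (rule exI[of _ "exp B"]) (auto, meson B abs_Re_le_cmod abs_le_D1 order_trans)
  have "BCk k (\<lambda>t. exp (A t))" for k
  proof (induction k)
    case (Suc k)
    show ?case by (rule BCk_SucI[OF bd deriv]) (use Suc A BCinf_rderiv[OF A] in \<open>auto intro!: BCk_mult simp: BCinf_def\<close>)
  qed (use bd in simp)
  then show ?thesis by (simp add: BCinf_def)
qed

lemma rderiv_exp: "BCinf A \<Longrightarrow> rderiv (\<lambda>t. exp (A t)) = (\<lambda>t. rderiv A t * exp (A t))"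
  using field_vector_diff_chain_at[of A "rderiv A _" _ exp "exp (A _)"] BCinf_deriv[of A]
  by (intro rderiv_eqI) (auto simp: o_def intro: DERIV_exp)

text \<open>The derivative of \<open>1 / R\<close> is a polynomial in \<open>1 / R\<close> and the
  derivative of \<open>R\<close>, so an induction on the order can use the function itself.\<close>

lemma BCinf_inverse:
  assumes R: "BCinf R" "\<And>t. R t \<noteq> 0" and bd: "bounded (range (\<lambda>t. inverse (R t)))"
  shows "BCinf (\<lambda>t. inverse (R t))"
proof -
  have deriv: "((\<lambda>t. inverse (R t)) has_vector_derivative rderiv R t * ((-1) * (inverse (R t) * inverse (R t)))) (at t)" for t
    using field_vector_diff_chain_at[of R "rderiv R t" t inverse "- (inverse (R t) * inverse (R t))"] BCinf_deriv[OF R(1)]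
      DERIV_inverse'[OF DERIV_ident R(2)[of t]]
    by (auto simp: o_def)
  have "BCk k (\<lambda>t. inverse (R t))" for k
  proof (induction k)
    case (Suc k)
    show ?case
    proof (rule BCk_SucI[OF bd deriv])
      show "BCk k (\<lambda>t. rderiv R t * ((-1) * (inverse (R t) * inverse (R t))))"
        using Suc BCinf_rderiv[OF R(1)] by (intro BCk_mult BCk_const Suc) (auto simp: BCinf_def)
    qed
  qed (use bd in simp)
  then show ?thesis by (simp add: BCinf_def)
qed

lemma bounded_periodic:
  fixes F :: "real \<Rightarrow> complex"
  assumes per: "\<And>t. F (t + 2 * pi) = F t" and cont: "continuous_on UNIV F"
  shows "bounded (range F)"
proof -
  have nat: "F (t + 2 * pi * real n) = F t" for t and n :: nat
  proof (induction n)
    case (Suc n)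
    show ?case using per[of "t + 2 * pi * real n"] Suc by (simp add: algebra_simps)
  qed simp
  have int: "F (t + 2 * pi * of_int n) = F t" for t and n :: int
  proof (cases "n \<ge> 0")
    case True then show ?thesis using nat[of t "nat n"] by simp
  next
    case False then show ?thesis using nat[of "t + 2 * pi * of_int n" "nat (- n)"] by (simp add: algebra_simps)
  qed
  have "range F \<subseteq> F ` {0..2 * pi}"
  proof
    fix y assume "y \<in> range F"
    then obtain t where t: "y = F t" by auto
    define n where "n = \<lfloor>t / (2 * pi)\<rfloor>"
    have n: "of_int n \<le> t / (2 * pi)" "t / (2 * pi) < of_int n + 1" by (auto simp: n_def)
    then have "t - 2 * pi * of_int n \<in> {0..2 * pi}" by (auto simp: field_simps)
    moreover have "y = F (t - 2 * pi * of_int n)" using int[of "t - 2 * pi * of_int n" n] t by simp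
    ultimately show "y \<in> F ` {0..2 * pi}" by blast
  qed
  moreover have "bounded (F ` {0..2 * pi})"
    using cont by (intro compact_imp_bounded compact_continuous_image) (auto intro: continuous_on_subset)
  ultimately show ?thesis by (rule bounded_subset[rotated])
qed

lemma rderiv_periodic:
  assumes per: "\<And>t. F (t + 2 * pi) = F t" and d: "\<And>t. F differentiable (at t)"
  shows "rderiv F (t + 2 * pi) = rderiv F t"
proof -
  have "(F has_vector_derivative rderiv F (t + 2 * pi)) (at (t + 2 * pi))"
    using d[of "t + 2 * pi"] by (simp add: rderiv_def vector_derivative_works)
  moreover have "((\<lambda>t. t + 2 * pi) has_vector_derivative 1) (at t)"
    by (rule derivative_eq_intros refl | simp)+
  ultimately have "(F has_vector_derivative rderiv F (t + 2 * pi)) (at t)"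
    using vector_diff_chain_at[of "\<lambda>t. t + 2 * pi" 1 t F "rderiv F (t + 2 * pi)"] per
    by (simp add: o_def)
  then show ?thesis by (simp add: rderiv_def vector_derivative_at)
qed

text \<open>Differentiation preserves the period, so each derivative is bounded by its values on one
  compact period. This is why \<open>smooth_K\<close>, which asks for no bounds, gives
  \<open>BCinf\<close>.\<close>

lemma BCinf_periodic:
  assumes per: "\<And>t. F (t + 2 * pi) = F t" and d: "\<And>j t. (rderiv ^^ j) F differentiable (at t)"
  shows "BCinf F"
proof (rule sbI_funpow[OF d])
  fix j
  have "(rderiv ^^ j) F (t + 2 * pi) = (rderiv ^^ j) F t" for t
  proof (induction j arbitrary: t)
    case (Suc j) then show ?case using rderiv_periodic[of "(rderiv ^^ j) F" t] d by simp
  qed (simp add: per)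
  moreover have "continuous_on UNIV ((rderiv ^^ j) F)"
    using d differentiable_imp_continuous_on differentiable_on_def
    by (metis differentiable_at_withinI)
  ultimately show "bounded (range ((rderiv ^^ j) F))" by (intro bounded_periodic)
qed

section \<open>Uniform convergence of derivatives\<close>

fun Ck_conv :: "nat \<Rightarrow> ('a \<Rightarrow> real \<Rightarrow> complex) \<Rightarrow> (real \<Rightarrow> complex) \<Rightarrow> 'a filter \<Rightarrow> bool" where
  "Ck_conv 0 F f \<F> \<longleftrightarrow> uniform_limit UNIV F f \<F>"
| "Ck_conv (Suc k) F f \<F> \<longleftrightarrow> uniform_limit UNIV F f \<F> \<and> Ck_conv k (\<lambda>x. rderiv (F x)) (rderiv f) \<F>"

text \<open>The recursion of \<open>Ck_conv\<close> follows the product and chain rules; the closed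
  form is the one that \<open>tendsto_Cinf\<close> is made of.\<close>

lemma Ck_conv_iff: "Ck_conv k F f \<F> \<longleftrightarrow>
    (\<forall>j\<le>k. uniform_limit UNIV (\<lambda>x. (rderiv ^^ j) (F x)) ((rderiv ^^ j) f) \<F>)"
proof (induction k arbitrary: F f)
  case (Suc k)
  have "{..Suc k} = insert 0 (Suc ` {..k})" by (metis atMost_Suc_eq_insert_0)
  then have *: "(\<forall>j\<le>Suc k. P j) \<longleftrightarrow> P 0 \<and> (\<forall>j\<le>k. P (Suc j))" for P :: "nat \<Rightarrow> bool"
    by (metis Suc_le_mono bot_nat_0.extremum not0_implies_Suc)
  show ?case unfolding * using Suc by (simp add: funpow_Suc_right del: funpow.simps(2))
qed simp

lemma Ck_conv_0: "Ck_conv k F f \<F> \<Longrightarrow> uniform_limit UNIV F f \<F>"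
  by (cases k) auto

lemma Ck_conv_Suc_imp: "Ck_conv (Suc k) F f \<F> \<Longrightarrow> Ck_conv k F f \<F>"
  by (simp add: Ck_conv_iff del: Ck_conv.simps)

lemma Ck_conv_cong: "eventually (\<lambda>x. F x = G x) \<F> \<Longrightarrow> Ck_conv k F f \<F> \<longleftrightarrow> Ck_conv k G f \<F>"
proof (induction k arbitrary: F G f)
  case 0
  then show ?case by (auto intro!: uniform_limit_cong elim: eventually_mono)
next
  case (Suc k)
  have "uniform_limit UNIV F f \<F> \<longleftrightarrow> uniform_limit UNIV G f \<F>"
    using Suc.prems by (auto intro!: uniform_limit_cong elim: eventually_mono)
  moreover have "eventually (\<lambda>x. rderiv (F x) = rderiv (G x)) \<F>"
    using Suc.prems by (auto elim: eventually_mono)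
  ultimately show ?case using Suc.IH by simp
qed

lemma Ck_conv_add:
  assumes "eventually (\<lambda>x. BCinf (F x)) \<F>" "eventually (\<lambda>x. BCinf (G x)) \<F>" "BCinf f" "BCinf g"
    "Ck_conv k F f \<F>" "Ck_conv k G g \<F>"
  shows "Ck_conv k (\<lambda>x t. F x t + G x t) (\<lambda>t. f t + g t) \<F>"
  using assms
proof (induction k arbitrary: F G f g)
  case (Suc k)
  have "Ck_conv k (\<lambda>x t. rderiv (F x) t + rderiv (G x) t) (\<lambda>t. rderiv f t + rderiv g t) \<F>"
    using Suc by (auto intro!: Suc.IH BCinf_rderiv elim: eventually_mono)
  moreover have ev': "\<forall>\<^sub>F x in \<F>. rderiv (\<lambda>t. F x t + G x t) = (\<lambda>t. rderiv (F x) t + rderiv (G x) t)"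
    using Suc.prems(1,2) by eventually_elim (rule rderiv_add)
  ultimately have "Ck_conv k (\<lambda>x. rderiv (\<lambda>t. F x t + G x t)) (\<lambda>t. rderiv f t + rderiv g t) \<F>"
    by (simp only: Ck_conv_cong[OF ev'])
  then show ?case using Suc.prems by (simp add: rderiv_add uniform_limit_add)
qed (auto intro: uniform_limit_add)

text \<open>The Leibniz rule turns order \<open>k + 1\<close> into a sum of products at order
  \<open>k\<close>; at order 0 the bounds on the limits enter.\<close>

lemma Ck_conv_mult:
  assumes "eventually (\<lambda>x. BCinf (F x)) \<F>" "eventually (\<lambda>x. BCinf (G x)) \<F>" "BCinf f" "BCinf g"
    "Ck_conv k F f \<F>" "Ck_conv k G g \<F>"
  shows "Ck_conv k (\<lambda>x t. F x t * G x t) (\<lambda>t. f t * g t) \<F>"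
  using assms
proof (induction k arbitrary: F G f g)
  case 0
  then show ?case by (auto intro!: uniform_lim_mult BCinf_bounded)
next
  case (Suc k)
  have ev: "\<forall>\<^sub>F x in \<F>. BCinf (rderiv (F x))" "\<forall>\<^sub>F x in \<F>. BCinf (rderiv (G x))"
    using Suc.prems(1,2) by (auto intro: BCinf_rderiv elim: eventually_mono)
  have "Ck_conv k (\<lambda>x t. F x t * rderiv (G x) t + rderiv (F x) t * G x t) (\<lambda>t. f t * rderiv g t + rderiv f t * g t) \<F>"
  proof (rule Ck_conv_add)
    show "\<forall>\<^sub>F x in \<F>. BCinf (\<lambda>t. F x t * rderiv (G x) t)"
      using Suc.prems(1) ev(2) by eventually_elim (rule BCinf_mult)
    show "\<forall>\<^sub>F x in \<F>. BCinf (\<lambda>t. rderiv (F x) t * G x t)"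
      using Suc.prems(2) ev(1) by eventually_elim (rule BCinf_mult)
    show "Ck_conv k (\<lambda>x t. F x t * rderiv (G x) t) (\<lambda>t. f t * rderiv g t) \<F>"
      using Suc.prems ev Ck_conv_Suc_imp by (intro Suc.IH BCinf_rderiv) auto
    show "Ck_conv k (\<lambda>x t. rderiv (F x) t * G x t) (\<lambda>t. rderiv f t * g t) \<F>"
      using Suc.prems ev Ck_conv_Suc_imp by (intro Suc.IH BCinf_rderiv) auto
  qed (auto intro!: BCinf_mult BCinf_rderiv Suc.prems)
  moreover have ev': "\<forall>\<^sub>F x in \<F>. rderiv (\<lambda>t. F x t * G x t) = (\<lambda>t. F x t * rderiv (G x) t + rderiv (F x) t * G x t)"
    using Suc.prems(1,2) by eventually_elim (rule rderiv_mult)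
  ultimately have "Ck_conv k (\<lambda>x. rderiv (\<lambda>t. F x t * G x t)) (\<lambda>t. f t * rderiv g t + rderiv f t * g t) \<F>"
    by (simp only: Ck_conv_cong[OF ev'])
  then show ?case using Suc.prems by (auto simp: rderiv_mult intro!: uniform_lim_mult BCinf_bounded)
qed

lemma Ck_conv_scalar: "(c \<longlongrightarrow> l) \<F> \<Longrightarrow> Ck_conv k (\<lambda>x t. c x) (\<lambda>t. l) \<F>"
proof (induction k arbitrary: c l)
  case 0
  then show ?case by (auto simp: uniform_limit_iff tendsto_iff)
next
  case (Suc k)
  then show ?case using Suc.IH[of "\<lambda>x. 0" 0]
    by (auto simp: uniform_limit_iff tendsto_iff rderiv_const)
qed

lemma Ck_conv_const: "Ck_conv k (\<lambda>x. f) f \<F>"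
  by (simp add: Ck_conv_iff uniform_limit_const)

lemma uniform_limit_compose_arg:
  "uniform_limit UNIV F f \<F> \<Longrightarrow> uniform_limit UNIV (\<lambda>x t. F x (a t)) (\<lambda>t. f (a t)) \<F>"
  unfolding uniform_limit_iff
proof (intro allI impI)
  fix e :: real assume "\<forall>e>0. \<forall>\<^sub>F n in \<F>. \<forall>t\<in>UNIV. dist (F n t) (f t) < e" "0 < e"
  then have "\<forall>\<^sub>F n in \<F>. \<forall>t\<in>UNIV. dist (F n t) (f t) < e" by blast
  then show "\<forall>\<^sub>F n in \<F>. \<forall>t\<in>UNIV. dist (F n (a t)) (f (a t)) < e"
    by (rule eventually_mono) simp
qed

lemma Ck_conv_compose:
  fixes a b :: "real \<Rightarrow> real"
  assumes b: "BCinf (\<lambda>t. of_real (b t))" and a: "\<And>t. (a has_real_derivative b t) (at t)"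
    and "eventually (\<lambda>x. BCinf (F x)) \<F>" "BCinf f" "Ck_conv k F f \<F>"
  shows "Ck_conv k (\<lambda>x t. F x (a t)) (\<lambda>t. f (a t)) \<F>"
  using assms(3-)
proof (induction k arbitrary: F f)
  case 0
  then show ?case by (auto intro: uniform_limit_compose_arg)
next
  case (Suc k)
  have ev: "\<forall>\<^sub>F x in \<F>. BCinf (rderiv (F x))"
    using Suc.prems(1) by (auto intro: BCinf_rderiv elim: eventually_mono)
  have "Ck_conv k (\<lambda>x t. of_real (b t) * rderiv (F x) (a t)) (\<lambda>t. of_real (b t) * rderiv f (a t)) \<F>"
  proof (rule Ck_conv_mult[OF _ _ b])
    show "\<forall>\<^sub>F x in \<F>. BCinf (\<lambda>t. rderiv (F x) (a t))"
      using ev by eventually_elim (rule BCinf_compose(1)[OF _ b a])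
    show "BCinf (\<lambda>t. rderiv f (a t))" by (rule BCinf_compose(1)[OF BCinf_rderiv[OF Suc.prems(2)] b a])
    show "Ck_conv k (\<lambda>x t. rderiv (F x) (a t)) (\<lambda>t. rderiv f (a t)) \<F>"
      using Suc.prems by (intro Suc.IH ev BCinf_rderiv) auto
  qed (use b in \<open>auto intro: Ck_conv_const\<close>)
  moreover have ev': "\<forall>\<^sub>F x in \<F>. rderiv (\<lambda>t. F x (a t)) = (\<lambda>t. of_real (b t) * rderiv (F x) (a t))"
    using Suc.prems(1) by eventually_elim (rule BCinf_compose(2)[OF _ b a])
  ultimately have "Ck_conv k (\<lambda>x. rderiv (\<lambda>t. F x (a t))) (\<lambda>t. of_real (b t) * rderiv f (a t)) \<F>"
    by (simp only: Ck_conv_cong[OF ev'])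
  moreover have "uniform_limit UNIV (\<lambda>x t. F x (a t)) (\<lambda>t. f (a t)) \<F>"
    by (rule uniform_limit_compose_arg[OF Ck_conv_0[OF Suc.prems(3)]])
  ultimately show ?case by (simp add: BCinf_compose(2)[OF Suc.prems(2) b a])
qed

text \<open>Remainder of the first-order Taylor polynomial of \<open>exp\<close>; since
  \<open>h\<close> has norm at most 1, the exponential factor is at most
  \<open>exp B\<close>.\<close>

lemma norm_exp_quotient_le:
  fixes h a :: complex
  assumes "h \<noteq> 0" "norm h \<le> 1" "norm a \<le> B"
  shows "norm ((exp (h * a) - 1) / h - a) \<le> norm h * (exp B * B\<^sup>2)"
proof -
  have B: "0 \<le> B" using assms(3) norm_ge_zero order_trans by blast
  have nh: "norm (h * a) \<le> B"
    using mult_mono[OF assms(2,3)] B by (simp add: norm_mult)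
  have "norm (exp (h * a) - (\<Sum>i\<le>1. (h * a) ^ i / fact i)) \<le> exp \<bar>Re (h * a)\<bar> * norm (h * a) ^ Suc 1 / fact 1"
    by (rule Taylor_exp)
  also have "\<dots> \<le> exp B * norm (h * a) ^ 2"
    using abs_Re_le_cmod[of "h * a"] nh by (auto simp: numeral_2_eq_2 intro!: mult_right_mono)
  also have "\<dots> \<le> exp B * (norm h * B)\<^sup>2"
    by (auto simp: norm_mult intro!: mult_left_mono power_mono assms)
  finally have *: "norm (exp (h * a) - 1 - h * a) \<le> exp B * (norm h * B)\<^sup>2" by (simp add: algebra_simps)
  have "(exp (h * a) - 1) / h - a = (exp (h * a) - 1 - h * a) / h" using assms(1) by (simp add: field_simps)
  then have "norm ((exp (h * a) - 1) / h - a) = norm (exp (h * a) - 1 - h * a) / norm h" by (simp add: norm_divide)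
  also have "\<dots> \<le> exp B * (norm h * B)\<^sup>2 / norm h" by (intro divide_right_mono *) simp
  also have "\<dots> = norm h * (exp B * B\<^sup>2)" using assms(1) by (simp add: power2_eq_square)
  finally show ?thesis .
qed

text \<open>Differentiating the quotient \<open>q\<close> in the angle gives
  \<open>A' (1 + h q)\<close>, so convergence to order \<open>k + 1\<close> follows from that to
  order \<open>k\<close>. Applied to the multiplier through which a group element acts, this is
  differentiation in the spectral parameter.\<close>

lemma Ck_conv_exp_quotient:
  assumes A: "BCinf A"
  shows "Ck_conv k (\<lambda>h t. (exp (h * A t) - 1) / h) A (at 0)"
proof (induction k)
  case 0
  obtain B where B: "\<And>t. norm (A t) \<le> B" using BCinf_bounded[OF A] by (auto simp: bounded_iff)
  have bound: "\<forall>\<^sub>F h in at 0. \<forall>t\<in>UNIV. norm ((exp (h * A t) - 1) / h - A t) \<le> norm h * (exp B * B\<^sup>2)"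
    using eventually_at_ball'[of 1 "0::complex" UNIV]
    by (auto elim!: eventually_mono intro!: norm_exp_quotient_le B)
  have lim: "((\<lambda>h::complex. norm h * (exp B * B\<^sup>2)) \<longlongrightarrow> 0) (at 0)"
    by (rule tendsto_eq_intros refl | simp)+
  show ?case unfolding Ck_conv.simps uniform_limit_iff
  proof (intro allI impI)
    fix e :: real assume "0 < e"
    have 1: "\<forall>\<^sub>F h::complex in at 0. norm h * (exp B * B\<^sup>2) < e"
      using lim \<open>0 < e\<close> by (rule order_tendstoD)
    show "\<forall>\<^sub>F h in at 0. \<forall>t\<in>UNIV. dist ((exp (h * A t) - 1) / h) (A t) < e"
      using eventually_conj[OF 1 bound]
    proof (rule eventually_mono, intro ballI)
      fix h :: complex and t :: real
      assume "norm h * (exp B * B\<^sup>2) < e \<and> (\<forall>t\<in>UNIV. norm ((exp (h * A t) - 1) / h - A t) \<le> norm h * (exp B * B\<^sup>2))"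
      then show "dist ((exp (h * A t) - 1) / h) (A t) < e"
        unfolding dist_norm by (meson UNIV_I le_less_trans)
    qed
  qed
next
  case (Suc k)
  have sbq: "BCinf (\<lambda>t. (exp (h * A t) - 1) / h)" for h
  proof -
    have "BCinf (\<lambda>t. (1 / h) * (exp (h * A t) + (- 1)))"
      by (intro BCinf_mult[OF BCinf_const] BCinf_add[OF _ BCinf_const] BCinf_exp A)
    then show ?thesis by simp
  qed
  have sbh: "BCinf (\<lambda>t. h * ((exp (h * A t) - 1) / h))" for h
    by (rule BCinf_mult[OF BCinf_const sbq])
  have lim: "Ck_conv k (\<lambda>h t. rderiv A t * (1 + h * ((exp (h * A t) - 1) / h))) (\<lambda>t. rderiv A t * (1 + 0 * A t)) (at 0)"
  proof (rule Ck_conv_mult)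
    have evs: "\<forall>\<^sub>F h in at 0. BCinf (\<lambda>t. h)" "\<forall>\<^sub>F h in at 0. BCinf (\<lambda>t. (exp (h * A t) - 1) / h)"
      "\<forall>\<^sub>F h in at 0. BCinf (\<lambda>t. h * ((exp (h * A t) - 1) / h))" "\<forall>\<^sub>F h in at (0::complex). BCinf (\<lambda>t. 1)"
      by (auto intro: always_eventually BCinf_const sbq sbh simp del: times_divide_eq_right nonzero_mult_div_cancel_left)
    have sb0: "BCinf (\<lambda>t. 0 * A t)" by (rule BCinf_mult[OF BCinf_const A])
    have "Ck_conv k (\<lambda>h t. h * ((exp (h * A t) - 1) / h)) (\<lambda>t. 0 * A t) (at 0)"
      by (rule Ck_conv_mult[OF evs(1,2) BCinf_const A Ck_conv_scalar[OF tendsto_ident_at] Suc])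
    then show "Ck_conv k (\<lambda>h t. 1 + h * ((exp (h * A t) - 1) / h)) (\<lambda>t. 1 + 0 * A t) (at 0)"
      by (rule Ck_conv_add[OF evs(4,3) BCinf_const sb0 Ck_conv_const])
    show "\<forall>\<^sub>F h in at 0. BCinf (\<lambda>t. 1 + h * ((exp (h * A t) - 1) / h))"
      by (rule always_eventually, rule allI, rule BCinf_add[OF BCinf_const sbh])
    show "BCinf (\<lambda>t. 1 + 0 * A t)" by (rule BCinf_add[OF BCinf_const sb0])
  qed (auto intro: BCinf_rderiv A Ck_conv_const)
  have eq: "rderiv (\<lambda>t. (exp (h * A t) - 1) / h) = (\<lambda>t. rderiv A t * (1 + h * ((exp (h * A t) - 1) / h)))" if "h \<noteq> 0" for h
  proof -
    have s: "BCinf (\<lambda>t. h * A t)" by (rule BCinf_mult[OF BCinf_const A])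
    have sbe: "BCinf (\<lambda>t. exp (h * A t) + (- 1))" by (rule BCinf_add[OF BCinf_exp[OF s] BCinf_const])
    have "rderiv (\<lambda>t. (exp (h * A t) - 1) / h) = rderiv (\<lambda>t. (1/h) * (exp (h * A t) + (- 1)))"
      by (simp add: diff_divide_distrib)
    also have "\<dots> = (\<lambda>t. (1/h) * (h * rderiv A t * exp (h * A t)))"
      unfolding rderiv_cmult[OF sbe] rderiv_add[OF BCinf_exp[OF s] BCinf_const] rderiv_const rderiv_exp[OF s] rderiv_cmult[OF A]
      by simp
    finally show ?thesis using that by (simp add: fun_eq_iff)
  qed
  have ev: "\<forall>\<^sub>F h in at 0. rderiv (\<lambda>t. (exp (h * A t) - 1) / h) = (\<lambda>t. rderiv A t * (1 + h * ((exp (h * A t) - 1) / h)))"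
    using eq by (auto simp: eventually_at_filter)
  then have "Ck_conv k (\<lambda>h. rderiv (\<lambda>t. (exp (h * A t) - 1) / h)) (rderiv A) (at 0)"
    using lim by (simp only: Ck_conv_cong[OF ev]) simp
  then show ?case using Ck_conv_0[OF Suc] by simp
qed

section \<open>Holomorphic families in the principal series\<close>

lemma K_deriv_eq: "K_deriv j f = (rderiv ^^ j) (\<lambda>\<theta>. f (rot \<theta>))"
proof -
  have "(\<lambda>F t. vector_derivative F (at t)) = rderiv" by (simp add: fun_eq_iff rderiv_def)
  then show ?thesis by (simp add: K_deriv_def)
qed

lemma rot_periodic: "rot (\<theta> + 2 * pi) = rot \<theta>"
  by (simp add: mat2_eq_iff)

lemma rot_in_K [simp]: "rot \<theta> \<in> Kgrp" by (simp add: Kgrp_def)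

lemma smooth_K_iff: "smooth_K f \<longleftrightarrow> BCinf (\<lambda>\<theta>. f (rot \<theta>))"
proof
  assume "smooth_K f"
  then show "BCinf (\<lambda>\<theta>. f (rot \<theta>))"
    by (intro BCinf_periodic) (auto simp: rot_periodic smooth_K_def K_deriv_eq)
next
  assume "BCinf (\<lambda>\<theta>. f (rot \<theta>))"
  then show "smooth_K f"
    unfolding smooth_K_def K_deriv_eq using BCinf_iff BCinf_funpow by blast
qed

lemma tendsto_Cinf_iff:
  "tendsto_Cinf F f \<F> \<longleftrightarrow> (\<forall>k. Ck_conv k (\<lambda>x \<theta>. F x (rot \<theta>)) (\<lambda>\<theta>. f (rot \<theta>)) \<F>)"
  unfolding tendsto_Cinf_def Ck_conv_iff K_deriv_eq by auto

lemma H_infD: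
  assumes "f \<in> H_inf \<sigma>"
  shows "x \<notin> Kgrp \<Longrightarrow> f x = 0" "BCinf (\<lambda>\<theta>. f (rot \<theta>))"
    "k \<in> Kgrp \<Longrightarrow> x \<in> Mgrp \<Longrightarrow> f (k ** x) = inverse (Mchar \<sigma> x) * f k"
  using assms by (auto simp: H_inf_def smooth_K_iff)

lemma H_infI:
  assumes "\<And>x. x \<notin> Kgrp \<Longrightarrow> f x = 0" "BCinf (\<lambda>\<theta>. f (rot \<theta>))"
    "\<And>k x. k \<in> Kgrp \<Longrightarrow> x \<in> Mgrp \<Longrightarrow> f (k ** x) = inverse (Mchar \<sigma> x) * f k"
  shows "f \<in> H_inf \<sigma>"
  using assms by (auto simp: H_inf_def smooth_K_iff)

lemma H_inf_lin:
  assumes "f \<in> H_inf \<sigma>" "g \<in> H_inf \<sigma>"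
  shows "(\<lambda>k. a * f k + b * g k) \<in> H_inf \<sigma>"
  using H_infD[OF assms(1)] H_infD[OF assms(2)]
  by (intro H_infI BCinf_add BCinf_mult BCinf_const) (auto simp: algebra_simps)

lemma Ck_conv_lin:
  assumes "eventually (\<lambda>x. BCinf (F x)) \<F>" "eventually (\<lambda>x. BCinf (G x)) \<F>" "BCinf f" "BCinf g"
    "Ck_conv k F f \<F>" "Ck_conv k G g \<F>"
  shows "Ck_conv k (\<lambda>x t. a * F x t + b * G x t) (\<lambda>t. a * f t + b * g t) \<F>"
proof -
  have "eventually (\<lambda>x. BCinf (\<lambda>t. a * F x t)) \<F>" "eventually (\<lambda>x. BCinf (\<lambda>t. b * G x t)) \<F>"
    using assms(1,2) by (auto elim: eventually_mono intro: BCinf_mult[OF BCinf_const])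
  moreover have "Ck_conv k (\<lambda>x t. a * F x t) (\<lambda>t. a * f t) \<F>" "Ck_conv k (\<lambda>x t. b * G x t) (\<lambda>t. b * g t) \<F>"
    by (rule Ck_conv_mult[OF always_eventually]; simp add: assms BCinf_const Ck_conv_const)+
  ultimately show ?thesis using assms by (intro Ck_conv_add BCinf_mult BCinf_const)
qed

definition Cinf_derivable :: "Mhat \<Rightarrow> family \<Rightarrow> complex \<Rightarrow> bool" where
  "Cinf_derivable \<sigma> \<phi> \<mu> \<longleftrightarrow>
     (\<exists>\<psi>\<in>H_inf \<sigma>. tendsto_Cinf (\<lambda>\<nu> k. (\<phi> \<nu> k - \<phi> \<mu> k) / (\<nu> - \<mu>)) \<psi> (at \<mu>))"

lemma H_germ_iff: "\<phi> \<in> H_germ \<sigma> \<zeta> \<longleftrightarrow>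
    (\<exists>U. open U \<and> \<zeta> \<in> U \<and> (\<forall>\<mu>\<in>U. \<phi> \<mu> \<in> H_inf \<sigma> \<and> Cinf_derivable \<sigma> \<phi> \<mu>))"
  by (simp add: H_germ_def Cinf_derivable_def)

lemma eventually_open_at: "open U \<Longrightarrow> \<mu> \<in> U \<Longrightarrow> \<forall>x\<in>U. P x \<Longrightarrow> eventually P (at \<mu>)"
  by (metis eventually_at_in_open' eventually_mono)

lemma BCinf_quotient:
  assumes "f \<in> H_inf \<sigma>" "g \<in> H_inf \<sigma>"
  shows "BCinf (\<lambda>\<theta>. (f (rot \<theta>) - g (rot \<theta>)) / c)"
  using H_infD(2)[OF H_inf_lin[OF assms, of "1/c" "-1/c"]] by (simp add: diff_divide_distrib)

lemma H_germ_lin: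
  assumes "\<phi> \<in> H_germ \<sigma> \<zeta>" "\<psi> \<in> H_germ \<sigma> \<zeta>"
  shows "(\<lambda>\<mu> k. a * \<phi> \<mu> k + b * \<psi> \<mu> k) \<in> H_germ \<sigma> \<zeta>"
proof -
  obtain U V where U: "open U" "\<zeta> \<in> U" "\<forall>\<mu>\<in>U. \<phi> \<mu> \<in> H_inf \<sigma> \<and> Cinf_derivable \<sigma> \<phi> \<mu>"
    and V: "open V" "\<zeta> \<in> V" "\<forall>\<mu>\<in>V. \<psi> \<mu> \<in> H_inf \<sigma> \<and> Cinf_derivable \<sigma> \<psi> \<mu>"
    using assms by (auto simp: H_germ_iff)
  have "Cinf_derivable \<sigma> (\<lambda>\<mu> k. a * \<phi> \<mu> k + b * \<psi> \<mu> k) \<mu>" if \<mu>: "\<mu> \<in> U" "\<mu> \<in> V" for \<mu>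
  proof -
    obtain f g where f: "f \<in> H_inf \<sigma>" "tendsto_Cinf (\<lambda>\<nu> k. (\<phi> \<nu> k - \<phi> \<mu> k) / (\<nu> - \<mu>)) f (at \<mu>)"
      and g: "g \<in> H_inf \<sigma>" "tendsto_Cinf (\<lambda>\<nu> k. (\<psi> \<nu> k - \<psi> \<mu> k) / (\<nu> - \<mu>)) g (at \<mu>)"
      using U V \<mu> unfolding Cinf_derivable_def by meson
    have ev: "\<forall>\<^sub>F \<nu> in at \<mu>. BCinf (\<lambda>\<theta>. (\<phi> \<nu> (rot \<theta>) - \<phi> \<mu> (rot \<theta>)) / (\<nu> - \<mu>))"
      "\<forall>\<^sub>F \<nu> in at \<mu>. BCinf (\<lambda>\<theta>. (\<psi> \<nu> (rot \<theta>) - \<psi> \<mu> (rot \<theta>)) / (\<nu> - \<mu>))"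
      using U V \<mu> by (auto intro: eventually_open_at[of U] BCinf_quotient)
        (auto intro: eventually_open_at[of V] BCinf_quotient)
    have eq: "(a * \<phi> \<nu> k + b * \<psi> \<nu> k - (a * \<phi> \<mu> k + b * \<psi> \<mu> k)) / (\<nu> - \<mu>) =
        a * ((\<phi> \<nu> k - \<phi> \<mu> k) / (\<nu> - \<mu>)) + b * ((\<psi> \<nu> k - \<psi> \<mu> k) / (\<nu> - \<mu>))" for \<nu> k
      by (simp add: algebra_simps diff_divide_distrib add_divide_distrib)
    have "tendsto_Cinf (\<lambda>\<nu> k. (a * \<phi> \<nu> k + b * \<psi> \<nu> k - (a * \<phi> \<mu> k + b * \<psi> \<mu> k)) / (\<nu> - \<mu>)) (\<lambda>k. a * f k + b * g k) (at \<mu>)"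
      unfolding tendsto_Cinf_iff eq
      using f g by (intro allI Ck_conv_lin ev H_infD(2)) (auto simp: tendsto_Cinf_iff)
    then show ?thesis using H_inf_lin[OF f(1) g(1)] unfolding Cinf_derivable_def by blast
  qed
  then show ?thesis unfolding H_germ_iff
    using U V by (intro exI[of _ "U \<inter> V"]) (auto intro: H_inf_lin)
qed

text \<open>Uniform convergence implies convergence at each point of \<open>K\<close>, and off
  \<open>K\<close> the values are 0. Scalar function theory thus applies at every \<open>k\<close>,
  with one neighbourhood \<open>U\<close> for all points.\<close>

lemma H_germ_holomorphic:
  assumes "\<phi> \<in> H_germ \<sigma> \<zeta>"
  obtains U where "open U" "\<zeta> \<in> U" "\<And>k. (\<lambda>\<mu>. \<phi> \<mu> k) holomorphic_on U" "\<And>\<mu>. \<mu> \<in> U \<Longrightarrow> \<phi> \<mu> \<in> H_inf \<sigma>"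
proof -
  obtain U where U: "open U" "\<zeta> \<in> U" "\<forall>\<mu>\<in>U. \<phi> \<mu> \<in> H_inf \<sigma> \<and> Cinf_derivable \<sigma> \<phi> \<mu>"
    using assms by (auto simp: H_germ_iff)
  have "(\<lambda>\<mu>. \<phi> \<mu> k) holomorphic_on U" for k
  proof (cases "k \<in> Kgrp")
    case False
    then have "\<forall>\<mu>\<in>U. \<phi> \<mu> k = 0" using U H_infD(1) by blast
    then show ?thesis using holomorphic_transform[of "\<lambda>_. 0" U "\<lambda>\<mu>. \<phi> \<mu> k"] by simp
  next
    case True
    then obtain \<theta> where k: "k = rot \<theta>" by (auto simp: Kgrp_def)
    have "\<exists>D. ((\<lambda>\<mu>. \<phi> \<mu> k) has_field_derivative D) (at \<mu>)" if "\<mu> \<in> U" for \<mu>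
    proof -
      obtain f where f: "tendsto_Cinf (\<lambda>\<nu> k. (\<phi> \<nu> k - \<phi> \<mu> k) / (\<nu> - \<mu>)) f (at \<mu>)"
        using U \<open>\<mu> \<in> U\<close> unfolding Cinf_derivable_def by meson
      then have "Ck_conv 0 (\<lambda>\<nu> \<theta>. (\<phi> \<nu> (rot \<theta>) - \<phi> \<mu> (rot \<theta>)) / (\<nu> - \<mu>)) (\<lambda>\<theta>. f (rot \<theta>)) (at \<mu>)"
        unfolding tendsto_Cinf_iff by blast
      then have "((\<lambda>\<nu>. (\<phi> \<nu> (rot \<theta>) - \<phi> \<mu> (rot \<theta>)) / (\<nu> - \<mu>)) \<longlongrightarrow> f (rot \<theta>)) (at \<mu>)"
        unfolding Ck_conv.simps by (rule tendsto_uniform_limitI) simp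
      then show ?thesis unfolding has_field_derivative_iff k by blast
    qed
    then show ?thesis using U(1)
      by (meson field_differentiable_at_within field_differentiable_def holomorphic_on_def)
  qed
  then show ?thesis using U that by blast
qed

lemma H_germ_analytic: "\<phi> \<in> H_germ \<sigma> \<zeta> \<Longrightarrow> (\<lambda>\<mu>. \<phi> \<mu> k) analytic_on {\<zeta>}"
  by (erule H_germ_holomorphic) (auto simp: analytic_at)

lemma H_inf_0: "(\<lambda>k. 0) \<in> H_inf \<sigma>"
  by (intro H_infI) (auto simp: BCinf_const)

lemma H_germ_0: "(\<lambda>\<mu> k. 0) \<in> H_germ \<sigma> \<zeta>"
  unfolding H_germ_iff
proof (intro exI[of _ UNIV] conjI ballI H_inf_0)
  fix \<mu> show "Cinf_derivable \<sigma> (\<lambda>\<mu> k. 0) \<mu>"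
    unfolding Cinf_derivable_def by (rule bexI[OF _ H_inf_0]) (simp add: tendsto_Cinf_iff Ck_conv_const)
qed auto

lemma jet_relI:
  assumes "\<phi> \<in> H_germ \<sigma> \<zeta>" "\<psi> \<in> H_germ \<sigma> \<zeta>" "\<omega> \<in> H_germ \<sigma> \<zeta>"
    "\<forall>\<^sub>F \<mu> in nhds \<zeta>. \<forall>k. \<phi> \<mu> k - \<psi> \<mu> k = (\<mu> - \<zeta>) ^ (d + 1) * \<omega> \<mu> k"
  shows "(\<phi>, \<psi>) \<in> jet_rel \<sigma> \<zeta> d"
  using assms by (auto simp: jet_rel_def)

lemma jet_relE:
  assumes "(\<phi>, \<psi>) \<in> jet_rel \<sigma> \<zeta> d"
  obtains \<omega> where "\<phi> \<in> H_germ \<sigma> \<zeta>" "\<psi> \<in> H_germ \<sigma> \<zeta>" "\<omega> \<in> H_germ \<sigma> \<zeta>"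
    "\<forall>\<^sub>F \<mu> in nhds \<zeta>. \<forall>k. \<phi> \<mu> k - \<psi> \<mu> k = (\<mu> - \<zeta>) ^ (d + 1) * \<omega> \<mu> k"
  using assms by (auto simp: jet_rel_def)

lemma equiv_jet_rel: "equiv (H_germ \<sigma> \<zeta>) (jet_rel \<sigma> \<zeta> d)"
proof (rule equivI)
  show "jet_rel \<sigma> \<zeta> d \<subseteq> H_germ \<sigma> \<zeta> \<times> H_germ \<sigma> \<zeta>" by (auto simp: jet_rel_def)
  show "refl_on (H_germ \<sigma> \<zeta>) (jet_rel \<sigma> \<zeta> d)"
    by (auto simp: refl_on_def intro!: jet_relI[OF _ _ H_germ_0])
  show "sym (jet_rel \<sigma> \<zeta> d)"
  proof (rule symI)
    fix \<phi> \<psi> assume "(\<phi>, \<psi>) \<in> jet_rel \<sigma> \<zeta> d"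
    then obtain \<omega> where \<omega>: "\<phi> \<in> H_germ \<sigma> \<zeta>" "\<psi> \<in> H_germ \<sigma> \<zeta>" "\<omega> \<in> H_germ \<sigma> \<zeta>"
      "\<forall>\<^sub>F \<mu> in nhds \<zeta>. \<forall>k. \<phi> \<mu> k - \<psi> \<mu> k = (\<mu> - \<zeta>) ^ (d + 1) * \<omega> \<mu> k" by (rule jet_relE)
    have "\<forall>\<^sub>F \<mu> in nhds \<zeta>. \<forall>k. \<psi> \<mu> k - \<phi> \<mu> k = (\<mu> - \<zeta>) ^ (d + 1) * (-1 * \<omega> \<mu> k + 0 * \<omega> \<mu> k)"
      using \<omega>(4) 
    proof eventually_elim
      case (elim \<mu>)
      show ?case
      proof
        fix k
        have "\<psi> \<mu> k - \<phi> \<mu> k = - (\<phi> \<mu> k - \<psi> \<mu> k)" by simp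
        also have "\<dots> = - ((\<mu> - \<zeta>) ^ (d + 1) * \<omega> \<mu> k)"
          using elim by presburger
        finally show "\<psi> \<mu> k - \<phi> \<mu> k = (\<mu> - \<zeta>) ^ (d + 1) * (-1 * \<omega> \<mu> k + 0 * \<omega> \<mu> k)" by simp
      qed
    qed
    then show "(\<psi>, \<phi>) \<in> jet_rel \<sigma> \<zeta> d"
      by (rule jet_relI[OF \<omega>(2,1) H_germ_lin[OF \<omega>(3,3)]])
  qed
  show "trans (jet_rel \<sigma> \<zeta> d)"
  proof (rule transI)
    fix \<phi> \<psi> \<eta> assume "(\<phi>, \<psi>) \<in> jet_rel \<sigma> \<zeta> d" "(\<psi>, \<eta>) \<in> jet_rel \<sigma> \<zeta> d"
    then obtain w w' where \<omega>: "\<phi> \<in> H_germ \<sigma> \<zeta>" "\<psi> \<in> H_germ \<sigma> \<zeta>" "w \<in> H_germ \<sigma> \<zeta>" "\<eta> \<in> H_germ \<sigma> \<zeta>" "w' \<in> H_germ \<sigma> \<zeta>"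
      and ev: "\<forall>\<^sub>F \<mu> in nhds \<zeta>. \<forall>k. \<phi> \<mu> k - \<psi> \<mu> k = (\<mu> - \<zeta>) ^ (d + 1) * w \<mu> k"
      "\<forall>\<^sub>F \<mu> in nhds \<zeta>. \<forall>k. \<psi> \<mu> k - \<eta> \<mu> k = (\<mu> - \<zeta>) ^ (d + 1) * w' \<mu> k"
      unfolding jet_rel_def by auto
    have "\<forall>\<^sub>F \<mu> in nhds \<zeta>. \<forall>k. \<phi> \<mu> k - \<eta> \<mu> k = (\<mu> - \<zeta>) ^ (d + 1) * (1 * w \<mu> k + 1 * w' \<mu> k)"
      using ev
    proof eventually_elim
      case (elim \<mu>)
      show ?case
      proof
        fix k
        have "\<phi> \<mu> k - \<eta> \<mu> k = (\<phi> \<mu> k - \<psi> \<mu> k) + (\<psi> \<mu> k - \<eta> \<mu> k)" by simp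
        also have "\<dots> = (\<mu> - \<zeta>) ^ (d + 1) * w \<mu> k + (\<mu> - \<zeta>) ^ (d + 1) * w' \<mu> k"
          using elim by presburger
        finally show "\<phi> \<mu> k - \<eta> \<mu> k = (\<mu> - \<zeta>) ^ (d + 1) * (1 * w \<mu> k + 1 * w' \<mu> k)"
          by (simp add: distrib_left)
      qed
    qed
    then show "(\<phi>, \<eta>) \<in> jet_rel \<sigma> \<zeta> d"
      by (rule jet_relI[OF \<omega>(1,4) H_germ_lin[OF \<omega>(3,5)]])
  qed
qed

text \<open>The factor of order \<open>d + 1\<close> kills all derivatives at \<zeta> up to order
  \<open>d\<close> by the Leibniz rule. Hence the coefficients tested in \<open>H_nbhd\<close> do
  not depend on the representatives.\<close>

lemma jet_rel_taylor:
  assumes "(\<phi>, \<psi>) \<in> jet_rel \<sigma> \<zeta> d" "l \<le> d"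
  shows "taylor_coeff \<zeta> l \<phi> = taylor_coeff \<zeta> l \<psi>"
proof
  fix k
  obtain \<omega> where \<omega>: "\<phi> \<in> H_germ \<sigma> \<zeta>" "\<psi> \<in> H_germ \<sigma> \<zeta>" "\<omega> \<in> H_germ \<sigma> \<zeta>"
    "\<forall>\<^sub>F \<mu> in nhds \<zeta>. \<forall>k. \<phi> \<mu> k - \<psi> \<mu> k = (\<mu> - \<zeta>) ^ (d + 1) * \<omega> \<mu> k"
    using assms(1) by (rule jet_relE)
  have "(deriv ^^ l) (\<lambda>\<mu>. \<phi> \<mu> k) \<zeta> - (deriv ^^ l) (\<lambda>\<mu>. \<psi> \<mu> k) \<zeta> = (deriv ^^ l) (\<lambda>\<mu>. \<phi> \<mu> k - \<psi> \<mu> k) \<zeta>"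
    by (rule higher_deriv_diff_at[symmetric, OF H_germ_analytic[OF \<omega>(1)] H_germ_analytic[OF \<omega>(2)]])
  also have "\<dots> = (deriv ^^ l) (\<lambda>\<mu>. (\<mu> - \<zeta>) ^ (d + 1) * \<omega> \<mu> k) \<zeta>"
    using \<omega>(4) by (intro higher_deriv_cong_ev refl) (auto elim: eventually_mono)
  also have "\<dots> = (\<Sum>i = 0..l. of_nat (l choose i) * (deriv ^^ i) (\<lambda>\<mu>. (\<mu> - \<zeta>) ^ (d + 1)) \<zeta> *
      (deriv ^^ (l-i)) (\<lambda>\<mu>. \<omega> \<mu> k) \<zeta>)"
    by (intro higher_deriv_mult_at H_germ_analytic[OF \<omega>(3)] analytic_intros)
  also have "\<dots> = 0"
    using assms(2) by (intro sum.neutral) (auto simp: higher_deriv_power simp del: power_Suc)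
  finally show "taylor_coeff \<zeta> l \<phi> k = taylor_coeff \<zeta> l \<psi> k"
    by (simp add: taylor_coeff_def)
qed

lemma jet_rel_value: "(\<phi>, \<psi>) \<in> jet_rel \<sigma> \<zeta> d \<Longrightarrow> \<phi> \<zeta> = \<psi> \<zeta>"
  using jet_rel_taylor[of \<phi> \<psi> \<sigma> \<zeta> d 0] by (simp add: taylor_coeff_def fun_eq_iff)

section \<open>The action of the group on holomorphic families\<close>

lemma SL2_iff: "x \<in> SL2 \<longleftrightarrow> x$1$1 * x$2$2 - x$1$2 * x$2$1 = 1"
  by (simp add: SL2_def det_2)

lemma SL2_mult: "x \<in> SL2 \<Longrightarrow> y \<in> SL2 \<Longrightarrow> x ** y \<in> SL2"
  by (simp add: SL2_def det_mul)

lemma rot_in_SL2: "rot \<theta> \<in> SL2" and diagm_in_SL2: "diagm s \<in> SL2"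
  by (simp_all add: SL2_iff flip: power2_eq_square exp_add)

lemma SL2_inv:
  assumes "g \<in> SL2"
  shows "g ** matrix_inv g = mat 1" "matrix_inv g ** g = mat 1" "matrix_inv g \<in> SL2"
proof -
  have "invertible g" using assms by (simp add: SL2_def invertible_det_nz)
  then have "g ** matrix_inv g = mat 1 \<and> matrix_inv g ** g = mat 1"
    unfolding invertible_def matrix_inv_def by (rule someI_ex)
  then show *: "g ** matrix_inv g = mat 1" "matrix_inv g ** g = mat 1" by simp_all
  have "det g * det (matrix_inv g) = 1" using *(1) by (metis det_I det_mul)
  then show "matrix_inv g \<in> SL2" using assms by (simp add: SL2_def)
qed

lemma matrix_inv_eqI:
  assumes "g ** h = mat 1" shows "matrix_inv g = (h::mat2)"
proof -
  have "\<exists>h. g ** h = mat 1 \<and> h ** g = mat 1"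
    using assms matrix_left_right_inverse[of g h] by blast
  then have "g ** matrix_inv g = mat 1 \<and> matrix_inv g ** g = mat 1"
    unfolding matrix_inv_def by (rule someI_ex)
  then have inv: "matrix_inv g ** g = mat 1" ..
  have "matrix_inv g = matrix_inv g ** (g ** h)" by (simp add: assms)
  also have "\<dots> = h" using inv by (simp add: matrix_mul_assoc)
  finally show ?thesis .
qed

lemma rot_add: "rot s ** rot t = rot (s + t)"
  by (simp add: mat2_eq_iff mat2_mult_nth cos_add sin_add)

lemma inv_rot: "matrix_inv (rot s) = rot (- s)"
  by (rule matrix_inv_eqI) (simp add: rot_add, simp add: mat2_eq_iff)

lemma inv_diagm: "matrix_inv (diagm s) = diagm (- s)"
  by (rule matrix_inv_eqI) (simp add: mat2_eq_iff mat2_mult_nth flip: exp_add)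

lemma K_subset_SL2: "k \<in> Kgrp \<Longrightarrow> k \<in> SL2"
  using rot_in_SL2 by (auto simp: Kgrp_def)

section \<open>The multiplier and the circle map of a group element\<close>

lemma BCinf_trig: "BCinf (\<lambda>t. a * of_real (cos t) + b * of_real (sin t))"
proof -
  have "BCk k (\<lambda>t. a * of_real (cos t) + b * of_real (sin t))" for k
  \<comment> \<open>The span of sine and cosine is stable under differentiation, hence the
    generalisation over both coefficients.\<close>
  proof (induction k arbitrary: a b)
    have bd: "bounded (range (\<lambda>t. a * of_real (cos t) + b * of_real (sin t)))" for a b :: complex
      by (intro bounded_plus_comp bounded_times_comp)
        (auto simp: bounded_iff image_constant_conv intro: exI[of _ 1])
    {
      case 0 show ?case using bd by simp
    next
      case (Suc k)
      show ?case
      proof (rule BCk_SucI[OF bd])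
        show "((\<lambda>t. a * of_real (cos t) + b * of_real (sin t)) has_vector_derivative
            b * of_real (cos t) + (- a) * of_real (sin t)) (at t)" for t
          by (rule derivative_eq_intros refl | simp)+
      qed (rule Suc)
    }
  qed
  then show ?thesis by (simp add: BCinf_def)
qed

text \<open>The squared norm of the first column of \<open>x ** rot \<theta>\<close>.\<close>
definition colsq :: "mat2 \<Rightarrow> real \<Rightarrow> real" where
  "colsq x \<theta> = (x$1$1 * cos \<theta> - x$1$2 * sin \<theta>)\<^sup>2 + (x$2$1 * cos \<theta> - x$2$2 * sin \<theta>)\<^sup>2"

lemma colsq_pos: assumes "x \<in> SL2" shows "colsq x \<theta> > 0"
proof -
  define y where "y = x ** rot \<theta>"
  have "y \<in> SL2" using assms by (simp add: y_def SL2_mult rot_in_SL2)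
  then have "y$1$1 \<noteq> 0 \<or> y$2$1 \<noteq> 0" by (auto simp: SL2_iff)
  moreover have "colsq x \<theta> = (y$1$1)\<^sup>2 + (y$2$1)\<^sup>2" by (simp add: y_def colsq_def mat2_mult_nth)
  ultimately show ?thesis by (simp add: sum_power2_gt_zero_iff)
qed

lemma colsq_eq: "(x ** rot \<theta>)$1$1^2 + (x ** rot \<theta>)$2$1^2 = colsq x \<theta>"
  by (simp add: colsq_def mat2_mult_nth)

lemma BCinf_colsq: "BCinf (\<lambda>\<theta>. of_real (colsq x \<theta>))"
proof -
  have "BCinf (\<lambda>\<theta>. (of_real (x$1$1) * of_real (cos \<theta>) + of_real (- x$1$2) * of_real (sin \<theta>)) *
        (of_real (x$1$1) * of_real (cos \<theta>) + of_real (- x$1$2) * of_real (sin \<theta>)) +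
      (of_real (x$2$1) * of_real (cos \<theta>) + of_real (- x$2$2) * of_real (sin \<theta>)) *
        (of_real (x$2$1) * of_real (cos \<theta>) + of_real (- x$2$2) * of_real (sin \<theta>)))"
    by (rule BCinf_add[OF BCinf_mult[OF BCinf_trig BCinf_trig] BCinf_mult[OF BCinf_trig BCinf_trig]])
  then show ?thesis by (simp add: colsq_def power2_eq_square)
qed

lemma BCinf_inverse_colsq: assumes "x \<in> SL2" shows "BCinf (\<lambda>\<theta>. of_real (inverse (colsq x \<theta>)))"
proof -
  have "BCinf (\<lambda>\<theta>. inverse (of_real (colsq x \<theta>)))"
  proof (rule BCinf_inverse[OF BCinf_colsq])
    show "complex_of_real (colsq x t) \<noteq> 0" for t using colsq_pos[OF assms, of t] by simp
    show "bounded (range (\<lambda>t. inverse (complex_of_real (colsq x t))))"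
    proof (rule bounded_periodic)
      have "continuous_on UNIV (\<lambda>t. complex_of_real (colsq x t))"
        by (auto simp: colsq_def intro!: continuous_intros)
      then show "continuous_on UNIV (\<lambda>t. inverse (complex_of_real (colsq x t)))"
        using colsq_pos[OF assms] by (intro continuous_on_inverse) (auto simp: less_imp_neq[symmetric])
    qed (simp add: colsq_def)
  qed
  then show ?thesis by simp
qed

text \<open>\<open>colsq x\<close> is real while the calculus of \<open>BCinf\<close> is complex;
  this pair moves the derivative between the two.\<close>

lemma rderiv_colsq: "(colsq x has_real_derivative Re (rderiv (\<lambda>\<theta>. of_real (colsq x \<theta>)) t)) (at t)"
  and rderiv_colsq_Re: "rderiv (\<lambda>\<theta>. of_real (colsq x \<theta>)) t = of_real (Re (rderiv (\<lambda>\<theta>. of_real (colsq x \<theta>)) t))"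
proof -
  define D where "D = 2 * (x$1$1 * cos t - x$1$2 * sin t) * (- x$1$1 * sin t - x$1$2 * cos t) +
    2 * (x$2$1 * cos t - x$2$2 * sin t) * (- x$2$1 * sin t - x$2$2 * cos t)"
  have D: "(colsq x has_real_derivative D) (at t)"
    unfolding colsq_def[abs_def] D_def by (auto intro!: derivative_eq_intros simp: algebra_simps)
  then have "((\<lambda>\<theta>. complex_of_real (colsq x \<theta>)) has_vector_derivative of_real D) (at t)"
    by (intro has_vector_derivative_of_real) (simp add: has_real_derivative_iff_has_vector_derivative)
  then have "rderiv (\<lambda>\<theta>. of_real (colsq x \<theta>)) t = of_real D"
    by (simp add: rderiv_def vector_derivative_at)
  with D show "(colsq x has_real_derivative Re (rderiv (\<lambda>\<theta>. of_real (colsq x \<theta>)) t)) (at t)"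
    "rderiv (\<lambda>\<theta>. of_real (colsq x \<theta>)) t = of_real (Re (rderiv (\<lambda>\<theta>. of_real (colsq x \<theta>)) t))"
    by simp_all
qed

text \<open>The logarithm is bounded by periodicity, and its derivative is a product of functions
  already known to be smooth.\<close>

lemma BCinf_ln_colsq: assumes "x \<in> SL2" shows "BCinf (\<lambda>\<theta>. of_real (- ln (colsq x \<theta>)))"
proof -
  let ?d = "\<lambda>t. Re (rderiv (\<lambda>\<theta>. of_real (colsq x \<theta>)) t)"
  have "((\<lambda>\<theta>. - ln (colsq x \<theta>)) has_real_derivative - (?d t * inverse (colsq x t))) (at t)" for t
    using colsq_pos[OF assms, of t] by (auto intro!: derivative_eq_intros rderiv_colsq simp: field_simps)
  then have "((\<lambda>\<theta>. complex_of_real (- ln (colsq x \<theta>))) has_vector_derivative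
      of_real (- (?d t * inverse (colsq x t)))) (at t)" for t
    by (intro has_vector_derivative_of_real) (simp only: has_real_derivative_iff_has_vector_derivative)
  also have "of_real (- (?d t * inverse (colsq x t))) =
      (- 1) * (rderiv (\<lambda>\<theta>. of_real (colsq x \<theta>)) t * of_real (inverse (colsq x t)))" for t
    by (subst rderiv_colsq_Re) (simp only: of_real_minus of_real_mult mult_minus1)
  finally have d: "((\<lambda>\<theta>. complex_of_real (- ln (colsq x \<theta>))) has_vector_derivative
      (- 1) * (rderiv (\<lambda>\<theta>. of_real (colsq x \<theta>)) t * of_real (inverse (colsq x t)))) (at t)" for t .
  have "bounded (range (\<lambda>\<theta>. complex_of_real (- ln (colsq x \<theta>))))"
  proof (rule bounded_periodic)
    show "continuous_on UNIV (\<lambda>\<theta>. complex_of_real (- ln (colsq x \<theta>)))"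
      using d by (meson continuous_at_imp_continuous_on has_vector_derivative_continuous)
  qed (simp add: colsq_def)
  moreover have "BCinf (\<lambda>t. (- 1) * (rderiv (\<lambda>\<theta>. of_real (colsq x \<theta>)) t * of_real (inverse (colsq x t))))"
    by (rule BCinf_mult[OF BCinf_const BCinf_mult[OF BCinf_rderiv[OF BCinf_colsq] BCinf_inverse_colsq[OF assms]]])
  ultimately show ?thesis
    unfolding BCinf_iff[of "\<lambda>\<theta>. of_real (- ln (colsq x \<theta>))"] rderiv_eqI[OF d]
    using d differentiableI_vector by blast
qed

text \<open>A group element moves the circle \<open>K\<close> by a diffeomorphism, which becomes an
  increasing function \<open>a\<close> on the line. Its derivative is the reciprocal of
  \<open>colsq\<close> because the Wronskian of the two entries of the first column is the
  determinant 1. Integrating this derivative produces \<open>a\<close>, and uniqueness for a linear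
  differential equation identifies it.\<close>

lemma angle_lift:
  assumes x: "x \<in> SL2"
  obtains a where "\<And>\<theta>. (a has_real_derivative inverse (colsq x \<theta>)) (at \<theta>)"
    "\<And>\<theta>. iwK (x ** rot \<theta>) = rot (a \<theta>)"
proof -
  define N where "N = colsq x"
  define p q where "p = (\<lambda>\<theta>. x$1$1 * cos \<theta> - x$1$2 * sin \<theta>)" and "q = (\<lambda>\<theta>. x$2$1 * cos \<theta> - x$2$2 * sin \<theta>)"
  define r where "r = (\<lambda>\<theta>. sqrt (N \<theta>))"
  have N: "N \<theta> > 0" for \<theta> using colsq_pos[OF x] by (simp add: N_def)
  have r: "r \<theta> > 0" "r \<theta> * r \<theta> = N \<theta>" for \<theta> using N[of \<theta>] by (auto simp: r_def)
  have Npq: "N \<theta> = p \<theta> * p \<theta> + q \<theta> * q \<theta>" for \<theta> by (simp add: N_def colsq_def p_def q_def power2_eq_square)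
  define p' q' where "p' = (\<lambda>\<theta>. - x$1$1 * sin \<theta> - x$1$2 * cos \<theta>)" and "q' = (\<lambda>\<theta>. - x$2$1 * sin \<theta> - x$2$2 * cos \<theta>)"
  have dp: "(p has_real_derivative p' \<theta>) (at \<theta>)" and dq: "(q has_real_derivative q' \<theta>) (at \<theta>)" for \<theta>
    unfolding p_def q_def p'_def q'_def by (rule derivative_eq_intros refl | simp)+
  have wr: "p' \<theta> * q \<theta> - p \<theta> * q' \<theta> = 1" for \<theta>
  proof -
    have "p' \<theta> * q \<theta> - p \<theta> * q' \<theta> = (x$1$1 * x$2$2 - x$1$2 * x$2$1) * ((sin \<theta>)\<^sup>2 + (cos \<theta>)\<^sup>2)"
      unfolding p_def q_def p'_def q'_def by algebra
    then show ?thesis using x by (simp add: SL2_iff)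
  qed
  have dr: "(r has_real_derivative (p \<theta> * p' \<theta> + q \<theta> * q' \<theta>) / r \<theta>) (at \<theta>)" for \<theta>
  proof -
    have "(N has_real_derivative 2 * (p \<theta> * p' \<theta> + q \<theta> * q' \<theta>)) (at \<theta>)"
      unfolding Npq[abs_def] by (rule derivative_eq_intros dp dq refl | simp)+
    then show ?thesis unfolding r_def using N[of \<theta>]
      by (auto intro!: derivative_eq_intros simp: field_simps)
  qed
  have dP: "((\<lambda>\<theta>. p \<theta> / r \<theta>) has_real_derivative (q \<theta> / r \<theta>) * inverse (N \<theta>)) (at \<theta>)" for \<theta>
  proof -
    have "((\<lambda>\<theta>. p \<theta> / r \<theta>) has_real_derivative (p' \<theta> * r \<theta> - p \<theta> * ((p \<theta> * p' \<theta> + q \<theta> * q' \<theta>) / r \<theta>)) / (r \<theta> * r \<theta>)) (at \<theta>)"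
      using r(1)[of \<theta>] by (intro DERIV_divide dp dr) simp
    also have "(p' \<theta> * r \<theta> - p \<theta> * ((p \<theta> * p' \<theta> + q \<theta> * q' \<theta>) / r \<theta>)) =
        (p' \<theta> * (r \<theta> * r \<theta>) - p \<theta> * (p \<theta> * p' \<theta> + q \<theta> * q' \<theta>)) / r \<theta>"
      using r(1)[of \<theta>] by (simp add: field_simps)
    also have "p' \<theta> * (r \<theta> * r \<theta>) - p \<theta> * (p \<theta> * p' \<theta> + q \<theta> * q' \<theta>) = q \<theta>"
      unfolding r(2) Npq using wr[of \<theta>] by algebra
    finally show ?thesis by (simp add: r(2) divide_inverse)
  qed
  have dQ: "((\<lambda>\<theta>. q \<theta> / r \<theta>) has_real_derivative - (p \<theta> / r \<theta>) * inverse (N \<theta>)) (at \<theta>)" for \<theta>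
  proof -
    have "((\<lambda>\<theta>. q \<theta> / r \<theta>) has_real_derivative (q' \<theta> * r \<theta> - q \<theta> * ((p \<theta> * p' \<theta> + q \<theta> * q' \<theta>) / r \<theta>)) / (r \<theta> * r \<theta>)) (at \<theta>)"
      using r(1)[of \<theta>] by (intro DERIV_divide dq dr) simp
    also have "(q' \<theta> * r \<theta> - q \<theta> * ((p \<theta> * p' \<theta> + q \<theta> * q' \<theta>) / r \<theta>)) =
        (q' \<theta> * (r \<theta> * r \<theta>) - q \<theta> * (p \<theta> * p' \<theta> + q \<theta> * q' \<theta>)) / r \<theta>"
      using r(1)[of \<theta>] by (simp add: field_simps)
    also have "q' \<theta> * (r \<theta> * r \<theta>) - q \<theta> * (p \<theta> * p' \<theta> + q \<theta> * q' \<theta>) = - p \<theta>"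
      unfolding r(2) Npq using wr[of \<theta>] by algebra
    finally show ?thesis by (simp add: r(2) divide_inverse)
  qed
  have "(p 0 / r 0)\<^sup>2 + (- (q 0 / r 0))\<^sup>2 = 1"
    using r(1)[of 0] r(2)[of 0, symmetric] Npq[of 0, symmetric] by (simp add: power2_eq_square flip: add_divide_distrib)
  \<comment> \<open>The angle of the moved point at 0 is the initial value of the lift.\<close>
  then obtain a0 where a0: "p 0 / r 0 = cos a0" "- (q 0 / r 0) = sin a0"
    using sincos_total_2pi by metis
  have contN: "continuous_on S (\<lambda>\<theta>. inverse (N \<theta>))" for S
  proof (rule continuous_on_inverse)
    show "continuous_on S N" unfolding N_def colsq_def[abs_def] by (intro continuous_intros)
  qed (use N in \<open>auto simp: less_imp_neq[symmetric]\<close>)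
  define a where "a = (\<lambda>\<theta>. a0 + (LBINT y=ereal 0..ereal \<theta>. inverse (N y)))"
  have da: "(a has_real_derivative inverse (N \<theta>)) (at \<theta>)" for \<theta>
  proof -
    define l u where "l = min 0 \<theta> - 1" and "u = max 0 \<theta> + 1"
    have "((\<lambda>u. LBINT y=ereal 0..ereal u. inverse (N y)) has_vector_derivative inverse (N \<theta>)) (at \<theta> within {l..u})"
      by (rule interval_integral_FTC2[OF _ _ contN]) (auto simp: l_def u_def)
    moreover have "at \<theta> within {l..u} = at \<theta>"
      by (rule at_within_interior) (auto simp: l_def u_def)
    ultimately show ?thesis
      unfolding a_def has_real_derivative_iff_has_vector_derivative by (auto intro!: derivative_eq_intros)
  qed
  define P Q where "P = (\<lambda>\<theta>. p \<theta> / r \<theta>)" and "Q = (\<lambda>\<theta>. q \<theta> / r \<theta>)"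
  have dP: "(P has_real_derivative Q \<theta> * inverse (N \<theta>)) (at \<theta>)"
    and dQ: "(Q has_real_derivative - P \<theta> * inverse (N \<theta>)) (at \<theta>)" for \<theta>
    using dP dQ by (simp_all only: P_def Q_def)
  \<comment> \<open>\<open>(P, Q)\<close> and \<open>(cos a, - sin a)\<close> solve the same
    rotation equation, so their squared distance \<open>E\<close> is constant.\<close>
  define E where "E = (\<lambda>\<theta>. (P \<theta> - cos (a \<theta>))\<^sup>2 + (Q \<theta> + sin (a \<theta>))\<^sup>2)"
  have dE: "(E has_real_derivative 0) (at \<theta>)" for \<theta>
    unfolding E_def
    by (rule derivative_eq_intros dP dQ da refl)+ (simp add: algebra_simps)
  have "E \<theta> = E 0" for \<theta> using DERIV_isconst_all[of E] dE by blast
  moreover have "E 0 = 0" using a0 by (simp add: E_def a_def P_def Q_def zero_ereal_def)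
  ultimately have "p \<theta> / r \<theta> = cos (a \<theta>)" "q \<theta> / r \<theta> = - sin (a \<theta>)" for \<theta>
    by (auto simp: E_def P_def Q_def sum_power2_eq_zero_iff eq_neg_iff_add_eq_0)
  then have "iwK (x ** rot \<theta>) = rot (a \<theta>)" for \<theta>
    unfolding iwK_def colsq_eq N_def[symmetric]
    by (simp add: mat2_mult_nth Let_def mat2_eq_iff p_def q_def r_def)
  then show ?thesis using that[of a] da unfolding N_def by blast
qed

section \<open>The action on functions and on germs\<close>

lemma ps_act_rot:
  assumes "g \<in> SL2"
  shows "ps_act \<mu> g f (rot \<theta>) = exp ((\<mu> + 1/2) * of_real (- ln (colsq (matrix_inv g) \<theta>))) * f (iwK (matrix_inv g ** rot \<theta>))"
proof -
  have "colsq (matrix_inv g) \<theta> > 0" using SL2_inv(3)[OF assms] by (rule colsq_pos)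
  then show ?thesis
    by (simp add: ps_act_def ps_extend_def iwA_def colsq_eq Apow_diagm ln_sqrt algebra_simps)
qed

text \<open>In the angle, a group element acts by a smooth change of variable and a multiplier, and
  the spectral parameter enters linearly in the exponent of the multiplier.\<close>

lemma ps_act_param:
  assumes "g \<in> SL2"
  obtains a b A where "BCinf (\<lambda>t. of_real (b t))" "\<And>t. (a has_real_derivative b t) (at t)" "BCinf A"
    "\<And>t. A t = of_real (- ln (colsq (matrix_inv g) t))"
    "\<And>\<mu> f t. ps_act \<mu> g f (rot t) = exp ((\<mu> + 1/2) * A t) * f (rot (a t))"
proof -
  note x = SL2_inv(3)[OF assms]
  obtain a where a: "\<And>\<theta>. (a has_real_derivative inverse (colsq (matrix_inv g) \<theta>)) (at \<theta>)"
    "\<And>\<theta>. iwK (matrix_inv g ** rot \<theta>) = rot (a \<theta>)" using angle_lift[OF x] by blast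
  show ?thesis
    by (rule that[OF BCinf_inverse_colsq[OF x] a(1) BCinf_ln_colsq[OF x] refl])
      (simp add: ps_act_rot[OF assms] a(2))
qed

lemma Kgrp_M: "k \<in> Kgrp \<Longrightarrow> x \<in> Mgrp \<Longrightarrow> k ** x \<in> Kgrp"
proof -
  assume "k \<in> Kgrp" "x \<in> Mgrp"
  then obtain t where t: "k = rot t" by (auto simp: Kgrp_def)
  have "k ** mat 1 = rot (t + 0)" "k ** (- mat 1) = rot (t + pi)"
    by (simp_all add: t mat2_eq_iff mat2_mult_nth)
  then show ?thesis using \<open>x \<in> Mgrp\<close> by (auto simp: Mgrp_def)
qed

lemma ps_act_equivariant:
  assumes "g \<in> SL2" "f \<in> H_inf \<sigma>" "k \<in> Kgrp" "x \<in> Mgrp"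
  shows "ps_act \<mu> g f (k ** x) = inverse (Mchar \<sigma> x) * ps_act \<mu> g f k"
proof -
  have I: "diagm 0 = mat 1" "unip 0 = mat 1" by (simp_all add: mat2_eq_iff)
  have "mat 1 \<in> Agrp" "mat 1 \<in> Ngrp" using I by (metis Agrp_def rangeI, metis Ngrp_def rangeI)
  moreover have "Apow (mat 1) z = 1" for z using Apow_diagm[of 0] I by simp
  moreover have "matrix_inv g ** k \<in> SL2" using SL2_mult SL2_inv(3) K_subset_SL2 assms by blast
  ultimately have "ps_extend \<mu> f (matrix_inv g ** k ** x) = inverse (Mchar \<sigma> x) * ps_extend \<mu> f (matrix_inv g ** k)"
    using ps_extend_equivariant[OF assms(2) _ assms(4), of _ "mat 1" "mat 1"] by simp
  then show ?thesis using assms Kgrp_M by (simp add: ps_act_def matrix_mul_assoc)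
qed

lemma ps_act_H_inf:
  assumes "g \<in> SL2" "f \<in> H_inf \<sigma>"
  shows "ps_act \<mu> g f \<in> H_inf \<sigma>"
proof (rule H_infI)
  obtain a b A where a: "BCinf (\<lambda>t. of_real (b t))" "\<And>t. (a has_real_derivative b t) (at t)" "BCinf A"
    "\<And>\<mu> f t. ps_act \<mu> g f (rot t) = exp ((\<mu> + 1/2) * A t) * f (rot (a t))"
    using ps_act_param[OF assms(1)] by metis
  show "BCinf (\<lambda>\<theta>. ps_act \<mu> g f (rot \<theta>))"
    unfolding a(4) by (rule BCinf_mult[OF BCinf_exp[OF BCinf_mult[OF BCinf_const a(3)]] BCinf_compose(1)[OF H_infD(2)[OF assms(2)] a(1,2)]])
qed (use assms in \<open>auto simp: ps_act_equivariant\<close>, simp add: ps_act_def)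

text \<open>In the Iwasawa decomposition of \<open>matrix_inv g ** k\<close> the \<open>A\<close>
  and \<open>N\<close> parts stand on the right, where \<open>ps_extend\<close> is equivariant. This
  is the cocycle property of the multiplier.\<close>

lemma ps_act_mult:
  assumes "g \<in> SL2" "h \<in> SL2" "f \<in> H_inf \<sigma>"
  shows "ps_act \<mu> g (ps_act \<mu> h f) = ps_act \<mu> (g ** h) f"
proof
  fix k
  show "ps_act \<mu> g (ps_act \<mu> h f) k = ps_act \<mu> (g ** h) f k"
  proof (cases "k \<in> Kgrp")
    case True
    define y where "y = matrix_inv g ** k"
    have y: "y \<in> SL2" using SL2_mult SL2_inv(3) K_subset_SL2 assms True by (simp add: y_def)
    obtain u where u: "u \<in> Ngrp" "y = iwK y ** iwA y ** u" using iwasawa(3)[OF y] by blast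
    have inv: "matrix_inv (g ** h) = matrix_inv h ** matrix_inv g"
    proof (rule matrix_inv_eqI)
      have "g ** h ** (matrix_inv h ** matrix_inv g) = g ** (h ** matrix_inv h) ** matrix_inv g"
        by (simp only: matrix_mul_assoc)
      then show "g ** h ** (matrix_inv h ** matrix_inv g) = mat 1"
        using SL2_inv(1) assms by simp
    qed
    have m1: "mat 1 \<in> Mgrp" by (simp add: Mgrp_def)
    have "ps_act \<mu> (g ** h) f k = ps_extend \<mu> f (matrix_inv h ** y)"
      using True by (simp add: ps_act_def inv y_def matrix_mul_assoc)
    also have "matrix_inv h ** y = (matrix_inv h ** iwK y) ** mat 1 ** iwA y ** u"
      by (subst u(2)) (simp add: matrix_mul_assoc)
    also have "ps_extend \<mu> f \<dots> = Apow (iwA y) (- (\<mu> + 1/2)) * inverse (Mchar \<sigma> (mat 1)) * ps_extend \<mu> f (matrix_inv h ** iwK y)"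
      by (rule ps_extend_equivariant[OF assms(3) SL2_mult[OF SL2_inv(3)[OF assms(2)] K_subset_SL2[OF iwasawa(1)[OF y]]]
          m1 iwasawa(2)[OF y] u(1)])
    also have "\<dots> = ps_act \<mu> g (ps_act \<mu> h f) k"
      using True iwasawa(1)[OF y] by (cases \<sigma>) (simp_all add: ps_act_def ps_extend_def flip: y_def)
    finally show ?thesis ..
  qed (simp add: ps_act_def)
qed

lemma Ck_conv_filtermap: "Ck_conv k F f (filtermap h \<F>) \<longleftrightarrow> Ck_conv k (\<lambda>x. F (h x)) f \<F>"
  by (simp add: Ck_conv_iff uniform_limit_iff eventually_filtermap del: Ck_conv.simps)

text \<open>The difference quotient in the spectral parameter splits, by the product rule, into the
  quotient of the multiplier times the moved function and the moved quotient of the family. Both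
  converge in all derivatives.\<close>

lemma ps_act_germ:
  assumes g: "g \<in> SL2" and \<phi>: "\<phi> \<in> H_germ \<sigma> \<zeta>"
  shows "(\<lambda>\<mu>. ps_act \<mu> g (\<phi> \<mu>)) \<in> H_germ \<sigma> \<zeta>"
proof -
  obtain U where U: "open U" "\<zeta> \<in> U" "\<forall>\<mu>\<in>U. \<phi> \<mu> \<in> H_inf \<sigma> \<and> Cinf_derivable \<sigma> \<phi> \<mu>"
    using \<phi> by (auto simp: H_germ_iff)
  obtain a b A where a: "BCinf (\<lambda>t. of_real (b t))" "\<And>t. (a has_real_derivative b t) (at t)" and A: "BCinf A"
    "\<And>t. A t = of_real (- ln (colsq (matrix_inv g) t))"
    and act: "\<And>\<mu> f t. ps_act \<mu> g f (rot t) = exp ((\<mu> + 1/2) * A t) * f (rot (a t))"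
    using ps_act_param[OF g] by metis
  have "Cinf_derivable \<sigma> (\<lambda>\<mu>. ps_act \<mu> g (\<phi> \<mu>)) \<mu>" if \<mu>: "\<mu> \<in> U" for \<mu>
  proof -
    obtain f where f: "f \<in> H_inf \<sigma>" "tendsto_Cinf (\<lambda>\<nu> k. (\<phi> \<nu> k - \<phi> \<mu> k) / (\<nu> - \<mu>)) f (at \<mu>)"
      using U \<mu> unfolding Cinf_derivable_def by meson
    have \<phi>\<mu>: "\<phi> \<mu> \<in> H_inf \<sigma>" using U \<mu> by blast
    \<comment> \<open>\<open>A\<close> is a function of the angle; \<open>B\<close> is the same
      exponent as a function of matrices, so that the limit \<psi> can be defined on
      \<open>K\<close>.\<close>
    define B where "B = (\<lambda>k::mat2. complex_of_real (- ln ((matrix_inv g ** k)$1$1^2 + (matrix_inv g ** k)$2$1^2)))"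
    have B: "B (rot t) = A t" for t by (simp only: B_def colsq_eq A)
    have BM: "B (k ** x) = B k" if "x \<in> Mgrp" for k x
      using that by (auto simp: B_def Mgrp_def matrix_mul_assoc mat2_mult_nth power2_eq_square algebra_simps)
    define \<psi> where "\<psi> = (\<lambda>k. B k * ps_act \<mu> g (\<phi> \<mu>) k + ps_act \<mu> g f k)"
    note D1 = H_infD[OF ps_act_H_inf[OF g \<phi>\<mu>, of \<mu>]] and D2 = H_infD[OF ps_act_H_inf[OF g f(1), of \<mu>]]
    have "\<psi> \<in> H_inf \<sigma>"
    proof (rule H_infI)
      show "BCinf (\<lambda>\<theta>. \<psi> (rot \<theta>))" unfolding \<psi>_def B by (rule BCinf_add[OF BCinf_mult[OF A(1) D1(2)] D2(2)])
    qed (use D1 D2 BM in \<open>auto simp: \<psi>_def distrib_left mult_ac\<close>)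
    moreover have "tendsto_Cinf (\<lambda>\<nu> k. (ps_act \<nu> g (\<phi> \<nu>) k - ps_act \<mu> g (\<phi> \<mu>) k) / (\<nu> - \<mu>)) \<psi> (at \<mu>)"
      unfolding tendsto_Cinf_iff
    proof
      fix n
      define Q where "Q = (\<lambda>\<nu> t. (\<phi> \<nu> (rot t) - \<phi> \<mu> (rot t)) / (\<nu> - \<mu>))"
      define X where "X = (\<lambda>\<nu> t. (exp ((\<nu> - \<mu>) * A t) - 1) / (\<nu> - \<mu>))"
      have sbf: "BCinf (\<lambda>t. f (rot t))" and BCinf\<phi>: "BCinf (\<lambda>t. \<phi> \<mu> (rot t))" by (rule H_infD(2)[OF f(1)] H_infD(2)[OF \<phi>\<mu>])+
      have evQ: "\<forall>\<^sub>F \<nu> in at \<mu>. BCinf (Q \<nu>)" unfolding Q_def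
        using U \<mu> BCinf_quotient by (intro eventually_open_at[of U]) blast+
      have ev\<phi>: "\<forall>\<^sub>F \<nu> in at \<mu>. BCinf (\<lambda>t. \<phi> \<nu> (rot t))"
        using U \<mu> H_infD(2) by (intro eventually_open_at[of U]) blast+
      have Q: "Ck_conv n Q (\<lambda>t. f (rot t)) (at \<mu>)" using f(2) unfolding tendsto_Cinf_iff Q_def by blast
      have d0: "((\<lambda>\<nu>. \<nu> - \<mu>) \<longlongrightarrow> 0) (at \<mu>)" by (rule tendsto_eq_intros refl | simp)+
      have ev1: "\<forall>\<^sub>F \<nu> in at \<mu>. BCinf (\<lambda>t. \<nu> - \<mu>)" by (intro always_eventually allI BCinf_const)
      have ev0: "\<forall>\<^sub>F \<nu> in at \<mu>. BCinf (\<lambda>t. \<phi> \<mu> (rot t))" using BCinf\<phi> by simp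
      have ev2: "\<forall>\<^sub>F \<nu> in at \<mu>. BCinf (\<lambda>t. (\<nu> - \<mu>) * Q \<nu> t)" using evQ by eventually_elim (rule BCinf_mult[OF BCinf_const])
      \<comment> \<open>Differentiability of the family in \<nu> gives its continuity, in all
        angular derivatives.\<close>
      have "Ck_conv n (\<lambda>\<nu> t. (\<nu> - \<mu>) * Q \<nu> t) (\<lambda>t. 0 * f (rot t)) (at \<mu>)"
        by (rule Ck_conv_mult[OF ev1 evQ BCinf_const sbf Ck_conv_scalar[OF d0] Q])
      then have "Ck_conv n (\<lambda>\<nu> t. \<phi> \<mu> (rot t) + (\<nu> - \<mu>) * Q \<nu> t) (\<lambda>t. \<phi> \<mu> (rot t) + 0 * f (rot t)) (at \<mu>)"
        by (rule Ck_conv_add[OF ev0 ev2 BCinf\<phi> BCinf_mult[OF BCinf_const sbf] Ck_conv_const])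
      moreover have "\<forall>\<^sub>F \<nu> in at \<mu>. (\<lambda>t. \<phi> \<mu> (rot t) + (\<nu> - \<mu>) * Q \<nu> t) = (\<lambda>t. \<phi> \<nu> (rot t))"
        by (auto simp: eventually_at_filter Q_def)
      ultimately have \<phi>lim: "Ck_conv n (\<lambda>\<nu> t. \<phi> \<nu> (rot t)) (\<lambda>t. \<phi> \<mu> (rot t)) (at \<mu>)"
        by (simp add: Ck_conv_cong)
      have X: "Ck_conv n X A (at \<mu>)"
      proof -
        have "at 0 = filtermap (\<lambda>\<nu>. \<nu> - \<mu>) (at \<mu>)"
          using filtermap_at_shift[of \<mu> \<mu>] by simp
        then show ?thesis using Ck_conv_exp_quotient[OF A(1), of n] unfolding X_def
          by (simp add: Ck_conv_filtermap)
      qed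
      have sbX: "BCinf (X \<nu>)" for \<nu>
      proof -
        have "BCinf (\<lambda>t. (1 / (\<nu> - \<mu>)) * (exp ((\<nu> - \<mu>) * A t) + (- 1)))"
          by (intro BCinf_mult[OF BCinf_const] BCinf_add[OF _ BCinf_const] BCinf_exp A)
        then show ?thesis by (simp add: X_def)
      qed
      have sbE: "BCinf (\<lambda>t. exp ((\<mu> + 1/2) * A t))" by (rule BCinf_exp[OF BCinf_mult[OF BCinf_const A(1)]])
      note cm = Ck_conv_compose[OF a] and sc = BCinf_compose(1)[OF _ a]
      have ev\<phi>a: "\<forall>\<^sub>F \<nu> in at \<mu>. BCinf (\<lambda>t. \<phi> \<nu> (rot (a t)))" using ev\<phi> by eventually_elim (rule sc)
      have evQa: "\<forall>\<^sub>F \<nu> in at \<mu>. BCinf (\<lambda>t. Q \<nu> (a t))" using evQ by eventually_elim (rule sc)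
      have evX: "\<forall>\<^sub>F \<nu> in at \<mu>. BCinf (X \<nu>)" using sbX by simp
      have evX\<phi>: "\<forall>\<^sub>F \<nu> in at \<mu>. BCinf (\<lambda>t. X \<nu> t * \<phi> \<nu> (rot (a t)))"
        using ev\<phi>a by eventually_elim (rule BCinf_mult[OF sbX])
      have ev3: "\<forall>\<^sub>F \<nu> in at \<mu>. BCinf (\<lambda>t. X \<nu> t * \<phi> \<nu> (rot (a t)) + Q \<nu> (a t))"
        using evX\<phi> evQa by eventually_elim (rule BCinf_add)
      have 1: "Ck_conv n (\<lambda>\<nu> t. X \<nu> t * \<phi> \<nu> (rot (a t))) (\<lambda>t. A t * \<phi> \<mu> (rot (a t))) (at \<mu>)"
        by (rule Ck_conv_mult[OF evX ev\<phi>a A(1) sc[OF BCinf\<phi>] X cm[OF ev\<phi> BCinf\<phi> \<phi>lim]])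
      have 2: "Ck_conv n (\<lambda>\<nu> t. X \<nu> t * \<phi> \<nu> (rot (a t)) + Q \<nu> (a t)) (\<lambda>t. A t * \<phi> \<mu> (rot (a t)) + f (rot (a t))) (at \<mu>)"
        by (rule Ck_conv_add[OF evX\<phi> evQa BCinf_mult[OF A(1) sc[OF BCinf\<phi>]] sc[OF sbf] 1 cm[OF evQ sbf Q]])
      have 3: "Ck_conv n (\<lambda>\<nu> t. exp ((\<mu> + 1/2) * A t) * (X \<nu> t * \<phi> \<nu> (rot (a t)) + Q \<nu> (a t)))
          (\<lambda>t. exp ((\<mu> + 1/2) * A t) * (A t * \<phi> \<mu> (rot (a t)) + f (rot (a t)))) (at \<mu>)"
        by (rule Ck_conv_mult[OF _ ev3 sbE BCinf_add[OF BCinf_mult[OF A(1) sc[OF BCinf\<phi>]] sc[OF sbf]] Ck_conv_const 2])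
          (use sbE in simp)
      have eq1: "(\<lambda>t. exp ((\<mu> + 1/2) * A t) * (A t * \<phi> \<mu> (rot (a t)) + f (rot (a t)))) = (\<lambda>t. \<psi> (rot t))"
        by (simp add: \<psi>_def B act algebra_simps)
      have "exp ((\<mu> + 1/2) * A t) * (X \<nu> t * \<phi> \<nu> (rot (a t)) + Q \<nu> (a t)) =
          (ps_act \<nu> g (\<phi> \<nu>) (rot t) - ps_act \<mu> g (\<phi> \<mu>) (rot t)) / (\<nu> - \<mu>)" for \<nu> t
      proof -
        have "exp ((\<nu> + 1/2) * A t) = exp ((\<mu> + 1/2) * A t) * exp ((\<nu> - \<mu>) * A t)"
          by (simp add: algebra_simps flip: exp_add)
        moreover have "e * ((E - 1) / d * x + (x - y) / d) = (e * E * x - e * y) / d" for e E x y d :: complex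
          by (simp add: algebra_simps add_divide_distrib diff_divide_distrib)
        ultimately show ?thesis by (simp only: act X_def Q_def)
      qed
      then have ev4: "\<forall>\<^sub>F \<nu> in at \<mu>. (\<lambda>t. exp ((\<mu> + 1/2) * A t) * (X \<nu> t * \<phi> \<nu> (rot (a t)) + Q \<nu> (a t))) =
          (\<lambda>t. (ps_act \<nu> g (\<phi> \<nu>) (rot t) - ps_act \<mu> g (\<phi> \<mu>) (rot t)) / (\<nu> - \<mu>))"
        by (auto simp: eventually_at_filter)
      show "Ck_conv n (\<lambda>\<nu> \<theta>. (ps_act \<nu> g (\<phi> \<nu>) (rot \<theta>) - ps_act \<mu> g (\<phi> \<mu>) (rot \<theta>)) / (\<nu> - \<mu>)) (\<lambda>\<theta>. \<psi> (rot \<theta>)) (at \<mu>)"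
        using 3 unfolding eq1 Ck_conv_cong[OF ev4] .
    qed
    ultimately show ?thesis unfolding Cinf_derivable_def by blast
  qed
  then show ?thesis unfolding H_germ_iff
    using U ps_act_H_inf[OF g] by (intro exI[of _ U]) blast
qed

section \<open>Matrix coefficients of weight vectors\<close>

text \<open>For real \<open>s\<close> and \<open>z\<close>, the conjugate numbers \<open>ucol s z\<close> and \<open>vcol s z\<close> encode the first column of
  \<open>diagm (-s) ** rot z\<close>, \<open>Rcol s z\<close> is its squared norm, and \<open>worbit m \<mu> s z\<close> is the value at \<open>rot z\<close>
  of the weight vector \<open>m\<close> translated by \<open>diagm s\<close>, see \<open>ps_act_diagm\<close>. Complex \<open>s\<close> and \<open>z\<close> give
  access to the identity theorem and to Cauchy estimates.\<close>
definition ucol :: "complex \<Rightarrow> complex \<Rightarrow> complex" where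
  "ucol s z = exp (- s) * cos z - \<i> * exp s * sin z"
definition vcol :: "complex \<Rightarrow> complex \<Rightarrow> complex" where
  "vcol s z = exp (- s) * cos z + \<i> * exp s * sin z"
definition Rcol :: "complex \<Rightarrow> complex \<Rightarrow> complex" where
  "Rcol s z = ucol s z * vcol s z"

definition worbit :: "int \<Rightarrow> complex \<Rightarrow> complex \<Rightarrow> complex \<Rightarrow> complex" where
  "worbit m \<mu> s z = exp (- (\<mu> + (of_int m + 1) / 2) * Ln (Rcol s z)) * ucol s z powi m"

definition lower :: "int \<Rightarrow> complex \<Rightarrow> complex" where "lower m \<mu> = \<mu> + (1 - of_int m) / 2"
definition raise :: "int \<Rightarrow> complex \<Rightarrow> complex" where "raise m \<mu> = \<mu> + (of_int m + 1) / 2"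

lemma Rcol_nonzero:
  assumes "Rcol s z \<notin> \<real>\<^sub>\<le>\<^sub>0" shows "ucol s z \<noteq> 0" "vcol s z \<noteq> 0" "Rcol s z \<noteq> 0"
  using assms by (auto simp: Rcol_def)

lemma Rcol_eq: "Rcol s z = exp (- 2 * s) * (cos z)\<^sup>2 + exp (2 * s) * (sin z)\<^sup>2"
proof -
  have e: "exp (- 2 * s) = (exp (- s))\<^sup>2" "exp (2 * s) = (exp s)\<^sup>2"
    by (simp_all flip: exp_double)
  have "\<i> * \<i> = -1" by simp
  then show ?thesis unfolding Rcol_def ucol_def vcol_def e by algebra
qed

text \<open>Lowering \<open>m\<close> by 2 multiplies by \<open>Rcol / ucol^2\<close>, and
  \<open>Rcol\<close> is the product of \<open>ucol\<close> and \<open>vcol\<close>.\<close>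

lemma worbit_lower:
  assumes "Rcol s z \<notin> \<real>\<^sub>\<le>\<^sub>0" shows "worbit (m - 2) \<mu> s z = worbit m \<mu> s z * vcol s z / ucol s z"
proof -
  note nz = Rcol_nonzero[OF assms]
  have "- (\<mu> + (of_int (m - 2) + 1) / 2) * Ln (Rcol s z) = - (\<mu> + (of_int m + 1) / 2) * Ln (Rcol s z) + Ln (Rcol s z)"
    by (simp add: field_simps)
  then have "exp (- (\<mu> + (of_int (m - 2) + 1) / 2) * Ln (Rcol s z)) = exp (- (\<mu> + (of_int m + 1) / 2) * Ln (Rcol s z)) * Rcol s z"
    by (simp only: exp_add exp_Ln[OF nz(3)])
  then show ?thesis using nz
    by (simp add: worbit_def power_int_diff Rcol_def power2_eq_square)
qed

lemma worbit_raise: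
  assumes "Rcol s z \<notin> \<real>\<^sub>\<le>\<^sub>0" shows "worbit (m + 2) \<mu> s z = worbit m \<mu> s z * ucol s z / vcol s z"
  using worbit_lower[OF assms, of "m + 2"] Rcol_nonzero[OF assms] by simp

text \<open>In \<open>s\<close>, each of \<open>ucol\<close> and \<open>vcol\<close> differentiates
  into minus the other, so the logarithmic derivative of \<open>worbit\<close> is a combination of
  \<open>vcol / ucol\<close> and \<open>ucol / vcol\<close>, the factors that shift the weight by 2.
  The ladder equation thus holds along the whole orbit and not only at \<open>s = 0\<close>.\<close>

lemma worbit_deriv:
  assumes R: "Rcol s z \<notin> \<real>\<^sub>\<le>\<^sub>0"
  shows "((\<lambda>s. worbit m \<mu> s z) has_field_derivative lower m \<mu> * worbit (m - 2) \<mu> s z + raise m \<mu> * worbit (m + 2) \<mu> s z) (at s)"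
proof -
  note nz = Rcol_nonzero[OF R]
  have du: "((\<lambda>s. ucol s z) has_field_derivative - vcol s z) (at s)"
    unfolding ucol_def vcol_def by (rule derivative_eq_intros refl | simp)+
  have dv: "((\<lambda>s. vcol s z) has_field_derivative - ucol s z) (at s)"
    unfolding ucol_def vcol_def by (rule derivative_eq_intros refl | simp)+
  have dR: "((\<lambda>s. Rcol s z) has_field_derivative - (vcol s z)\<^sup>2 - (ucol s z)\<^sup>2) (at s)"
    unfolding Rcol_def by (rule derivative_eq_intros du dv refl)+ (simp add: power2_eq_square)
  have dL: "((\<lambda>s. Ln (Rcol s z)) has_field_derivative (- (vcol s z)\<^sup>2 - (ucol s z)\<^sup>2) / Rcol s z) (at s)"
    using DERIV_chain2[OF has_field_derivative_Ln[OF R] dR] by (simp add: divide_inverse mult.commute)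
  define w where "w = \<mu> + (of_int m + 1) / 2"
  have "((\<lambda>s. worbit m \<mu> s z) has_field_derivative
     exp (- w * Ln (Rcol s z)) * (- w * ((- (vcol s z)\<^sup>2 - (ucol s z)\<^sup>2) / Rcol s z)) * ucol s z powi m +
     exp (- w * Ln (Rcol s z)) * (of_int m * ucol s z powi (m - 1) * (- vcol s z))) (at s)"
  proof -
    have "((\<lambda>s. exp (- w * Ln (Rcol s z))) has_field_derivative
        exp (- w * Ln (Rcol s z)) * (- w * ((- (vcol s z)\<^sup>2 - (ucol s z)\<^sup>2) / Rcol s z))) (at s)"
      by (rule DERIV_chain2[OF DERIV_exp DERIV_cmult[OF dL]])
    moreover have "((\<lambda>s. ucol s z powi m) has_field_derivative of_int m * ucol s z powi (m - 1) * (- vcol s z)) (at s)"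
      by (rule DERIV_power_int[OF du disjI2[OF nz(1)]])
    ultimately show ?thesis unfolding worbit_def w_def[symmetric]
      using DERIV_mult by (fastforce simp: algebra_simps)
  qed
  also have "ucol s z powi (m - 1) = ucol s z powi m / ucol s z" using nz by (simp add: power_int_diff)
  also have "exp (- w * Ln (Rcol s z)) * (- w * ((- (vcol s z)\<^sup>2 - (ucol s z)\<^sup>2) / Rcol s z)) * ucol s z powi m +
     exp (- w * Ln (Rcol s z)) * (of_int m * (ucol s z powi m / ucol s z) * (- vcol s z)) =
     (exp (- w * Ln (Rcol s z)) * ucol s z powi m) *
       (w * ((vcol s z)\<^sup>2 + (ucol s z)\<^sup>2) / Rcol s z - of_int m * vcol s z / ucol s z)"
    using nz by (simp add: field_simps)
  \<comment> \<open>Here \<open>w\<close> is \<open>raise m \<mu>\<close> and \<open>w - m\<close>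
    is \<open>lower m \<mu>\<close>.\<close>
  also have "w * ((vcol s z)\<^sup>2 + (ucol s z)\<^sup>2) / Rcol s z - of_int m * vcol s z / ucol s z =
      lower m \<mu> * vcol s z / ucol s z + raise m \<mu> * ucol s z / vcol s z"
    using nz unfolding Rcol_def lower_def raise_def w_def by (simp add: divide_simps power2_eq_square) algebra
  also have "exp (- w * Ln (Rcol s z)) * ucol s z powi m = worbit m \<mu> s z" by (simp add: worbit_def w_def)
  finally show ?thesis unfolding worbit_lower[OF R] worbit_raise[OF R] by (simp add: algebra_simps)
qed

lemma worbit_0: "worbit m \<mu> 0 z = exp (- \<i> * of_int m * z)"
proof -
  have "ucol 0 z = exp (- (\<i> * z))" "vcol 0 z = exp (\<i> * z)"
    by (simp_all add: ucol_def vcol_def exp_Euler exp_minus_Euler)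
  then have "Rcol 0 z = 1" by (simp add: Rcol_def flip: exp_add)
  then show ?thesis using \<open>ucol 0 z = _\<close> by (simp add: worbit_def exp_power_int mult_ac)
qed

text \<open>The width keeps \<open>cos (2 * Im s)\<close> positive, so \<open>Rcol\<close> has
  positive real part at real angles and the principal logarithm is holomorphic there.\<close>

definition strip :: "complex set" where "strip = {s. \<bar>Im s\<bar> < pi / 4}"

lemma strip: "open strip" "convex strip" "0 \<in> strip" "of_real r \<in> strip"
proof -
  have *: "strip = {s. Im s < pi / 4} \<inter> {s. Im s > - (pi / 4)}" by (auto simp: strip_def)
  show "open strip" "convex strip" unfolding *
    by (intro open_Int open_halfspace_Im_lt open_halfspace_Im_gt convex_Int convex_halfspace_Im_lt convex_halfspace_Im_gt)+
qed (auto simp: strip_def)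

lemma Rcol_strip:
  assumes "s \<in> strip" shows "Rcol s (of_real \<theta>) \<notin> \<real>\<^sub>\<le>\<^sub>0"
proof -
  have "cos (2 * Im s) > 0" using assms by (intro cos_gt_zero_pi) (auto simp: strip_def)
  then have e: "Re (exp (- 2 * s)) > 0" "Re (exp (2 * s)) > 0" by (simp_all add: Re_exp)
  have "Re (Rcol s (of_real \<theta>)) = Re (exp (- 2 * s)) * (cos \<theta>)\<^sup>2 + Re (exp (2 * s)) * (sin \<theta>)\<^sup>2"
    unfolding Rcol_eq by (simp add: cos_of_real sin_of_real flip: of_real_power)
  moreover have "(cos \<theta>)\<^sup>2 > 0 \<or> (sin \<theta>)\<^sup>2 > 0"
    using sin_cos_squared_add[of \<theta>] by (metis add_0 power2_less_0 linorder_neqE_linordered_idom zero_neq_one)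
  ultimately have "Re (Rcol s (of_real \<theta>)) > 0"
    using e by (metis add_nonneg_pos add_pos_nonneg less_imp_le mult_nonneg_nonneg mult_pos_pos zero_le_power2)
  then show ?thesis by (auto simp: complex_nonpos_Reals_iff)
qed

lemma continuous_on_worbit:
  "continuous_on (strip \<times> UNIV) (\<lambda>(s, \<theta>). worbit m \<mu> s (of_real (\<theta> - a)))"
proof -
  have "Rcol s (of_real \<theta> - of_real a) \<notin> \<real>\<^sub>\<le>\<^sub>0" "ucol s (of_real \<theta> - of_real a) \<noteq> 0" if "s \<in> strip" for s \<theta>
    using Rcol_strip[OF that, of "\<theta> - a"] Rcol_nonzero(1) by auto
  then show ?thesis
    unfolding worbit_def case_prod_beta Rcol_def ucol_def vcol_def
    by (intro continuous_intros) (auto simp: Rcol_def ucol_def vcol_def)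
qed

text \<open>The first row of the \<open>K\<close> part, read as a complex number, is
  \<open>vcol / r\<close> with \<open>r^2 = Rcol\<close>, so its inverse is \<open>ucol / r\<close>.
  The power \<open>r^(-m)\<close> joins the multiplier, whence the shift \<open>(m + 1) / 2\<close>
  in the exponent.\<close>

lemma ps_act_diagm:
  "ps_act \<mu> (diagm s) (frobenius m v t \<mu>) (rot \<theta>) = t \<mu> * v * worbit m \<mu> (of_real s) (of_real \<theta>)"
proof -
  define N where "N = colsq (diagm (- s)) \<theta>"
  define r where "r = sqrt N"
  have N: "N > 0" using colsq_pos[OF diagm_in_SL2] by (simp add: N_def)
  then have r: "r > 0" "r * r = N" by (auto simp: r_def)
  have R: "Rcol (of_real s) (of_real \<theta>) = of_real N"
  proof -
    have "exp (-2 * s) = exp (- s) * exp (- s)" "exp (2 * s) = exp s * exp s" by (simp_all flip: exp_add)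
    then have "N = exp (-2 * s) * (cos \<theta>)\<^sup>2 + exp (2 * s) * (sin \<theta>)\<^sup>2"
      by (simp add: N_def colsq_def power2_eq_square algebra_simps)
    then show ?thesis unfolding Rcol_eq by (simp add: cos_of_real sin_of_real flip: exp_of_real)
  qed
  have R0: "Rcol (of_real s) (of_real \<theta>) \<notin> \<real>\<^sub>\<le>\<^sub>0" using Rcol_strip[OF strip(4)] .
  note nz = Rcol_nonzero[OF R0]
  have L: "Ln (Rcol (of_real s) (of_real \<theta>)) = of_real (ln N)" using N by (simp add: R Ln_of_real)
  have K: "Complex (iwK (diagm (- s) ** rot \<theta>) $ 1 $ 1) (iwK (diagm (- s) ** rot \<theta>) $ 1 $ 2) =
      vcol (of_real s) (of_real \<theta>) / of_real r"
    unfolding iwK_def colsq_eq N_def[symmetric] r_def[symmetric]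
    by (simp add: Let_def mat2_mult_nth vcol_def complex_eq_iff Re_exp Im_exp cos_of_real sin_of_real)
  have vr: "vcol (of_real s) (of_real \<theta>) = of_real r * of_real r / ucol (of_real s) (of_real \<theta>)"
    using nz R r by (simp add: Rcol_def field_simps flip: of_real_mult)
  have "inverse (delta m (iwK (diagm (- s) ** rot \<theta>))) = (ucol (of_real s) (of_real \<theta>) / of_real r) powi m"
    unfolding delta_def K vr using nz r by (simp add: power_int_divide_distrib power_int_mult_distrib field_simps)
  also have "\<dots> = ucol (of_real s) (of_real \<theta>) powi m * exp (- (of_int m / 2) * of_real (ln N))"
  proof -
    have "ln r = ln N / 2" using N by (simp add: r_def ln_sqrt)
    moreover have "r = exp (ln r)" using r(1) by simp
    ultimately have "r = exp (ln N / 2)" by metis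
    then have "complex_of_real r = exp (of_real (ln N / 2))" by (simp only: exp_of_real)
    then have "complex_of_real r = exp (of_real (ln N) / 2)" by simp
    then have "(complex_of_real r) powi m = exp (of_int m * (of_real (ln N) / 2))" by (simp add: exp_power_int)
    then show ?thesis by (simp add: power_int_divide_distrib exp_minus field_simps)
  qed
  finally have D: "inverse (delta m (iwK (diagm (- s) ** rot \<theta>))) = \<dots>" .
  have "diagm (- s) ** rot \<theta> \<in> SL2" by (intro SL2_mult diagm_in_SL2 rot_in_SL2)
  then have k: "iwK (diagm (- s) ** rot \<theta>) \<in> Kgrp" by (rule iwasawa)
  have "ps_act \<mu> (diagm s) (frobenius m v t \<mu>) (rot \<theta>) = exp ((\<mu> + 1/2) * of_real (- ln N)) * (t \<mu> * (inverse (delta m (iwK (diagm (- s) ** rot \<theta>))) * v))"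
    using k by (simp add: ps_act_rot[OF diagm_in_SL2] inv_diagm frobenius_def N_def)
  also have "\<dots> = t \<mu> * v * ((exp ((\<mu> + 1/2) * of_real (- ln N)) * exp (- (of_int m / 2) * of_real (ln N))) * ucol (of_real s) (of_real \<theta>) powi m)"
    unfolding D by simp
  also have "exp ((\<mu> + 1/2) * of_real (- ln N)) * exp (- (of_int m / 2) * of_real (ln N)) = exp (- (\<mu> + (of_int m + 1) / 2) * of_real (ln N))"
  proof -
    have "(\<mu> + 1/2) * of_real (- ln N) + - (of_int m / 2) * of_real (ln N) = - (\<mu> + (of_int m + 1) / 2) * of_real (ln N)"
      by (simp add: field_simps)
    then show ?thesis by (simp only: exp_add[symmetric])
  qed
  finally show ?thesis by (simp add: worbit_def L)
qed

text \<open>A real 2 by 2 matrix is the sum of a complex-linear and an antilinear part, of moduli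
  \<open>P\<close> and \<open>Q\<close>, and its determinant is \<open>P^2 - Q^2\<close>. So
  \<open>P = cosh s\<close> and \<open>Q = sinh s\<close>, and the arguments of the two parts are
  the sum and the difference of the angles sought.\<close>

lemma KAK:
  assumes "g \<in> SL2" obtains \<alpha> s \<beta> where "g = rot \<alpha> ** diagm s ** rot \<beta>"
proof -
  define a b c d where "a = g$1$1" and "b = g$1$2" and "c = g$2$1" and "d = g$2$2"
  have det: "a * d - b * c = 1" using assms by (simp add: SL2_iff a_def b_def c_def d_def)
  define P Q where "P = sqrt ((a + d)\<^sup>2 + (b - c)\<^sup>2) / 2" and "Q = sqrt ((a - d)\<^sup>2 + (b + c)\<^sup>2) / 2"
  have P2: "4 * P\<^sup>2 = (a + d)\<^sup>2 + (b - c)\<^sup>2" and Q2: "4 * Q\<^sup>2 = (a - d)\<^sup>2 + (b + c)\<^sup>2"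
    by (simp_all add: P_def Q_def power_divide)
  have "4 * P\<^sup>2 = 4 * Q\<^sup>2 + 4" unfolding P2 Q2 using det by algebra
  then have PQ: "P\<^sup>2 = Q\<^sup>2 + 1" by simp
  have pos: "P \<ge> 0" "Q \<ge> 0" by (simp_all add: P_def Q_def)
  define s where "s = arsinh Q"
  have sQ: "sinh s = Q" by (simp add: s_def)
  have "(cosh s)\<^sup>2 = P\<^sup>2" using cosh_square_eq[of s] PQ sQ by simp
  then have sP: "cosh s = P" using pos cosh_real_nonneg[of s] by (simp add: power2_eq_iff_nonneg)
  have polar: "\<exists>t. x = 2 * r * cos t \<and> y = 2 * r * sin t" if "4 * r\<^sup>2 = x\<^sup>2 + y\<^sup>2" for x y r :: real
  proof (cases "r = 0")
    case True then show ?thesis using that by (simp add: sum_power2_eq_zero_iff)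
  next
    case False
    have "(x / (2 * r))\<^sup>2 + (y / (2 * r))\<^sup>2 = (x\<^sup>2 + y\<^sup>2) / (2 * r)\<^sup>2"
      by (simp only: power_divide add_divide_distrib)
    also have "\<dots> = 1" using False unfolding that[symmetric] by (simp add: power_mult_distrib)
    finally obtain t where "x / (2 * r) = cos t" "y / (2 * r) = sin t" using sincos_total_2pi by metis
    then show ?thesis using False by (intro exI[of _ t]) (simp add: field_simps)
  qed
  obtain t1 where t1: "a + d = 2 * P * cos t1" "b - c = 2 * P * sin t1" using polar[OF P2] by blast
  obtain t2 where t2: "a - d = 2 * Q * cos t2" "b + c = 2 * Q * sin t2" using polar[OF Q2] by blast
  define \<alpha> \<beta> where "\<alpha> = (t1 - t2) / 2" and "\<beta> = (t1 + t2) / 2"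
  have t: "t1 = \<alpha> + \<beta>" "t2 = \<beta> - \<alpha>" by (simp_all add: \<alpha>_def \<beta>_def field_simps)
  have e: "exp s = P + Q" "exp (- s) = P - Q"
    using sP sQ cosh_plus_sinh[of s] cosh_minus_sinh[of s] by simp_all
  have "a = P * cos t1 + Q * cos t2" "d = P * cos t1 - Q * cos t2"
    "b = P * sin t1 + Q * sin t2" "c = Q * sin t2 - P * sin t1"
    using t1 t2 by linarith+
  then have "g = rot \<alpha> ** diagm s ** rot \<beta>"
    unfolding mat2_eq_iff mat2_mult_nth rot_nth diagm_nth e t cos_add sin_add cos_diff sin_diff
      a_def b_def c_def d_def
    by (simp add: algebra_simps)
  then show ?thesis by (rule that)
qed

text \<open>Up to the factor 2 pi, the Fourier coefficient at \<open>exp (- i n \<theta>)\<close>,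
  the weight vector produced by \<open>frobenius n\<close>.\<close>

definition K_coeff :: "int \<Rightarrow> (mat2 \<Rightarrow> complex) \<Rightarrow> complex" where
  "K_coeff n f = integral {0..2 * pi} (\<lambda>\<theta>. f (rot \<theta>) * cis (of_int n * \<theta>))"

text \<open>For real \<open>s\<close>, the \<open>n\<close>-th coefficient of the weight vector
  \<open>m\<close> translated by \<open>rot a ** diagm s\<close>: a matrix coefficient of the
  principal series, continued to complex \<open>s\<close>.\<close>

definition weight_coeff :: "int \<Rightarrow> int \<Rightarrow> real \<Rightarrow> complex \<Rightarrow> complex \<Rightarrow> complex" where
  "weight_coeff n m a \<mu> s = integral {0..2 * pi} (\<lambda>\<theta>. worbit m \<mu> s (of_real (\<theta> - a)) * cis (of_int n * \<theta>))"

lemma weight_coeff_integrable: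
  assumes "s \<in> strip"
  shows "(\<lambda>\<theta>. worbit m \<mu> s (of_real (\<theta> - a)) * cis (of_int n * \<theta>)) integrable_on {0..2 * pi}"
proof -
  have "continuous_on UNIV ((\<lambda>(s, \<theta>). worbit m \<mu> s (of_real (\<theta> - a))) \<circ> (\<lambda>\<theta>. (s, \<theta>)))"
    using assms by (intro continuous_on_compose continuous_intros continuous_on_subset[OF continuous_on_worbit]) auto
  then have "continuous_on {0..2*pi} (\<lambda>\<theta>. worbit m \<mu> s (of_real (\<theta> - a)))"
    by (auto simp: o_def intro: continuous_on_subset)
  then show ?thesis by (intro integrable_continuous_real continuous_intros)
qed

lemma weight_coeff_deriv:
  assumes s: "s \<in> strip"
  shows "(weight_coeff n m a \<mu> has_field_derivative lower m \<mu> * weight_coeff n (m - 2) a \<mu> s + raise m \<mu> * weight_coeff n (m + 2) a \<mu> s) (at s)"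
proof -
  let ?f = "\<lambda>m s \<theta>. worbit m \<mu> s (of_real (\<theta> - a)) * cis (of_int n * \<theta>)"
  let ?d = "\<lambda>s \<theta>. (lower m \<mu> * worbit (m - 2) \<mu> s (of_real (\<theta> - a)) + raise m \<mu> * worbit (m + 2) \<mu> s (of_real (\<theta> - a))) * cis (of_int n * \<theta>)"
  have cont: "continuous_on (strip \<times> cbox 0 (2 * pi)) (\<lambda>(s, \<theta>). worbit m \<mu> s (of_real (\<theta> - a)))" for m
    by (rule continuous_on_subset[OF continuous_on_worbit]) auto
  have "((\<lambda>s. integral (cbox 0 (2 * pi)) (?f m s)) has_field_derivative integral (cbox 0 (2 * pi)) (?d s)) (at s within strip)"
  proof (rule leibniz_rule_field_derivative)
    show "((\<lambda>s. ?f m s \<theta>) has_field_derivative ?d x \<theta>) (at x within strip)" if "x \<in> strip" for x \<theta>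
      by (rule DERIV_cmult_right[OF has_field_derivative_at_within[OF worbit_deriv[OF Rcol_strip[OF that]]]])
    show "?f m x integrable_on cbox 0 (2 * pi)" if "x \<in> strip" for x
      using weight_coeff_integrable[OF that] by (simp add: cbox_interval)
    show "continuous_on (strip \<times> cbox 0 (2 * pi)) (\<lambda>(s, \<theta>). ?d s \<theta>)"
      unfolding case_prod_beta
      by (intro continuous_on_mult continuous_on_add cont[unfolded case_prod_beta] continuous_on_const)
        (intro continuous_intros)
  qed (rule s strip(2))+
  also have "at s within strip = at s" by (rule at_within_open[OF s strip(1)])
  also have "integral (cbox 0 (2 * pi)) (?d s) = lower m \<mu> * weight_coeff n (m - 2) a \<mu> s + raise m \<mu> * weight_coeff n (m + 2) a \<mu> s"
  proof -
    have "integral {0..2 * pi} (?d s) = integral {0..2 * pi} (\<lambda>\<theta>. lower m \<mu> * ?f (m - 2) s \<theta> + raise m \<mu> * ?f (m + 2) s \<theta>)"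
      by (simp only: distrib_right mult.assoc)
    also have "\<dots> = integral {0..2 * pi} (\<lambda>\<theta>. lower m \<mu> * ?f (m - 2) s \<theta>) + integral {0..2 * pi} (\<lambda>\<theta>. raise m \<mu> * ?f (m + 2) s \<theta>)"
      by (rule integral_add) (rule integrable_on_mult_right[OF weight_coeff_integrable[OF s]])+
    finally show ?thesis by (simp add: weight_coeff_def cbox_interval)
  qed
  finally show ?thesis by (simp add: weight_coeff_def[abs_def] cbox_interval)
qed

lemma weight_coeff_holomorphic: "weight_coeff n m a \<mu> holomorphic_on strip"
  using weight_coeff_deriv holomorphic_onI by (metis (no_types, lifting) field_differentiable_at_within field_differentiable_def)

text \<open>A sum over walks of length \<open>j\<close> from \<open>m\<close> to \<open>n\<close>
  with steps of size 2, each step weighted by \<open>lower\<close> or \<open>raise\<close>. Up to a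
  common factor these are the derivatives of \<open>weight_coeff\<close> at 0.\<close>

fun coeff_deriv :: "int \<Rightarrow> nat \<Rightarrow> int \<Rightarrow> complex \<Rightarrow> complex" where
  "coeff_deriv n 0 m \<mu> = (if m = n then 1 else 0)"
| "coeff_deriv n (Suc j) m \<mu> = lower m \<mu> * coeff_deriv n j (m - 2) \<mu> + raise m \<mu> * coeff_deriv n j (m + 2) \<mu>"

lemma weight_coeff_0: "weight_coeff n m a \<mu> 0 = (if m = n then 1 else 0) * (2 * pi * cis (of_int n * a))"
proof -
  have eq: "worbit m \<mu> 0 (of_real (\<theta> - a)) * cis (of_int n * \<theta>) = cis (of_int m * a) * cis (of_int (n - m) * \<theta>)" for \<theta>
    by (simp add: worbit_0 cis_conv_exp algebra_simps flip: exp_add)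
  show ?thesis
  proof (cases "m = n")
    case True
    then show ?thesis unfolding weight_coeff_def eq by (simp add: scaleR_conv_of_real)
  next
    case False
    define k where "k = complex_of_int (n - m)"
    have k: "k \<noteq> 0" using False by (simp add: k_def)
    define G where "G = (\<lambda>z. cis (of_int m * a) * (exp (\<i> * k * z) / (\<i> * k)))"
    have G: "((\<lambda>\<theta>. cis (of_int m * a) * exp (\<i> * k * of_real \<theta>)) has_integral G (of_real (2 * pi)) - G (of_real 0)) {0..2 * pi}"
    proof (rule fundamental_theorem_of_calculus)
      fix x :: real
      have "((\<lambda>z. exp (\<i> * k * z) / (\<i> * k)) has_field_derivative exp (\<i> * k * x)) (at (of_real x))"
        using k by (auto intro!: derivative_eq_intros)
      then have "(G has_field_derivative cis (of_int m * a) * exp (\<i> * k * of_real x)) (at (of_real x))"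
        unfolding G_def by (rule DERIV_cmult)
      then show "((\<lambda>x. G (of_real x)) has_vector_derivative cis (of_int m * a) * exp (\<i> * k * of_real x)) (at x within {0..2 * pi})"
        by (rule has_vector_derivative_real_field)
    qed simp
    have c: "cis (of_int (n - m) * \<theta>) = exp (\<i> * k * of_real \<theta>)" for \<theta>
      by (simp add: k_def cis_conv_exp mult_ac)
    have "exp (\<i> * k * of_real (2 * pi)) = 1" unfolding c[symmetric]
      using cis_multiple_2pi[of "of_int (n - m)"] by (simp add: mult_ac)
    then have "G (of_real (2 * pi)) - G (of_real 0) = 0" by (simp add: G_def)
    then show ?thesis unfolding weight_coeff_def eq c using False integral_unique[OF G] by simp
  qed
qed

lemma weight_coeff_higher_deriv:
  "s \<in> strip \<Longrightarrow> (deriv ^^ Suc j) (weight_coeff n m a \<mu>) s =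
     lower m \<mu> * (deriv ^^ j) (weight_coeff n (m - 2) a \<mu>) s + raise m \<mu> * (deriv ^^ j) (weight_coeff n (m + 2) a \<mu>) s"
proof -
  assume s: "s \<in> strip"
  have "(deriv ^^ Suc j) (weight_coeff n m a \<mu>) s = (deriv ^^ j) (deriv (weight_coeff n m a \<mu>)) s"
    by (simp only: funpow_Suc_right o_apply)
  also have "\<dots> = (deriv ^^ j) (\<lambda>s. lower m \<mu> * weight_coeff n (m - 2) a \<mu> s + raise m \<mu> * weight_coeff n (m + 2) a \<mu> s) s"
    by (rule higher_deriv_transform_within_open[OF _ _ strip(1) s])
      (auto intro!: holomorphic_intros weight_coeff_holomorphic holomorphic_deriv strip(1) DERIV_imp_deriv weight_coeff_deriv)
  also have "\<dots> = (deriv ^^ j) (\<lambda>s. lower m \<mu> * weight_coeff n (m - 2) a \<mu> s) s + (deriv ^^ j) (\<lambda>s. raise m \<mu> * weight_coeff n (m + 2) a \<mu> s) s"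
    by (rule higher_deriv_add[OF _ _ strip(1) s]) (intro holomorphic_intros weight_coeff_holomorphic)+
  finally show ?thesis by (simp add: higher_deriv_cmult[OF weight_coeff_holomorphic s strip(1)])
qed

lemma weight_coeff_deriv_0: "(deriv ^^ j) (weight_coeff n m a \<mu>) 0 = coeff_deriv n j m \<mu> * (2 * pi * cis (of_int n * a))"
proof (induction j arbitrary: m)
  case 0 then show ?case by (simp add: weight_coeff_0)
next
  case (Suc j)
  show ?case unfolding weight_coeff_higher_deriv[OF strip(3)] Suc by (simp add: algebra_simps)
qed

section \<open>Ladder products and even entire functions\<close>

definition ladder :: "int \<Rightarrow> int \<Rightarrow> complex \<Rightarrow> complex" where
  "ladder n m \<mu> = (if m \<le> n then \<Prod>i<nat ((n - m) div 2). raise (m + 2 * int i) \<mu>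
     else \<Prod>i<nat ((m - n) div 2). lower (m - 2 * int i) \<mu>)"

lemma ladder_refl [simp]: "ladder n n \<mu> = 1" by (simp add: ladder_def)

lemma ladder_up:
  assumes "even (m - n)" "m < n" shows "ladder n m \<mu> = raise m \<mu> * ladder n (m + 2) \<mu>"
proof -
  have *: "m + 2 \<le> n" using assms by presburger
  then have "nat ((n - m) div 2) = Suc (nat ((n - (m + 2)) div 2))" by linarith
  then show ?thesis using assms * by (simp add: ladder_def prod.lessThan_Suc_shift algebra_simps del: prod.lessThan_Suc)
qed

lemma ladder_down:
  assumes "even (m - n)" "m > n" shows "ladder n m \<mu> = lower m \<mu> * ladder n (m - 2) \<mu>"
proof -
  have *: "m - 2 \<ge> n" using assms by presburger
  then have "nat ((m - n) div 2) = Suc (nat ((m - 2 - n) div 2))" by linarith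
  moreover have "ladder n (m - 2) \<mu> = (\<Prod>i<nat ((m - 2 - n) div 2). lower (m - 2 - 2 * int i) \<mu>)"
    using * by (auto simp: ladder_def)
  ultimately show ?thesis using assms by (simp add: ladder_def prod.lessThan_Suc_shift algebra_simps del: prod.lessThan_Suc)
qed

lemma lower_raise: "lower (m + 2) \<mu> * raise m \<mu> = \<mu>\<^sup>2 - ((of_int m + 1) / 2)\<^sup>2"
  by (simp add: lower_def raise_def field_simps power2_eq_square)

text \<open>If \<open>m > n\<close>, the step is the first one of the shortest path and the factor
  is 1. Otherwise it has to be undone, and the factor is the round trip of
  \<open>lower_raise\<close>.\<close>

lemma ladder_lower_even:
  assumes "even (m - n)"
  obtains e where "\<And>\<mu>. e (- \<mu>) = e \<mu>" "\<And>\<mu>. lower m \<mu> * ladder n (m - 2) \<mu> = ladder n m \<mu> * e \<mu>"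
proof (cases "m > n")
  case True
  show ?thesis by (rule that[of "\<lambda>_. 1"]) (simp_all add: ladder_down[OF assms True])
next
  case False
  have "even (m - 2 - n)" "m - 2 < n" using assms False by auto
  then have "lower m \<mu> * ladder n (m - 2) \<mu> = ladder n m \<mu> * (lower (m - 2 + 2) \<mu> * raise (m - 2) \<mu>)" for \<mu>
    using ladder_up[of "m - 2" n \<mu>] by simp
  then show ?thesis unfolding lower_raise by (rule that[rotated]) simp
qed

lemma ladder_raise_even:
  assumes "even (m - n)"
  obtains e where "\<And>\<mu>. e (- \<mu>) = e \<mu>" "\<And>\<mu>. raise m \<mu> * ladder n (m + 2) \<mu> = ladder n m \<mu> * e \<mu>"
proof (cases "m < n")
  case True
  show ?thesis by (rule that[of "\<lambda>_. 1"]) (simp_all add: ladder_up[OF assms True])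
next
  case False
  have "even (m + 2 - n)" "m + 2 > n" using assms False by auto
  then have "raise m \<mu> * ladder n (m + 2) \<mu> = ladder n m \<mu> * (lower (m + 2) \<mu> * raise m \<mu>)" for \<mu>
    using ladder_down[of "m + 2" n \<mu>] by simp
  then show ?thesis unfolding lower_raise by (rule that[rotated]) simp
qed

text \<open>Each walk from \<open>m\<close> to \<open>n\<close> traverses the shortest path, and its
  remaining steps pair off into round trips.\<close>

lemma coeff_deriv_factor:
  assumes "even (m - n)"
  shows "\<exists>e. (\<forall>\<mu>. e (- \<mu>) = e \<mu>) \<and> (\<forall>\<mu>. coeff_deriv n j m \<mu> = ladder n m \<mu> * e \<mu>)"
  using assms
proof (induction j arbitrary: m)
  case 0
  show ?case by (rule exI[of _ "\<lambda>_. if m = n then 1 else 0"]) auto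
next
  case (Suc j)
  have "even (m - 2 - n)" "even (m + 2 - n)" using Suc.prems by auto
  then obtain e1 e2 where e1: "\<And>\<mu>. e1 (- \<mu>) = e1 \<mu>" "\<And>\<mu>. coeff_deriv n j (m - 2) \<mu> = ladder n (m - 2) \<mu> * e1 \<mu>"
    and e2: "\<And>\<mu>. e2 (- \<mu>) = e2 \<mu>" "\<And>\<mu>. coeff_deriv n j (m + 2) \<mu> = ladder n (m + 2) \<mu> * e2 \<mu>"
    using Suc.IH by metis
  obtain d1 where d1: "\<And>\<mu>. d1 (- \<mu>) = d1 \<mu>" "\<And>\<mu>. lower m \<mu> * ladder n (m - 2) \<mu> = ladder n m \<mu> * d1 \<mu>"
    using ladder_lower_even[OF Suc.prems] by metis
  obtain d2 where d2: "\<And>\<mu>. d2 (- \<mu>) = d2 \<mu>" "\<And>\<mu>. raise m \<mu> * ladder n (m + 2) \<mu> = ladder n m \<mu> * d2 \<mu>"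
    using ladder_raise_even[OF Suc.prems] by metis
  have "coeff_deriv n (Suc j) m \<mu> = ladder n m \<mu> * (d1 \<mu> * e1 \<mu> + d2 \<mu> * e2 \<mu>)" for \<mu>
  proof -
    have "coeff_deriv n (Suc j) m \<mu> = (lower m \<mu> * ladder n (m - 2) \<mu>) * e1 \<mu> + (raise m \<mu> * ladder n (m + 2) \<mu>) * e2 \<mu>"
      by (simp add: e1 e2)
    then show ?thesis unfolding d1 d2 by (simp add: algebra_simps)
  qed
  then show ?case using e1(1) e2(1) d1(1) d2(1)
    by (intro exI[of _ "\<lambda>\<mu>. d1 \<mu> * e1 \<mu> + d2 \<mu> * e2 \<mu>"]) auto
qed

text \<open>The cofactor of the \<open>j\<close>-th derivative is the same at \<mu> and -\<mu>, so
  the hypothesis annihilates all derivatives of the combination at 0, and the identity theorem on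
  the connected strip applies.\<close>

lemma weight_coeff_relation:
  assumes "even (m - n)" "t1 * ladder n m \<mu> + t2 * ladder n m (- \<mu>) = 0" "s \<in> strip"
  shows "t1 * weight_coeff n m a \<mu> s + t2 * weight_coeff n m a (- \<mu>) s = 0"
proof (rule holomorphic_fun_eq_0_on_connected[OF _ strip(1) convex_connected[OF strip(2)] _ strip(3) assms(3)])
  show "(\<lambda>s. t1 * weight_coeff n m a \<mu> s + t2 * weight_coeff n m a (- \<mu>) s) holomorphic_on strip"
    by (intro holomorphic_intros weight_coeff_holomorphic)
  fix j
  obtain e where e: "\<And>\<mu>. e (- \<mu>) = e \<mu>" "\<And>\<mu>. coeff_deriv n j m \<mu> = ladder n m \<mu> * e \<mu>"
    using coeff_deriv_factor[OF assms(1)] by blast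
  have "(deriv ^^ j) (\<lambda>s. t1 * weight_coeff n m a \<mu> s + t2 * weight_coeff n m a (- \<mu>) s) 0 =
      (deriv ^^ j) (\<lambda>s. t1 * weight_coeff n m a \<mu> s) 0 + (deriv ^^ j) (\<lambda>s. t2 * weight_coeff n m a (- \<mu>) s) 0"
    by (rule higher_deriv_add[OF _ _ strip(1,3)]) (intro holomorphic_intros weight_coeff_holomorphic)+
  also have "\<dots> = (t1 * ladder n m \<mu> + t2 * ladder n m (- \<mu>)) * (e \<mu> * (2 * pi * cis (of_int n * a)))"
    by (simp add: higher_deriv_cmult[OF weight_coeff_holomorphic strip(3,1)] weight_coeff_deriv_0 e algebra_simps)
  finally show "(deriv ^^ j) (\<lambda>s. t1 * weight_coeff n m a \<mu> s + t2 * weight_coeff n m a (- \<mu>) s) 0 = 0"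
    using assms(2) by simp
qed

lemma prod_lessThan_rev: "(\<Prod>i<k. f i) = (\<Prod>i<k. f (k - Suc i))" for f :: "nat \<Rightarrow> complex"
  by (rule prod.nat_diff_reindex[symmetric])

text \<open>The factors of \<open>ladder\<close> are ordered along the path that starts at
  \<open>m\<close>. This is the order of \<open>qpoly\<close> if the path leads away from 0, and the
  opposite one if it leads towards 0 or across it; \<open>rev\<close> reverses the product.\<close>

lemma qpoly_eq_ladder:
  assumes "even (m - n)" shows "qpoly n m = ladder n m"
proof
  fix z :: complex
  obtain k where k: "m = n + 2 * k" using assms by (metis add.commute diff_add_cancel evenE)
  have d2: "- (2 * k) div 2 = - k" by simp
  have rev: "(\<Prod>i<l. b - of_nat i) = (\<Prod>i<l. c + of_nat i)" if "b = c + of_nat l - 1" for b c :: complex and l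
  proof -
    have "b - of_nat i = c + of_nat (l - Suc i)" if "i < l" for i
      using that by (simp add: \<open>b = _\<close> of_nat_diff)
    then show ?thesis by (subst prod_lessThan_rev[of "\<lambda>i. c + of_nat i"]) (intro prod.cong, auto)
  qed
  \<comment> \<open>A weight 0 falls under the same-sign cases, in agreement with
    \<open>qpoly\<close>.\<close>
  consider "n = m" | "m < n" "m \<ge> 0" | "n < m" "m \<le> 0" | "n < m" "n \<ge> 0" | "m < n" "n \<le> 0" | "m < 0" "0 < n" | "n < 0" "0 < m"
    by linarith
  then show "qpoly n m z = ladder n m z"
  proof cases
    case 1 then show ?thesis by (simp add: qpoly_def)
  next
    case 2
    then have "n * m \<ge> 0" by simp
    then show ?thesis using 2 by (auto simp: qpoly_def ladder_def raise_def add_divide_distrib algebra_simps)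
  next
    case 3
    then have "n * m \<ge> 0" by (simp add: mult_nonpos_nonpos)
    then show ?thesis using 3 by (auto simp: qpoly_def ladder_def lower_def add_divide_distrib diff_divide_distrib algebra_simps)
  next
    case 4
    then have "n * m \<ge> 0" by simp
    then have "qpoly n m z = (\<Prod>i<nat k. (z - (of_int n + 1) / 2) - of_nat i)"
      using 4 k by (simp add: qpoly_def)
    also have "\<dots> = (\<Prod>i<nat k. (z + (1 - of_int m) / 2) + of_nat i)"
      by (rule rev) (use 4 k in \<open>simp add: field_simps\<close>)
    also have "\<dots> = ladder n m z" using 4 k by (auto simp: ladder_def lower_def add_divide_distrib diff_divide_distrib intro!: prod.cong)
    finally show ?thesis .
  next
    case 5
    then have "n * m \<ge> 0" by (simp add: mult_nonpos_nonpos)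
    then have "qpoly n m z = (\<Prod>i<nat (- k). (z + (of_int n - 1) / 2) - of_nat i)"
      using 5 k d2 by (auto simp: qpoly_def diff_divide_distrib add_divide_distrib algebra_simps)
    also have "\<dots> = (\<Prod>i<nat (- k). (z + (of_int m + 1) / 2) + of_nat i)"
      by (rule rev) (use 5 k in \<open>simp add: field_simps\<close>)
    also have "\<dots> = ladder n m z" using 5 k by (auto simp: ladder_def raise_def add_divide_distrib diff_divide_distrib intro!: prod.cong)
    finally show ?thesis .
  next
    case 6
    then have "n * m < 0" by (simp add: mult_pos_neg)
    then have "qpoly n m z = (\<Prod>i<nat (- k). (z + (of_int n - 1) / 2) - of_nat i)"
      using 6 k d2 by (auto simp: qpoly_def)
    also have "\<dots> = (\<Prod>i<nat (- k). (z + (of_int m + 1) / 2) + of_nat i)"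
      by (rule rev) (use 6 k in \<open>simp add: field_simps\<close>)
    also have "\<dots> = ladder n m z" using 6 k by (auto simp: ladder_def raise_def add_divide_distrib diff_divide_distrib intro!: prod.cong)
    finally show ?thesis .
  next
    case 7
    then have "n * m < 0" by (simp add: mult_neg_pos)
    then have "qpoly n m z = (\<Prod>i<nat k. (z + (- of_int n - 1) / 2) - of_nat i)"
      using 7 k by (auto simp: qpoly_def)
    also have "\<dots> = (\<Prod>i<nat k. (z + (1 - of_int m) / 2) + of_nat i)"
      by (rule rev) (use 7 k in \<open>simp add: field_simps\<close>)
    also have "\<dots> = ladder n m z" using 7 k by (auto simp: ladder_def lower_def add_divide_distrib diff_divide_distrib intro!: prod.cong)
    finally show ?thesis .
  qed
qed

lemma ladder_linear_factors:
  obtains k :: nat and a :: "nat \<Rightarrow> complex" where "inj_on a {..<k}" "\<And>z. ladder n m z = (\<Prod>i<k. z - a i)"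
proof (cases "m \<le> n")
  case True
  show ?thesis
    by (rule that[of "\<lambda>i. - (of_int m + 2 * of_nat i + 1) / 2" "nat ((n - m) div 2)"])
      (use True in \<open>auto simp: inj_on_def ladder_def raise_def diff_divide_distrib add_divide_distrib intro!: prod.cong\<close>)
next
  case False
  show ?thesis
    by (rule that[of "\<lambda>i. (of_int m - 2 * of_nat i - 1) / 2" "nat ((m - n) div 2)"])
      (use False in \<open>auto simp: inj_on_def ladder_def lower_def diff_divide_distrib add_divide_distrib intro!: prod.cong\<close>)
qed

section \<open>Division of entire functions\<close>

lemma entire_zero_factor:
  fixes f :: "complex \<Rightarrow> complex"
  assumes "f holomorphic_on UNIV" "f a = 0"
  obtains g where "g holomorphic_on UNIV" "\<And>z. f z = (z - a) * g z"
proof (rule that)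
  show "(\<lambda>z. if z = a then deriv f a else (f z - f a) / (z - a)) holomorphic_on UNIV"
    by (rule pole_lemma[OF assms(1)]) simp
qed (use assms(2) in auto)

lemma entire_zeros_factor:
  fixes f :: "complex \<Rightarrow> complex" and k :: nat
  assumes f: "f holomorphic_on UNIV" and "inj_on a {..<k}" "\<And>i. i < k \<Longrightarrow> f (a i) = 0"
  shows "\<exists>g. g holomorphic_on UNIV \<and> (\<forall>z. f z = (\<Prod>i<k. z - a i) * g z)"
  using assms(2,3)
proof (induction k)
  case 0
  then show ?case using f by auto
next
  case (Suc k)
  have "inj_on a {..<k}" by (rule inj_on_subset[OF Suc.prems(1)]) auto
  then obtain g where g: "g holomorphic_on UNIV" "\<And>z. f z = (\<Prod>i<k. z - a i) * g z"
    using Suc.IH Suc.prems(2) by (meson less_SucI)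
  have "a k \<noteq> a i" if "i < k" for i
    using inj_onD[OF Suc.prems(1), of k i] that by auto
  then have "(\<Prod>i<k. a k - a i) \<noteq> 0" by auto
  moreover have "(\<Prod>i<k. a k - a i) * g (a k) = 0" using Suc.prems(2)[of k] g(2)[of "a k"] by simp
  ultimately have "g (a k) = 0" by simp
  then obtain h where "h holomorphic_on UNIV" "\<And>z. g z = (z - a k) * h z"
    using entire_zero_factor[OF g(1)] by metis
  then show ?case using g(2) by (intro exI[of _ h]) (simp add: mult_ac)
qed

text \<open>The complement of a finite set is dense, and \<open>f\<close> is continuous.\<close>

lemma entire_eq_0_off_finite:
  fixes f :: "complex \<Rightarrow> complex"
  assumes f: "f holomorphic_on UNIV" and S: "finite S" "\<And>z. z \<notin> S \<Longrightarrow> f z = 0"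
  shows "f z = 0"
proof (rule continuous_constant_on_closure[where f = f and S = "- S"])
  have "- closure (- S) = {}" using empty_interior_finite[OF S(1)] by (simp add: interior_closure)
  then have cl: "closure (- S) = UNIV" by blast
  then show "continuous_on (closure (- S)) f" "z \<in> closure (- S)"
    using holomorphic_on_imp_continuous_on[OF f] by simp_all
qed (use S in auto)

lemma holomorphic_reflect: "f holomorphic_on UNIV \<Longrightarrow> (\<lambda>z. f (- z :: complex)) holomorphic_on UNIV"
  using holomorphic_on_compose_gen[of uminus UNIV f UNIV] by (simp add: o_def holomorphic_on_minus)

text \<open>Off the finitely many zeros of the ladder and their negatives, both ladder factors can
  be cancelled from \<open>sym\<close>, which leaves evenness of the quotient.\<close>

lemma even_quotient_ladder:
  assumes f: "f holomorphic_on UNIV" and zero: "\<And>z. ladder n m z = 0 \<Longrightarrow> f z = 0"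
    and sym: "\<And>z. ladder n m (- z) * f z = ladder n m z * f (- z)"
  shows "\<exists>h. h holomorphic_on UNIV \<and> (\<forall>z. h (- z) = h z) \<and> (\<forall>z. f z = h z * ladder n m z)"
proof -
  obtain k a where a: "inj_on a {..<k::nat}" "\<And>z. ladder n m z = (\<Prod>i<k. z - a i)"
    using ladder_linear_factors[of n m] by metis
  have "f (a i) = 0" if "i < k" for i using that by (intro zero) (auto simp: a(2))
  then obtain h where h: "h holomorphic_on UNIV" "\<And>z. f z = ladder n m z * h z"
    using entire_zeros_factor[OF f a(1)] unfolding a(2)[symmetric] by blast
  have "h (- z) - h z = 0" for z
  proof (rule entire_eq_0_off_finite[of "\<lambda>z. h (- z) - h z" "a ` {..<k} \<union> (uminus \<circ> a) ` {..<k}"])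
    show "(\<lambda>z. h (- z) - h z) holomorphic_on UNIV" by (intro holomorphic_on_diff holomorphic_reflect h)
    fix z assume z: "z \<notin> a ` {..<k} \<union> (uminus \<circ> a) ` {..<k}"
    have "z \<noteq> a i" "- z \<noteq> a i" if "i < k" for i
    proof -
      show "z \<noteq> a i" using z that by auto
      show "- z \<noteq> a i"
      proof
        assume "- z = a i"
        then have "z = (uminus \<circ> a) i" by (metis comp_apply minus_minus)
        then show False using z that by blast
      qed
    qed
    then have "ladder n m z \<noteq> 0" "ladder n m (- z) \<noteq> 0" by (auto simp: a(2))
    then show "h (- z) - h z = 0" using sym[of z] by (simp add: h(2))
  qed simp
  then show ?thesis using h by (intro exI[of _ h]) (auto simp: mult.commute)
qed

text \<open>\<open>h - h c\<close> vanishes at \<open>c\<close> and at \<open>-c\<close>. For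
  \<open>c = 0\<close> the second zero comes from evenness: the first quotient is odd.\<close>

lemma even_division:
  fixes h :: "complex \<Rightarrow> complex"
  assumes h: "h holomorphic_on UNIV" "\<And>z. h (- z) = h z"
  obtains g where "g holomorphic_on UNIV" "\<And>z. g (- z) = g z" "\<And>z. h z = h c + (z\<^sup>2 - c\<^sup>2) * g z"
proof -
  have "(\<lambda>z. h z - h c) holomorphic_on UNIV" by (intro holomorphic_intros h)
  then obtain g1 where g1: "g1 holomorphic_on UNIV" "\<And>z. h z - h c = (z - c) * g1 z"
    by (rule entire_zero_factor[where a = c]) auto
  have "g1 (- c) = 0"
  proof (cases "c = 0")
    case False
    then show ?thesis using g1(2)[of "- c"] h(2)[of c] by simp
  next
    case True
    have "g1 z + g1 (- z) = 0" for z
    proof (rule entire_eq_0_off_finite[of "\<lambda>z. g1 z + g1 (- z)" "{0}"])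
      show "(\<lambda>z. g1 z + g1 (- z)) holomorphic_on UNIV" by (intro holomorphic_on_add holomorphic_reflect g1)
      fix z :: complex assume "z \<notin> {0}"
      moreover have "z * (g1 z + g1 (- z)) = 0"
        using g1(2)[of z] g1(2)[of "- z"] h(2)[of z] True by (simp add: algebra_simps)
      ultimately show "g1 z + g1 (- z) = 0" by simp
    qed simp
    from this[of 0] show ?thesis using True by simp
  qed
  then obtain g where g: "g holomorphic_on UNIV" "\<And>z. g1 z = (z - (- c)) * g z"
    by (rule entire_zero_factor[OF g1(1)]) auto
  have eq: "h z = h c + (z\<^sup>2 - c\<^sup>2) * g z" for z
    using g1(2)[of z] g(2)[of z] by (simp add: power2_eq_square algebra_simps)
  have ev: "g (- z) - g z = 0" for z
  proof (rule entire_eq_0_off_finite[of "\<lambda>z. g (- z) - g z" "{c, - c}"])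
    show "(\<lambda>z. g (- z) - g z) holomorphic_on UNIV" by (intro holomorphic_on_diff holomorphic_reflect g)
    fix z assume "z \<notin> {c, - c}"
    then have "z\<^sup>2 - c\<^sup>2 \<noteq> 0" by (simp add: power2_eq_iff)
    moreover have "(z\<^sup>2 - c\<^sup>2) * g z = (z\<^sup>2 - c\<^sup>2) * g (- z)"
      using eq[of z] eq[of "- z"] h(2)[of z] by simp
    ultimately show "g (- z) - g z = 0" by simp
  qed simp
  show ?thesis
  proof (rule that[OF g(1) _ eq])
    show "g (- z) = g z" for z using ev[of z] by simp
  qed
qed

text \<open>Repeated nodes give higher order of contact.\<close>
lemma even_interpolation:
  fixes h :: "complex \<Rightarrow> complex"
  assumes "h holomorphic_on UNIV" "\<And>z. h (- z) = h z"
  shows "\<exists>P g. g holomorphic_on UNIV \<and> (\<forall>z. h z = poly P (z\<^sup>2) + (\<Prod>c\<leftarrow>cs. z\<^sup>2 - c\<^sup>2) * g z)"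
  using assms
proof (induction cs arbitrary: h)
  case Nil
  then show ?case by (intro exI[of _ 0] exI[of _ h]) auto
next
  case (Cons c cs)
  obtain h1 where h1: "h1 holomorphic_on UNIV" "\<And>z. h1 (- z) = h1 z" "\<And>z. h z = h c + (z\<^sup>2 - c\<^sup>2) * h1 z"
    using even_division[OF Cons.prems] by metis
  obtain P g where P: "g holomorphic_on UNIV" "\<And>z. h1 z = poly P (z\<^sup>2) + (\<Prod>c\<leftarrow>cs. z\<^sup>2 - c\<^sup>2) * g z"
    using Cons.IH[OF h1(1,2)] by blast
  have "h z = poly ([:h c:] + [:- c\<^sup>2, 1:] * P) (z\<^sup>2) + (\<Prod>c\<leftarrow>c # cs. z\<^sup>2 - c\<^sup>2) * g z" for z
  proof -
    have 1: "poly ([:h c:] + [:- c\<^sup>2, 1:] * P) w = h c + (w - c\<^sup>2) * poly P w" for w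
      by (simp add: algebra_simps)
    have 2: "(\<Prod>c\<leftarrow>c # cs. z\<^sup>2 - c\<^sup>2) = (z\<^sup>2 - c\<^sup>2) * (\<Prod>c\<leftarrow>cs. z\<^sup>2 - c\<^sup>2)" by simp
    have "h z = h c + (z\<^sup>2 - c\<^sup>2) * (poly P (z\<^sup>2) + (\<Prod>c\<leftarrow>cs. z\<^sup>2 - c\<^sup>2) * g z)"
      using h1(3)[of z] P(2)[of z] by simp
    then show ?thesis unfolding 1 2 by (simp only: distrib_left mult.assoc add.assoc)
  qed
  then show ?case using P(1) by blast
qed

section \<open>Necessity\<close>

lemma Mgrp_cases: "x \<in> Mgrp \<Longrightarrow> (x = mat 1 \<Longrightarrow> P) \<Longrightarrow> (x = - mat 1 \<Longrightarrow> P) \<Longrightarrow> P"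
  by (auto simp: Mgrp_def)

lemma delta_M: "delta m (mat 1) = 1" "delta m (- mat 1) = (-1) powi m"
proof -
  have "Complex 1 0 = 1" "Complex (- 1) 0 = - 1" by (simp_all add: complex_eq_iff)
  then show "delta m (mat 1) = 1" "delta m (- mat 1) = (-1) powi m" by (simp_all add: delta_def)
qed

lemma delta_mult_M:
  assumes "x \<in> Mgrp" shows "delta m (k ** x) = delta m x * delta m k"
  using assms
proof (rule Mgrp_cases)
  assume x: "x = - mat 1"
  have "Complex (- (k$1$1)) (- (k$1$2)) = (-1) * Complex (k$1$1) (k$1$2)" by (simp add: complex_eq_iff)
  then have "delta m (k ** x) = ((-1) * Complex (k$1$1) (k$1$2)) powi m"
    by (simp add: delta_def x mat2_mult_nth)
  also have "\<dots> = delta m x * delta m k" by (simp only: power_int_mult_distrib delta_M x) (simp add: delta_def)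
  finally show ?thesis .
qed (simp add: delta_M)

definition Msgn :: "Mhat \<Rightarrow> complex" where "Msgn \<sigma> = (case \<sigma> of MTriv \<Rightarrow> 1 | MSign \<Rightarrow> -1)"

lemma Mchar_M: "Mchar \<sigma> (mat 1) = 1" "Mchar \<sigma> (- mat 1) = Msgn \<sigma>"
  by (cases \<sigma>; simp add: Msgn_def)+

text \<open>As \<open>M\<close> has two elements, equivariance of a scalar is one parity condition
  at \<open>- mat 1\<close>.\<close>

lemma Hom_M_iff: "c \<in> Hom_M (delta m) (Mchar \<sigma>) \<longleftrightarrow> c = 0 \<or> (-1) powi m = Msgn \<sigma>"
  by (auto simp: Hom_M_def Mgrp_def delta_M Mchar_M)

lemma Hom_M_parity: "even (m - n) \<Longrightarrow> Hom_M (delta m) (Mchar \<sigma>) = Hom_M (delta n) (Mchar \<sigma>)"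
  by (auto simp: Hom_M_iff power_int_minus_left)

lemma frobenius_rot: "frobenius m v t \<mu> (rot \<theta>) = t \<mu> * v * cis (- of_int m * \<theta>)"
  by (simp add: frobenius_def delta_rot cis_inverse flip: cis_inverse)

lemma BCinf_cis: "BCinf (\<lambda>\<theta>. c * cis (x * \<theta>))"
proof -
  have "BCk k (\<lambda>\<theta>. c * cis (x * \<theta>))" for k
  proof (induction k arbitrary: c)
    have bd: "bounded (range (\<lambda>\<theta>. c * cis (x * \<theta>)))" for c
      by (auto simp: bounded_iff norm_mult intro!: exI[of _ "norm c"])
    {
      case 0 show ?case using bd by simp
    next
      case (Suc k)
      show ?case
      proof (rule BCk_SucI[OF bd])
        fix t
        have "((\<lambda>z. c * exp (\<i> * of_real x * z)) has_field_derivative (c * \<i> * of_real x) * exp (\<i> * of_real x * of_real t)) (at (of_real t))"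
          by (auto intro!: derivative_eq_intros)
        then show "((\<lambda>\<theta>. c * cis (x * \<theta>)) has_vector_derivative (c * \<i> * of_real x) * cis (x * t)) (at t)"
          unfolding cis_conv_exp of_real_mult mult.assoc[symmetric] by (rule has_vector_derivative_real_field)
      qed (rule Suc)
    }
  qed
  then show ?thesis by (simp add: BCinf_def)
qed

lemma frobenius_H_inf:
  assumes "t \<mu> \<in> Hom_M (delta m) (Mchar \<sigma>)"
  shows "frobenius m v t \<mu> \<in> H_inf \<sigma>"
proof (rule H_infI)
  show "BCinf (\<lambda>\<theta>. frobenius m v t \<mu> (rot \<theta>))" unfolding frobenius_rot by (rule BCinf_cis)
  fix k x assume k: "k \<in> Kgrp" "x \<in> Mgrp"
  have "t \<mu> * inverse (delta m x) = inverse (Mchar \<sigma> x) * t \<mu>"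
    using k(2) assms by (auto simp: Mgrp_def delta_M Mchar_M Hom_M_iff)
  then have "t \<mu> * inverse (delta m x) * inverse (delta m k) * v = inverse (Mchar \<sigma> x) * t \<mu> * inverse (delta m k) * v"
    by simp
  then show "frobenius m v t \<mu> (k ** x) = inverse (Mchar \<sigma> x) * frobenius m v t \<mu> k"
    using k Kgrp_M by (simp add: frobenius_def delta_mult_M mult_ac)
qed (simp add: frobenius_def)

lemma Hom_germE:
  assumes "t \<in> Hom_germ m \<sigma> \<zeta>"
  obtains U where "open U" "\<zeta> \<in> U" "t holomorphic_on U" "\<And>\<mu>. \<mu> \<in> U \<Longrightarrow> t \<mu> \<in> Hom_M (delta m) (Mchar \<sigma>)"
proof -
  obtain U V where "open U" "\<zeta> \<in> U" "t holomorphic_on U" "open V" "\<zeta> \<in> V" "\<forall>\<mu>\<in>V. t \<mu> \<in> Hom_M (delta m) (Mchar \<sigma>)"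
    using assms by (auto simp: Hom_germ_def analytic_at eventually_nhds)
  then show ?thesis by (intro that[of "U \<inter> V"]) (auto intro: holomorphic_on_subset)
qed

lemma frobenius_germ:
  assumes "t \<in> Hom_germ m \<sigma> \<zeta>"
  shows "frobenius m v t \<in> H_germ \<sigma> \<zeta>"
proof -
  obtain U where U: "open U" "\<zeta> \<in> U" "t holomorphic_on U" "\<And>\<mu>. \<mu> \<in> U \<Longrightarrow> t \<mu> \<in> Hom_M (delta m) (Mchar \<sigma>)"
    using assms by (rule Hom_germE) blast
  have "Cinf_derivable \<sigma> (frobenius m v t) \<mu>" if \<mu>: "\<mu> \<in> U" for \<mu>
    unfolding Cinf_derivable_def
  proof (rule bexI)
    \<comment> \<open>If the parity excludes non-zero maps, \<open>t\<close> vanishes near \<mu> and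
      so does its derivative.\<close>
    have "deriv t \<mu> = 0" if "(-1) powi m \<noteq> Msgn \<sigma>"
    proof -
      have z: "t \<nu> = 0" if "\<nu> \<in> U" for \<nu> using U(4)[OF that] \<open>(-1) powi m \<noteq> Msgn \<sigma>\<close> by (simp add: Hom_M_iff)
      have "((\<lambda>_. 0) has_field_derivative deriv t \<mu>) (at \<mu>)"
        by (rule has_field_derivative_transform_within_open[OF holomorphic_derivI[OF U(3,1) \<mu>] U(1) \<mu>]) (rule z)
      from DERIV_unique[OF this DERIV_const] show ?thesis .
    qed
    then show "frobenius m v (deriv t) \<mu> \<in> H_inf \<sigma>" by (intro frobenius_H_inf) (auto simp: Hom_M_iff)
    have lim: "((\<lambda>\<nu>. (t \<nu> - t \<mu>) / (\<nu> - \<mu>)) \<longlongrightarrow> deriv t \<mu>) (at \<mu>)"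
      using holomorphic_derivI[OF U(3,1) \<mu>, of UNIV] by (simp add: has_field_derivative_iff)
    have "Ck_conv k (\<lambda>\<nu> \<theta>. ((t \<nu> - t \<mu>) / (\<nu> - \<mu>)) * (v * cis (- of_int m * \<theta>))) (\<lambda>\<theta>. deriv t \<mu> * (v * cis (- of_int m * \<theta>))) (at \<mu>)" for k
      by (rule Ck_conv_mult[OF _ _ BCinf_const BCinf_cis Ck_conv_scalar[OF lim] Ck_conv_const])
        (rule always_eventually allI BCinf_const BCinf_cis)+
    moreover have "(t \<nu> * v * c - t \<mu> * v * c) / (\<nu> - \<mu>) = ((t \<nu> - t \<mu>) / (\<nu> - \<mu>)) * (v * c)" for \<nu> c
      by (simp add: algebra_simps diff_divide_distrib)
    ultimately show "tendsto_Cinf (\<lambda>\<nu> k. (frobenius m v t \<nu> k - frobenius m v t \<mu> k) / (\<nu> - \<mu>)) (frobenius m v (deriv t) \<mu>) (at \<mu>)"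
      unfolding tendsto_Cinf_iff frobenius_rot mult.assoc[of "deriv t \<mu>"] by presburger
  qed
  then show ?thesis unfolding H_germ_iff using U frobenius_H_inf by (intro exI[of _ U]) blast
qed

lemma ps_act_rot_left: "ps_act \<mu> (rot \<alpha>) f (rot \<theta>) = f (rot (\<theta> - \<alpha>))"
  using ps_extend_on_K[of "rot (\<theta> - \<alpha>)" \<mu> f] by (simp add: ps_act_def inv_rot rot_add)

lemma ps_act_rot_frobenius: "ps_act \<mu> (rot \<beta>) (frobenius m v t \<mu>) = frobenius m (v * cis (of_int m * \<beta>)) t \<mu>"
proof
  fix k
  show "ps_act \<mu> (rot \<beta>) (frobenius m v t \<mu>) k = frobenius m (v * cis (of_int m * \<beta>)) t \<mu> k"
  proof (cases "k \<in> Kgrp")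
    case True
    then obtain \<theta> where k: "k = rot \<theta>" by (auto simp: Kgrp_def)
    show ?thesis unfolding k ps_act_rot_left frobenius_rot by (simp add: algebra_simps cis_mult)
  qed (simp add: ps_act_def frobenius_def)
qed

text \<open>The rotation applied first acts on a weight vector by a scalar, and the one applied last
  shifts the angle under the integral; the middle factor gives \<open>worbit\<close>.\<close>

lemma K_coeff_ps_act_frobenius:
  assumes "frobenius m v t \<mu> \<in> H_inf \<sigma>"
  shows "K_coeff n (ps_act \<mu> (rot \<alpha> ** diagm s ** rot \<beta>) (frobenius m v t \<mu>)) =
    t \<mu> * v * cis (of_int m * \<beta>) * weight_coeff n m \<alpha> \<mu> (of_real s)"
proof -
  have "ps_act \<mu> (rot \<alpha> ** diagm s ** rot \<beta>) (frobenius m v t \<mu>) =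
      ps_act \<mu> (rot \<alpha>) (ps_act \<mu> (diagm s) (ps_act \<mu> (rot \<beta>) (frobenius m v t \<mu>)))"
    using assms by (simp add: ps_act_mult rot_in_SL2 diagm_in_SL2 SL2_mult ps_act_H_inf matrix_mul_assoc)
  then show ?thesis
    unfolding K_coeff_def weight_coeff_def ps_act_rot_frobenius
    by (simp add: ps_act_rot_left ps_act_diagm mult.assoc)
qed

lemma K_coeff_integrable:
  assumes "f \<in> H_inf \<sigma>" shows "(\<lambda>\<theta>. f (rot \<theta>) * cis (of_int n * \<theta>)) integrable_on {0..2 * pi}"
proof -
  have "continuous_on {0..2*pi} (\<lambda>\<theta>. f (rot \<theta>))"
    by (intro continuous_at_imp_continuous_on ballI has_vector_derivative_continuous[OF BCinf_deriv[OF H_infD(2)[OF assms]]])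
  then show ?thesis by (intro integrable_continuous_real continuous_intros)
qed

lemma K_coeff_lin:
  assumes "f \<in> H_inf \<sigma>" "g \<in> H_inf \<sigma>"
  shows "K_coeff n (\<lambda>k. a * f k + b * g k) = a * K_coeff n f + b * K_coeff n g"
proof -
  have "K_coeff n (\<lambda>k. a * f k + b * g k) = integral {0..2 * pi} (\<lambda>\<theta>. a * (f (rot \<theta>) * cis (of_int n * \<theta>)) + b * (g (rot \<theta>) * cis (of_int n * \<theta>)))"
    unfolding K_coeff_def by (simp only: distrib_right mult.assoc)
  also have "\<dots> = integral {0..2 * pi} (\<lambda>\<theta>. a * (f (rot \<theta>) * cis (of_int n * \<theta>))) + integral {0..2 * pi} (\<lambda>\<theta>. b * (g (rot \<theta>) * cis (of_int n * \<theta>)))"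
    by (rule integral_add) (rule integrable_on_mult_right[OF K_coeff_integrable[OF assms(1)]] integrable_on_mult_right[OF K_coeff_integrable[OF assms(2)]])+
  finally show ?thesis by (simp add: K_coeff_def)
qed

lemma ps_act_lin: "ps_act \<mu> g (\<lambda>k. a * f k + b * h k) = (\<lambda>k. a * ps_act \<mu> g f k + b * ps_act \<mu> g h k)"
  by (simp add: fun_eq_iff ps_act_def ps_extend_def algebra_simps)

text \<open>The multiplier of \<open>g\<close> is bounded, so the coefficient of a translate is
  continuous in the sup norm. This makes the annihilator below closed.\<close>

lemma K_coeff_ps_act_bound:
  assumes g: "g \<in> SL2"
  obtains C where "C > 0" "\<And>\<sigma> a b \<epsilon>. a \<in> H_inf \<sigma> \<Longrightarrow> b \<in> H_inf \<sigma> \<Longrightarrow> (\<And>\<theta>. norm (a (rot \<theta>) - b (rot \<theta>)) \<le> \<epsilon>) \<Longrightarrow>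
    norm (K_coeff n (ps_act \<mu> g a) - K_coeff n (ps_act \<mu> g b)) \<le> C * \<epsilon>"
proof -
  obtain u w A where A: "BCinf A" and act: "\<And>\<mu> f t. ps_act \<mu> g f (rot t) = exp ((\<mu> + 1/2) * A t) * f (rot (u t))"
    using ps_act_param[OF g] by metis
  obtain B where B: "B > 0" "\<And>t. norm (exp ((\<mu> + 1/2) * A t)) \<le> B"
    using BCinf_bounded[OF BCinf_exp[OF BCinf_mult[OF BCinf_const A]], of "\<mu> + 1/2"] bounded_pos by (metis (no_types, lifting) rangeI)
  show ?thesis
  proof (rule that[of "B * (2 * pi)"])
    show "B * (2 * pi) > 0" using B by simp
    fix \<sigma> a b and \<epsilon> :: real
    assume ab: "a \<in> H_inf \<sigma>" "b \<in> H_inf \<sigma>" and le: "\<And>\<theta>. norm (a (rot \<theta>) - b (rot \<theta>)) \<le> \<epsilon>"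
    define d where "d = (\<lambda>k. 1 * a k + (-1) * b k)"
    have d: "d \<in> H_inf \<sigma>" unfolding d_def by (rule H_inf_lin[OF ab])
    have "K_coeff n (ps_act \<mu> g d) = K_coeff n (ps_act \<mu> g a) - K_coeff n (ps_act \<mu> g b)"
      unfolding d_def ps_act_lin K_coeff_lin[OF ps_act_H_inf[OF g ab(1)] ps_act_H_inf[OF g ab(2)]] by simp
    moreover have "norm (K_coeff n (ps_act \<mu> g d)) \<le> (B * \<epsilon>) * (2 * pi - 0)"
    proof -
      have "0 \<le> \<epsilon>" using le[of 0] norm_ge_zero order_trans by blast
      have bd: "norm (ps_act \<mu> g d (rot \<theta>) * cis (of_int n * \<theta>)) \<le> B * \<epsilon>" for \<theta>
        using mult_mono[OF B(2)[of \<theta>] le[of "u \<theta>"]] B(1) by (simp add: act norm_mult d_def)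
      have "norm (integral (cbox 0 (2 * pi)) (\<lambda>\<theta>. ps_act \<mu> g d (rot \<theta>) * cis (of_int n * \<theta>))) \<le> B * \<epsilon> * measure lborel (cbox 0 (2 * pi))"
        using B \<open>0 \<le> \<epsilon>\<close> K_coeff_integrable[OF ps_act_H_inf[OF g d]] bd
        by (intro has_integral_bound[OF _ integrable_integral]) (auto simp: cbox_interval)
      then show ?thesis by (simp add: K_coeff_def cbox_interval)
    qed
    ultimately show "norm (K_coeff n (ps_act \<mu> g a) - K_coeff n (ps_act \<mu> g b)) \<le> B * (2 * pi) * \<epsilon>"
      by (simp add: mult_ac)
  qed
qed

section \<open>The annihilator of a Fourier coefficient in a pair of principal series\<close>

context
  fixes \<sigma> :: Mhat and \<zeta>1 \<zeta>2 :: complex and n :: int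
begin

definition pair_datum :: datum where
  "pair_datum = [(\<sigma>, \<zeta>1, 0), (\<sigma>, \<zeta>2, 0)]"

text \<open>Quantifying over all of \<open>SL2\<close> makes the condition invariant by
  construction. It depends on the values at the two parameters, which is what classes with
  \<open>d = 0\<close> determine.\<close>

definition pair_annihilated :: "family \<Rightarrow> family \<Rightarrow> bool" where
  "pair_annihilated f g \<longleftrightarrow> (\<forall>x\<in>SL2. K_coeff n (ps_act \<zeta>1 x (f \<zeta>1)) + K_coeff n (ps_act \<zeta>2 x (g \<zeta>2)) = 0)"

definition pair_W :: "family set list set" where
  "pair_W = {jet_class pair_datum [f, g] | f g. f \<in> H_germ \<sigma> \<zeta>1 \<and> g \<in> H_germ \<sigma> \<zeta>2 \<and> pair_annihilated f g}"

lemma pair_jet_class: "jet_class pair_datum [f, g] = [jet_rel \<sigma> \<zeta>1 0 `` {f}, jet_rel \<sigma> \<zeta>2 0 `` {g}]"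
  by (simp add: jet_class_def pair_datum_def)

lemma pair_germs: "\<phi>s \<in> germs pair_datum \<longleftrightarrow> (\<exists>f g. \<phi>s = [f, g] \<and> f \<in> H_germ \<sigma> \<zeta>1 \<and> g \<in> H_germ \<sigma> \<zeta>2)"
  by (auto simp: germs_def pair_datum_def list_all2_Cons1)

lemma pair_H_sum: "x \<in> H_sum pair_datum \<longleftrightarrow> (\<exists>f g. x = jet_class pair_datum [f, g] \<and> f \<in> H_germ \<sigma> \<zeta>1 \<and> g \<in> H_germ \<sigma> \<zeta>2)"
  unfolding pair_jet_class by (auto simp: H_sum_def pair_datum_def list_all2_Cons1 H_der_def elim!: quotientE intro: quotientI)

lemma H_germ_value: "f \<in> H_germ \<tau> \<zeta> \<Longrightarrow> f \<zeta> \<in> H_inf \<tau>"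
  by (auto simp: H_germ_iff)

text \<open>Congruent germs have the same value, so membership can be tested on any
  representatives.\<close>

lemma pair_W_iff:
  assumes "f \<in> H_germ \<sigma> \<zeta>1" "g \<in> H_germ \<sigma> \<zeta>2"
  shows "jet_class pair_datum [f, g] \<in> pair_W \<longleftrightarrow> pair_annihilated f g"
proof
  assume "jet_class pair_datum [f, g] \<in> pair_W"
  then obtain f' g' where fg: "f' \<in> H_germ \<sigma> \<zeta>1" "g' \<in> H_germ \<sigma> \<zeta>2" "pair_annihilated f' g'"
    "jet_rel \<sigma> \<zeta>1 0 `` {f} = jet_rel \<sigma> \<zeta>1 0 `` {f'}" "jet_rel \<sigma> \<zeta>2 0 `` {g} = jet_rel \<sigma> \<zeta>2 0 `` {g'}"
    by (auto simp: pair_W_def pair_jet_class)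
  have "f \<zeta>1 = f' \<zeta>1" "g \<zeta>2 = g' \<zeta>2"
    using jet_rel_value eq_equiv_class[OF fg(4) equiv_jet_rel fg(1)] eq_equiv_class[OF fg(5) equiv_jet_rel fg(2)] by blast+
  then show "pair_annihilated f g" using fg(3) by (simp add: pair_annihilated_def)
qed (use assms in \<open>auto simp: pair_W_def\<close>)

lemma pair_W_subrep: "subrep pair_datum pair_W"
  unfolding subrep_def
proof (intro conjI ballI allI impI)
  show "pair_W \<subseteq> H_sum pair_datum" unfolding pair_W_def using pair_H_sum by blast
  have "ps_act \<mu> x (\<lambda>k. 0) = (\<lambda>k. 0)" for \<mu> x by (simp add: ps_act_def ps_extend_def fun_eq_iff)
  then have "pair_annihilated (\<lambda>\<mu> k. 0) (\<lambda>\<mu> k. 0)" by (simp add: pair_annihilated_def K_coeff_def)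
  then show "jet_class pair_datum (replicate (length pair_datum) (\<lambda>\<mu> k. 0)) \<in> pair_W"
    using pair_W_iff[OF H_germ_0 H_germ_0] by (simp add: pair_datum_def)
next
  fix \<phi>s \<psi>s a b
  assume "\<phi>s \<in> germs pair_datum" "\<psi>s \<in> germs pair_datum"
  then obtain f g f' g' where *: "\<phi>s = [f, g]" "f \<in> H_germ \<sigma> \<zeta>1" "g \<in> H_germ \<sigma> \<zeta>2" "\<psi>s = [f', g']" "f' \<in> H_germ \<sigma> \<zeta>1" "g' \<in> H_germ \<sigma> \<zeta>2"
    by (auto simp: pair_germs)
  assume "jet_class pair_datum \<phi>s \<in> pair_W" "jet_class pair_datum \<psi>s \<in> pair_W"
  then have ann: "pair_annihilated f g" "pair_annihilated f' g'" using * pair_W_iff by blast+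
  have "pair_annihilated (\<lambda>\<mu> k. a * f \<mu> k + b * f' \<mu> k) (\<lambda>\<mu> k. a * g \<mu> k + b * g' \<mu> k)"
    unfolding pair_annihilated_def ps_act_lin
  proof
    fix x assume x: "x \<in> SL2"
    note c1 = K_coeff_lin[OF ps_act_H_inf[OF x H_germ_value[OF *(2)]] ps_act_H_inf[OF x H_germ_value[OF *(5)]]]
    note c2 = K_coeff_lin[OF ps_act_H_inf[OF x H_germ_value[OF *(3)]] ps_act_H_inf[OF x H_germ_value[OF *(6)]]]
    have "K_coeff n (ps_act \<zeta>2 x (g \<zeta>2)) = - K_coeff n (ps_act \<zeta>1 x (f \<zeta>1))" "K_coeff n (ps_act \<zeta>2 x (g' \<zeta>2)) = - K_coeff n (ps_act \<zeta>1 x (f' \<zeta>1))"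
      using ann x by (auto simp: pair_annihilated_def eq_neg_iff_add_eq_0 add.commute)
    then show "K_coeff n (\<lambda>k. a * ps_act \<zeta>1 x (f \<zeta>1) k + b * ps_act \<zeta>1 x (f' \<zeta>1) k) +
        K_coeff n (\<lambda>k. a * ps_act \<zeta>2 x (g \<zeta>2) k + b * ps_act \<zeta>2 x (g' \<zeta>2) k) = 0"
      unfolding c1 c2 by simp
  qed
  then show "jet_class pair_datum (map2 (\<lambda>\<phi> \<psi> \<mu> k. a * \<phi> \<mu> k + b * \<psi> \<mu> k) \<phi>s \<psi>s) \<in> pair_W"
    using pair_W_iff[OF H_germ_lin[OF *(2,5)] H_germ_lin[OF *(3,6)]] by (simp add: *)
next
  fix \<phi>s y
  assume "\<phi>s \<in> germs pair_datum" and y: "y \<in> SL2"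
  then obtain f g where *: "\<phi>s = [f, g]" "f \<in> H_germ \<sigma> \<zeta>1" "g \<in> H_germ \<sigma> \<zeta>2"
    by (auto simp: pair_germs)
  assume "jet_class pair_datum \<phi>s \<in> pair_W"
  then have ann: "pair_annihilated f g" using * pair_W_iff by blast
  have "pair_annihilated (\<lambda>\<mu>. ps_act \<mu> y (f \<mu>)) (\<lambda>\<mu>. ps_act \<mu> y (g \<mu>))"
    using ann y unfolding pair_annihilated_def
    by (auto simp: ps_act_mult[OF _ y H_germ_value[OF *(2)]] ps_act_mult[OF _ y H_germ_value[OF *(3)]] SL2_mult)
  then show "jet_class pair_datum (map (\<lambda>\<phi> \<mu>. ps_act \<mu> y (\<phi> \<mu>)) \<phi>s) \<in> pair_W"
    using pair_W_iff[OF ps_act_germ[OF y *(2)] ps_act_germ[OF y *(3)]] by (simp add: *)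
qed

lemma pair_W_closed: "closedin (H_topology pair_datum) pair_W"
  unfolding closedin_def topspace_H_topology openin_H_topology
proof (intro conjI ballI)
  show "pair_W \<subseteq> H_sum pair_datum" using pair_W_subrep by (simp add: subrep_def)
  show "H_sum pair_datum - pair_W \<subseteq> H_sum pair_datum" by blast
  fix x assume x: "x \<in> H_sum pair_datum - pair_W"
  then obtain f g where fg: "x = jet_class pair_datum [f, g]" "f \<in> H_germ \<sigma> \<zeta>1" "g \<in> H_germ \<sigma> \<zeta>2"
    by (auto simp: pair_H_sum)
  then have "\<not> pair_annihilated f g" using x pair_W_iff by auto
  then obtain y where y: "y \<in> SL2" and nz: "K_coeff n (ps_act \<zeta>1 y (f \<zeta>1)) + K_coeff n (ps_act \<zeta>2 y (g \<zeta>2)) \<noteq> 0"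
    by (auto simp: pair_annihilated_def)
  obtain C1 where C1: "C1 > 0" "\<And>\<tau> a b \<epsilon>. a \<in> H_inf \<tau> \<Longrightarrow> b \<in> H_inf \<tau> \<Longrightarrow> (\<And>\<theta>. norm (a (rot \<theta>) - b (rot \<theta>)) \<le> \<epsilon>) \<Longrightarrow>
    norm (K_coeff n (ps_act \<zeta>1 y a) - K_coeff n (ps_act \<zeta>1 y b)) \<le> C1 * \<epsilon>" using K_coeff_ps_act_bound[OF y] by metis
  obtain C2 where C2: "C2 > 0" "\<And>\<tau> a b \<epsilon>. a \<in> H_inf \<tau> \<Longrightarrow> b \<in> H_inf \<tau> \<Longrightarrow> (\<And>\<theta>. norm (a (rot \<theta>) - b (rot \<theta>)) \<le> \<epsilon>) \<Longrightarrow>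
    norm (K_coeff n (ps_act \<zeta>2 y a) - K_coeff n (ps_act \<zeta>2 y b)) \<le> C2 * \<epsilon>" using K_coeff_ps_act_bound[OF y] by metis
  define \<delta> where "\<delta> = norm (K_coeff n (ps_act \<zeta>1 y (f \<zeta>1)) + K_coeff n (ps_act \<zeta>2 y (g \<zeta>2)))"
  define S where "S = C1 + C2"
  \<comment> \<open>Moving both components by at most \<epsilon> changes the sum of coefficients by
    at most \<open>\<delta> / 2\<close>.\<close>
  define \<epsilon> where "\<epsilon> = \<delta> / (2 * S)"
  have \<delta>: "\<delta> > 0" using nz by (simp add: \<delta>_def)
  have S: "S > 0" using C1(1) C2(1) by (simp add: S_def)
  have "S * \<epsilon> = \<delta> / 2" using S by (simp add: \<epsilon>_def)
  then have "S * \<epsilon> < \<delta>" using \<delta> by simp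
  then have \<epsilon>: "\<epsilon> > 0" "(C1 + C2) * \<epsilon> < \<delta>" using \<delta> S by (simp_all add: \<epsilon>_def S_def)
  \<comment> \<open>Angular order 0 is enough, since the bounds with \<open>C1\<close> and
    \<open>C2\<close> are in the sup norm.\<close>
  have "H_nbhd pair_datum x 0 \<epsilon> \<subseteq> H_sum pair_datum - pair_W"
  proof
    fix z assume z: "z \<in> H_nbhd pair_datum x 0 \<epsilon>"
    then have zs: "z \<in> H_sum pair_datum" by (simp add: H_nbhd_def)
    then obtain f' g' where fg': "z = jet_class pair_datum [f', g']" "f' \<in> H_germ \<sigma> \<zeta>1" "g' \<in> H_germ \<sigma> \<zeta>2"
      by (auto simp: pair_H_sum)
    have mem: "f \<in> x ! 0" "g \<in> x ! 1" "f' \<in> z ! 0" "g' \<in> z ! 1"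
      using fg fg' equiv_class_self[OF equiv_jet_rel] by (auto simp: pair_jet_class)
    have near: "\<forall>i<length (pair_datum). \<forall>\<tau> \<zeta> d. pair_datum ! i = (\<tau>, \<zeta>, d) \<longrightarrow> (\<forall>\<phi>\<in>x ! i. \<forall>\<psi>\<in>z ! i. \<forall>l\<le>d. \<forall>j\<le>0. \<forall>\<theta>.
        norm (K_deriv j (taylor_coeff \<zeta> l \<phi>) \<theta> - K_deriv j (taylor_coeff \<zeta> l \<psi>) \<theta>) < \<epsilon>)"
      using z unfolding H_nbhd_def mem_Collect_eq by (rule conjunct2)
    have tc: "K_deriv 0 (taylor_coeff \<zeta> 0 \<phi>) \<theta> = \<phi> \<zeta> (rot \<theta>)" for \<zeta> \<phi> \<theta>
      by (simp add: K_deriv_def taylor_coeff_def)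
    have dat: "pair_datum ! 0 = (\<sigma>, \<zeta>1, 0)" "pair_datum ! 1 = (\<sigma>, \<zeta>2, 0)" "0 < length pair_datum" "1 < length pair_datum"
      by (simp_all add: pair_datum_def)
    have n1: "norm (f \<zeta>1 (rot \<theta>) - f' \<zeta>1 (rot \<theta>)) \<le> \<epsilon>" for \<theta>
      using near[rule_format, OF dat(3,1) mem(1,3) order_refl order_refl, of \<theta>] unfolding tc by simp
    have n2: "norm (g \<zeta>2 (rot \<theta>) - g' \<zeta>2 (rot \<theta>)) \<le> \<epsilon>" for \<theta>
      using near[rule_format, OF dat(4,2) mem(2,4) order_refl order_refl, of \<theta>] unfolding tc by simp
    have b1: "norm (K_coeff n (ps_act \<zeta>1 y (f \<zeta>1)) - K_coeff n (ps_act \<zeta>1 y (f' \<zeta>1))) \<le> C1 * \<epsilon>"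
      by (rule C1(2)[OF H_germ_value[OF fg(2)] H_germ_value[OF fg'(2)] n1])
    have b2: "norm (K_coeff n (ps_act \<zeta>2 y (g \<zeta>2)) - K_coeff n (ps_act \<zeta>2 y (g' \<zeta>2))) \<le> C2 * \<epsilon>"
      by (rule C2(2)[OF H_germ_value[OF fg(3)] H_germ_value[OF fg'(3)] n2])
    have "K_coeff n (ps_act \<zeta>1 y (f' \<zeta>1)) + K_coeff n (ps_act \<zeta>2 y (g' \<zeta>2)) \<noteq> 0"
    proof
      assume 0: "K_coeff n (ps_act \<zeta>1 y (f' \<zeta>1)) + K_coeff n (ps_act \<zeta>2 y (g' \<zeta>2)) = 0"
      have "\<delta> = norm ((K_coeff n (ps_act \<zeta>1 y (f \<zeta>1)) - K_coeff n (ps_act \<zeta>1 y (f' \<zeta>1))) + (K_coeff n (ps_act \<zeta>2 y (g \<zeta>2)) - K_coeff n (ps_act \<zeta>2 y (g' \<zeta>2))))"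
        using 0 unfolding \<delta>_def by (metis add_diff_add diff_zero)
      also have "\<dots> \<le> C1 * \<epsilon> + C2 * \<epsilon>" by (rule norm_triangle_mono[OF b1 b2])
      finally show False using \<epsilon>(2) by (simp add: distrib_right)
    qed
    then have "\<not> pair_annihilated f' g'" using y by (auto simp: pair_annihilated_def)
    then show "z \<in> H_sum pair_datum - pair_W" using zs fg' pair_W_iff by auto
  qed
  then show "\<exists>N. \<exists>\<epsilon>>0. H_nbhd pair_datum x N \<epsilon> \<subseteq> H_sum pair_datum - pair_W" using \<epsilon>(1) by blast
qed

text \<open>Testing at \<open>rot 0\<close>, the unit element, recovers the scalar from its
  Frobenius partner.\<close>

lemma K_coeff_frobenius_id:
  assumes "f = frobenius n v t"
  shows "K_coeff n (ps_act \<mu> (rot 0) (f \<mu>)) = of_real (2 * pi) * (t \<mu> * v)"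
proof -
  have "f \<mu> (rot \<theta>) * cis (of_int n * \<theta>) = t \<mu> * v" for \<theta>
    by (simp add: assms(1) frobenius_rot mult.assoc cis_mult)
  then show ?thesis unfolding K_coeff_def ps_act_rot_left by (simp add: scaleR_conv_of_real)
qed

text \<open>Properness is witnessed by the weight vector \<open>n\<close> in the first component and
  0 in the second, whose coefficient at the unit element is 2 pi.\<close>

lemma pair_intertwining_datum:
  assumes "UNIV = Hom_M (delta n) (Mchar \<sigma>)"
  shows "intertwining_datum pair_datum pair_W"
proof -
  define f where "f = frobenius n 1 (\<lambda>_. 1)"
  have f: "f \<in> H_germ \<sigma> \<zeta>1" unfolding f_def using assms by (intro frobenius_germ) (auto simp: Hom_germ_def)
  have "K_coeff n (ps_act \<zeta>1 (rot 0) (f \<zeta>1)) \<noteq> 0"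
    using K_coeff_frobenius_id[OF f_def] by simp
  moreover have "K_coeff n (ps_act \<zeta>2 (rot 0) (\<lambda>k. 0)) = 0" by (simp add: K_coeff_def ps_act_rot_left)
  ultimately have "\<not> pair_annihilated f (\<lambda>\<mu> k. 0)" unfolding pair_annihilated_def using rot_in_SL2[of 0]
    by (metis add.right_neutral)
  then have "jet_class pair_datum [f, \<lambda>\<mu> k. 0] \<notin> pair_W" using pair_W_iff[OF f H_germ_0] by simp
  moreover have "jet_class pair_datum [f, \<lambda>\<mu> k. 0] \<in> H_sum pair_datum" using f H_germ_0 pair_H_sum by blast
  ultimately have "pair_W \<noteq> H_sum pair_datum" by blast
  then show ?thesis using pair_W_subrep pair_W_closed by (simp add: intertwining_datum_def)
qed

end

section \<open>From (D.3) to an even quotient\<close>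

lemma Hom_rel_value: "(t, u) \<in> Hom_rel m \<sigma> \<zeta> d \<Longrightarrow> t \<zeta> = u \<zeta>"
  by (auto simp: Hom_rel_def dest: eventually_nhds_x_imp_x)

lemma Hom_germ_0: "(\<lambda>_. 0) \<in> Hom_germ m \<sigma> \<zeta>"
  by (auto simp: Hom_germ_def Hom_M_iff)

lemma Hom_rel_refl: "t \<in> Hom_germ m \<sigma> \<zeta> \<Longrightarrow> (t, t) \<in> Hom_rel m \<sigma> \<zeta> d"
  by (auto simp: Hom_rel_def intro!: bexI[OF _ Hom_germ_0[of m \<sigma> \<zeta>]])

lemma Hom_rel_class_eqD:
  assumes "Hom_rel m \<sigma> \<zeta> d `` {t} = Hom_rel m \<sigma> \<zeta> d `` {u}" "u \<in> Hom_germ m \<sigma> \<zeta>"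
  shows "(t, u) \<in> Hom_rel m \<sigma> \<zeta> d"
  using assms Hom_rel_refl by (metis Image_singleton_iff)

text \<open>By \<open>KAK\<close> and \<open>weight_coeff_relation\<close> the constants
  \<open>t1\<close> at \<zeta> and \<open>t2\<close> at -\<zeta> define a pair in the annihilator.
  Condition (D.3) puts the products with \<phi> there as well, and the unit element reads off the
  relation. The case \<open>t1 = t2 = 0\<close> is split off because (D.3) speaks of non-zero
  \<open>t\<close>.\<close>

lemma D3_proportional:
  assumes par: "even (m - n)" and \<phi>: "\<phi> holomorphic_on UNIV" and D3: "D3 n m \<phi>"
    and t: "t1 * ladder n m \<zeta> + t2 * ladder n m (- \<zeta>) = 0"
  shows "t1 * \<phi> \<zeta> + t2 * \<phi> (- \<zeta>) = 0"
proof (cases "t1 = 0 \<and> t2 = 0")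
  case False
  \<comment> \<open>The character of \<open>M\<close> with the parity of \<open>n\<close>, for which
    every scalar is equivariant.\<close>
  define \<sigma> where "\<sigma> = (if even n then MTriv else MSign)"
  have n: "UNIV = Hom_M (delta n) (Mchar \<sigma>)" by (auto simp: Hom_M_iff \<sigma>_def Msgn_def power_int_minus_left)
  then have m: "UNIV = Hom_M (delta m) (Mchar \<sigma>)" using Hom_M_parity[OF par] by simp
  define \<xi> where "\<xi> = pair_datum \<sigma> \<zeta> (- \<zeta>)"
  define W where "W = pair_W \<sigma> \<zeta> (- \<zeta>) n"
  note iff = pair_W_iff[of _ \<sigma> \<zeta> _ "- \<zeta>" n, folded \<xi>_def W_def]
  have dat: "intertwining_datum \<xi> W" unfolding \<xi>_def W_def by (rule pair_intertwining_datum[OF n])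
  have germm: "t \<in> Hom_germ m \<sigma> \<mu>" if "t holomorphic_on UNIV" for t \<mu>
    using that m by (auto simp: Hom_germ_def analytic_at)
  define ts where "ts = [\<lambda>_::complex. t1, \<lambda>_. t2]"
  have ts: "ts \<in> Hom_germs m \<xi>" by (simp add: ts_def Hom_germs_def \<xi>_def pair_datum_def germm)
  have inW: "jet_class \<xi> (map (frobenius m v) ts) \<in> W" for v
  proof -
    have f: "frobenius m v (\<lambda>_. c) \<in> H_germ \<sigma> \<mu>" for c \<mu> by (rule frobenius_germ[OF germm]) simp
    have "pair_annihilated \<zeta> (- \<zeta>) n (frobenius m v (\<lambda>_. t1)) (frobenius m v (\<lambda>_. t2))"
      unfolding pair_annihilated_def
    proof
      fix x assume "x \<in> SL2"
      then obtain \<alpha> s \<beta> where x: "x = rot \<alpha> ** diagm s ** rot \<beta>" by (rule KAK)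
      show "K_coeff n (ps_act \<zeta> x (frobenius m v (\<lambda>_. t1) \<zeta>)) + K_coeff n (ps_act (- \<zeta>) x (frobenius m v (\<lambda>_. t2) (- \<zeta>))) = 0"
        unfolding x K_coeff_ps_act_frobenius[OF H_germ_value[OF f]]
        using arg_cong[OF weight_coeff_relation[OF par t strip(4), of \<alpha> s], of "\<lambda>w. v * cis (of_int m * \<beta>) * w"] by (simp add: algebra_simps)
    qed
    then show ?thesis using iff[OF f f] by (simp add: ts_def)
  qed
  have "Hom_class m \<xi> ts \<noteq> Hom_class m \<xi> (replicate (length \<xi>) (\<lambda>\<mu>. 0))"
  proof
    assume "Hom_class m \<xi> ts = Hom_class m \<xi> (replicate (length \<xi>) (\<lambda>\<mu>. 0))"
    then have "Hom_rel m \<sigma> \<zeta> 0 `` {\<lambda>_. t1} = Hom_rel m \<sigma> \<zeta> 0 `` {\<lambda>_. 0}" "Hom_rel m \<sigma> (- \<zeta>) 0 `` {\<lambda>_. t2} = Hom_rel m \<sigma> (- \<zeta>) 0 `` {\<lambda>_. 0}"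
      by (simp_all add: Hom_class_def ts_def \<xi>_def pair_datum_def)
    then have "t1 = 0" "t2 = 0" using Hom_rel_class_eqD[OF _ Hom_germ_0, THEN Hom_rel_value] by blast+
    then show False using False by simp
  qed
  moreover have "Hom_class m \<xi> ts \<in> D_space \<xi> W m" unfolding D_space_def using ts inW by blast
  ultimately have "Hom_class n \<xi> (map (\<lambda>t \<mu>. t \<mu> * \<phi> \<mu>) ts) \<in> D_space \<xi> W n"
    using D3 dat ts unfolding D3_def by blast
  \<comment> \<open>\<open>D_space\<close> provides some representatives \<open>us\<close>; their
    values at \<zeta> and -\<zeta> agree with those of the products with \<phi>.\<close>
  then obtain us where us: "Hom_class n \<xi> (map (\<lambda>t \<mu>. t \<mu> * \<phi> \<mu>) ts) = Hom_class n \<xi> us" "us \<in> Hom_germs n \<xi>"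
    "\<And>v. jet_class \<xi> (map (frobenius n v) us) \<in> W"
    unfolding D_space_def by blast
  obtain u1 u2 where u: "us = [u1, u2]" "u1 \<in> Hom_germ n \<sigma> \<zeta>" "u2 \<in> Hom_germ n \<sigma> (- \<zeta>)"
    using us(2) by (auto simp: Hom_germs_def \<xi>_def pair_datum_def list_all2_Cons1)
  have "Hom_rel n \<sigma> \<zeta> 0 `` {\<lambda>\<mu>. t1 * \<phi> \<mu>} = Hom_rel n \<sigma> \<zeta> 0 `` {u1}" "Hom_rel n \<sigma> (- \<zeta>) 0 `` {\<lambda>\<mu>. t2 * \<phi> \<mu>} = Hom_rel n \<sigma> (- \<zeta>) 0 `` {u2}"
    using us(1) by (simp_all add: Hom_class_def ts_def u \<xi>_def pair_datum_def)
  then have uv: "t1 * \<phi> \<zeta> = u1 \<zeta>" "t2 * \<phi> (- \<zeta>) = u2 (- \<zeta>)"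
    using Hom_rel_class_eqD[THEN Hom_rel_value] u by blast+
  note f1 = frobenius_germ[OF u(2), of 1] and f2 = frobenius_germ[OF u(3), of 1]
  have "pair_annihilated \<zeta> (- \<zeta>) n (frobenius n 1 u1) (frobenius n 1 u2)"
    using us(3)[of 1] iff[OF f1 f2] by (simp add: u)
  then have "K_coeff n (ps_act \<zeta> (rot 0) (frobenius n 1 u1 \<zeta>)) + K_coeff n (ps_act (- \<zeta>) (rot 0) (frobenius n 1 u2 (- \<zeta>))) = 0"
    unfolding pair_annihilated_def using rot_in_SL2 by blast
  then have "of_real (2 * pi) * (u1 \<zeta> + u2 (- \<zeta>)) = 0"
    using K_coeff_frobenius_id[OF refl] by (simp add: algebra_simps)
  then show ?thesis unfolding uv by simp
qed simp

text \<open>At a zero of the ladder the pair \<open>(1, 0)\<close> satisfies the linear relation; at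
  every \<open>z\<close> the pair \<open>(ladder n m (- z), - ladder n m z)\<close> does.\<close>

lemma D3_imp_quotient:
  assumes "even (m - n)" "\<phi> holomorphic_on UNIV" "D3 n m \<phi>"
  shows "\<exists>h. h holomorphic_on UNIV \<and> (\<forall>z. h (- z) = h z) \<and> (\<forall>\<mu>. \<phi> \<mu> = h \<mu> * ladder n m \<mu>)"
proof (rule even_quotient_ladder[OF assms(2)])
  note * = D3_proportional[OF assms]
  show "\<phi> z = 0" if "ladder n m z = 0" for z using *[of 1 z 0] that by simp
  show "ladder n m (- z) * \<phi> z = ladder n m z * \<phi> (- z)" for z
    using *[of "ladder n m (- z)" z "- ladder n m z"] by (simp add: mult.commute)
qed

section \<open>Complexified difference quotients\<close>

text \<open>Angular derivatives are complex derivatives of the holomorphic extension, which brings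
  them under Cauchy's estimates.\<close>

lemma funpow_rderiv_of_real:
  assumes f: "f holomorphic_on Z" "open Z" and Z: "\<And>\<theta>. of_real \<theta> \<in> Z"
  shows "(rderiv ^^ j) (\<lambda>\<theta>. f (of_real \<theta>)) = (\<lambda>\<theta>. (deriv ^^ j) f (of_real \<theta>))"
proof (induction j)
  case (Suc j)
  have "((\<lambda>\<theta>. (deriv ^^ j) f (of_real \<theta>)) has_vector_derivative (deriv ^^ Suc j) f (of_real \<theta>)) (at \<theta>)" for \<theta>
    by (rule has_vector_derivative_real_field[OF has_field_derivative_higher_deriv[OF f Z]])
  then show ?case using rderiv_eqI by (simp add: Suc)
qed simp

text \<open>Cauchy's estimate is applied with values in an open ball, whence the radius
  \<open>2 * B\<close>.\<close>

lemma Cauchy_deriv_le: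
  assumes f: "f holomorphic_on S" "cball z r \<subseteq> S" and r: "r > 0" and B: "B > 0" "\<And>w. w \<in> cball z r \<Longrightarrow> norm (f w) \<le> B"
  shows "norm ((deriv ^^ n) f z) \<le> fact n * (2 * B) / r ^ n"
proof (cases "n = 0")
  case True
  then show ?thesis using B(2)[of z] B(1) r by simp
next
  case False
  have "f holomorphic_on ball z r" "continuous_on (cball z r) f"
    by (rule holomorphic_on_subset[OF f(1)], use f(2) in force)
      (rule continuous_on_subset[OF holomorphic_on_imp_continuous_on[OF f(1)] f(2)])
  moreover have "f w \<in> ball 0 (2 * B)" if "w \<in> ball z r" for w
    using B(2)[of w] B(1) that by (simp add: dist_norm)
  ultimately show ?thesis using Cauchy_higher_deriv_bound[of f z r 0 "2 * B" n] r False by simp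
qed

text \<open>First-order Taylor formula. The second derivative is estimated on discs of radius
  \<open>\<delta> / 4\<close> around points of norm below \<open>\<delta> / 2\<close>, by
  \<open>2 * (2 * B) / (\<delta> / 4)^2\<close>, hence the constant 64.\<close>

lemma difference_quotient_le:
  assumes f: "f holomorphic_on ball 0 \<delta>" and B: "B > 0" "\<And>w. w \<in> ball 0 \<delta> \<Longrightarrow> norm (f w) \<le> B"
    and s: "norm s < \<delta> / 2" "s \<noteq> 0"
  shows "norm ((f s - f 0) / s - deriv f 0) \<le> 64 * B / \<delta>\<^sup>2 * norm s"
proof -
  have \<delta>: "\<delta> > 0" using s(1) norm_ge_zero[of s] by linarith
  define S where "S = ball (0::complex) (\<delta> / 2)"
  have 1: "((deriv ^^ i) f has_field_derivative (deriv ^^ Suc i) f x) (at x within S)" if "x \<in> S" for i x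
    by (rule has_field_derivative_at_within[OF has_field_derivative_higher_deriv[OF f open_ball]])
      (use that \<delta> in \<open>auto simp: S_def\<close>)
  have 2: "norm ((deriv ^^ Suc 1) f x) \<le> 64 * B / \<delta>\<^sup>2" if "x \<in> S" for x
  proof -
    have sub: "cball x (\<delta> / 4) \<subseteq> ball 0 \<delta>"
    proof
      fix w assume "w \<in> cball x (\<delta> / 4)"
      then have "norm w \<le> norm x + \<delta> / 4" using norm_triangle_sub[of w x] by (simp add: dist_norm norm_minus_commute)
      then show "w \<in> ball 0 \<delta>" using that \<delta> by (simp add: S_def)
    qed
    have "norm ((deriv ^^ 2) f x) \<le> fact 2 * (2 * B) / (\<delta> / 4) ^ 2"
      by (rule Cauchy_deriv_le[OF f sub _ B(1)]) (use \<delta> B(2) sub in auto)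
    then show ?thesis by (simp add: power_divide numeral_2_eq_2)
  qed
  have "norm ((deriv ^^ 0) f s - (\<Sum>i\<le>1. (deriv ^^ i) f 0 * (s - 0) ^ i / fact i)) \<le> 64 * B / \<delta>\<^sup>2 * norm (s - 0) ^ Suc 1 / fact 1"
  proof (rule complex_Taylor[where S = S])
    show "(0::complex) \<in> S" "s \<in> S" "convex S" using s \<delta> by (simp_all add: S_def)
  qed (rule 1 2, assumption)+
  then have T: "norm (f s - f 0 - deriv f 0 * s) \<le> 64 * B / \<delta>\<^sup>2 * norm s ^ 2"
    by (simp add: algebra_simps numeral_2_eq_2)
  have "(f s - f 0) / s - deriv f 0 = (f s - f 0 - deriv f 0 * s) / s" using s(2) by (simp add: field_simps)
  then have "norm ((f s - f 0) / s - deriv f 0) = norm (f s - f 0 - deriv f 0 * s) / norm s" by (simp add: norm_divide)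
  also have "\<dots> \<le> 64 * B / \<delta>\<^sup>2 * norm s ^ 2 / norm s" by (intro divide_right_mono T) simp
  also have "\<dots> = 64 * B / \<delta>\<^sup>2 * norm s" using s(2) by (simp add: power2_eq_square)
  finally show ?thesis .
qed

text \<open>The strip contains the disc of radius 1/2 around each real angle, so Cauchy's estimates
  are uniform in the angle.\<close>

definition zstrip :: "complex set" where "zstrip = {z. \<bar>Im z\<bar> < 1}"

lemma zstrip: "open zstrip" "of_real \<theta> \<in> zstrip" "cball (of_real \<theta>) (1/2) \<subseteq> zstrip"
proof -
  have *: "zstrip = {s. Im s < 1} \<inter> {s. Im s > - 1}" by (auto simp: zstrip_def)
  show "open zstrip" unfolding *
    by (intro open_Int open_halfspace_Im_lt open_halfspace_Im_gt)
  show "cball (of_real \<theta>) (1/2) \<subseteq> zstrip"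
  proof
    fix z assume "z \<in> cball (complex_of_real \<theta>) (1/2)"
    then have "norm (z - of_real \<theta>) \<le> 1/2" by (simp add: dist_norm norm_minus_commute)
    then have "\<bar>Im z\<bar> \<le> 1/2" using abs_Im_le_cmod[of "z - of_real \<theta>"] by simp
    then show "z \<in> zstrip" by (simp add: zstrip_def)
  qed
qed (simp add: zstrip_def)

text \<open>The constant 3 bounds \<open>exp 1\<close>, which dominates \<open>exp (i z)\<close> and
  \<open>exp (- i z)\<close> on the strip.\<close>

lemma trig_bound:
  assumes "z \<in> zstrip" shows "norm (cos z) \<le> 3" "norm (sin z) \<le> 3"
proof -
  have e: "norm (exp (\<i> * z)) \<le> 3" "norm (exp (- (\<i> * z))) \<le> 3"
    using assms exp_le by (auto simp: zstrip_def norm_exp_eq_Re intro: order_trans[of _ "exp 1"])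
  show "norm (cos z) \<le> 3" unfolding cos_exp_eq
    using norm_triangle_mono[OF e] by (simp add: norm_divide)
  show "norm (sin z) \<le> 3" unfolding sin_exp_eq
    using norm_triangle_ineq4[of "exp (\<i> * z)" "exp (- (\<i> * z))"] e by (simp add: norm_divide norm_mult)
qed

text \<open>For complex angles \<open>Rcol\<close> can meet the cut of the logarithm when
  \<open>s\<close> is large. For small \<open>s\<close> it is close to \<open>Rcol 0 z = 1\<close>,
  uniformly on the strip.\<close>

lemma Rcol_near_1:
  obtains \<delta> where "0 < \<delta>" "\<delta> \<le> 1" "\<And>s z. norm s < \<delta> \<Longrightarrow> z \<in> zstrip \<Longrightarrow> norm (Rcol s z - 1) \<le> 1/2"
proof -
  \<comment> \<open>9 is the square of the bound 3 for \<open>cos\<close> and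
    \<open>sin\<close>.\<close>
  define k where "k = (\<lambda>s::complex. 9 * norm (exp (-2 * s) - 1) + 9 * norm (exp (2 * s) - 1))"
  have "isCont k 0" unfolding k_def by (intro continuous_intros)
  then have "(k \<longlongrightarrow> 0) (at 0)" by (simp add: isCont_def k_def)
  then have "\<forall>\<^sub>F s in at 0. k s < 1/2" by (rule order_tendstoD) simp
  then obtain d where d: "d > 0" "\<And>s. s \<noteq> 0 \<Longrightarrow> norm s < d \<Longrightarrow> k s < 1/2"
    unfolding eventually_at by (auto simp: dist_norm)
  have "norm (Rcol s z - 1) \<le> 1/2" if s: "norm s < min d 1" and z: "z \<in> zstrip" for s z
  proof -
    have ks: "k s \<le> 1/2" using d(2)[of s] s by (cases "s = 0") (auto simp: k_def)
    have "Rcol s z - 1 = (exp (-2 * s) - 1) * (cos z)\<^sup>2 + (exp (2 * s) - 1) * (sin z)\<^sup>2"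
      unfolding Rcol_eq using sin_cos_squared_add[of z] by algebra
    also have "norm \<dots> \<le> norm (exp (-2 * s) - 1) * (norm (cos z))\<^sup>2 + norm (exp (2 * s) - 1) * (norm (sin z))\<^sup>2"
      by (rule order_trans[OF norm_triangle_ineq]) (simp add: norm_mult norm_power)
    also have "\<dots> \<le> norm (exp (-2 * s) - 1) * 3\<^sup>2 + norm (exp (2 * s) - 1) * 3\<^sup>2"
      using trig_bound[OF z] by (intro add_mono mult_left_mono power_mono) auto
    also have "\<dots> = k s" by (simp add: k_def)
    finally show ?thesis using ks by simp
  qed
  then show ?thesis using that[of "min d 1"] d(1) by auto
qed

lemma near_1_not_nonpos: "norm (w - 1 :: complex) \<le> 1/2 \<Longrightarrow> w \<notin> \<real>\<^sub>\<le>\<^sub>0"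
  using abs_Re_le_cmod[of "w - 1"] by (auto simp: complex_nonpos_Reals_iff)

text \<open>Uniformity in the spectral parameter, the group parameter and the angle prepares the
  Cauchy estimates in all three. For negative \<open>m\<close> the inverse of \<open>ucol\<close> is
  bounded as \<open>vcol / Rcol\<close>, with \<open>Rcol\<close> at least 1/2 in modulus.\<close>

lemma worbit_bounded:
  assumes \<delta>: "\<delta> \<le> 1" "\<And>s z. norm s < \<delta> \<Longrightarrow> z \<in> zstrip \<Longrightarrow> norm (Rcol s z - 1) \<le> 1/2"
  obtains B where "B > 0" "\<And>\<mu> s z. \<mu> \<in> cball \<zeta> 1 \<Longrightarrow> norm s < \<delta> \<Longrightarrow> z \<in> zstrip \<Longrightarrow> norm (worbit m \<mu> s z) \<le> B"
proof -
  have "compact (Ln ` cball 1 (1/2))"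
    using near_1_not_nonpos by (intro compact_continuous_image continuous_on_Ln continuous_on_id) (auto simp: dist_norm norm_minus_commute)
  then obtain l where l: "l > 0" "\<And>w. w \<in> cball 1 (1/2) \<Longrightarrow> norm (Ln w) \<le> l"
    using compact_imp_bounded bounded_pos by (metis imageI)
  define c where "c = norm \<zeta> + 1 + norm ((of_int m + 1) / 2 :: complex)"
  have "norm (worbit m \<mu> s z) \<le> exp (c * l) * 36 ^ nat \<bar>m\<bar>"
    if \<mu>: "\<mu> \<in> cball \<zeta> 1" and s: "norm s < \<delta>" and z: "z \<in> zstrip" for \<mu> s z
  proof -
    note R = \<delta>(2)[OF s z]
    note nz = Rcol_nonzero[OF near_1_not_nonpos[OF R]]
    have L: "norm (Ln (Rcol s z)) \<le> l" using R by (intro l) (simp add: dist_norm norm_minus_commute)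
    have "norm \<mu> \<le> norm \<zeta> + 1" using \<mu> norm_triangle_sub[of \<mu> \<zeta>] by (simp add: dist_norm norm_minus_commute)
    then have "norm (\<mu> + (of_int m + 1) / 2) \<le> c" unfolding c_def by (intro norm_triangle_mono) auto
    then have "norm (- (\<mu> + (of_int m + 1) / 2) * Ln (Rcol s z)) \<le> c * l"
      unfolding norm_mult norm_minus_cancel by (intro mult_mono' L) auto
    then have E: "norm (exp (- (\<mu> + (of_int m + 1) / 2) * Ln (Rcol s z))) \<le> exp (c * l)"
      using norm_exp exp_le_cancel_iff order_trans by blast
    have es: "norm (exp s) \<le> 3" "norm (exp (- s)) \<le> 3"
      using s \<delta>(1) exp_le norm_exp[of s] norm_exp[of "- s"] by (auto intro: order_trans[of _ "exp (norm s)"] order_trans[of _ "exp 1"])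
    have p: "norm (exp (- s) * cos z) \<le> 9" "norm (\<i> * exp s * sin z) \<le> 9"
      using mult_mono'[OF es(2) trig_bound(1)[OF z]] mult_mono'[OF es(1) trig_bound(2)[OF z]] by (simp_all add: norm_mult)
    have uv: "norm (ucol s z) \<le> 18" "norm (vcol s z) \<le> 18"
      using p norm_triangle_ineq4[of "exp (- s) * cos z" "\<i> * exp s * sin z"] norm_triangle_ineq[of "exp (- s) * cos z" "\<i> * exp s * sin z"]
      unfolding ucol_def vcol_def by linarith+
    have "norm (Rcol s z) \<ge> 1/2" using R norm_triangle_ineq2[of 1 "1 - Rcol s z"] by (simp add: norm_minus_commute)
    then have "norm (vcol s z) / norm (Rcol s z) \<le> 18 / (1/2)" using uv(2) by (intro frac_le) auto
    moreover have "inverse (ucol s z) = vcol s z / Rcol s z" using nz by (simp add: Rcol_def field_simps)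
    ultimately have iu: "norm (inverse (ucol s z)) \<le> 36" by (simp add: norm_divide)
    have "norm (ucol s z powi m) \<le> 36 ^ nat \<bar>m\<bar>"
    proof (cases "m \<ge> 0")
      case True
      then have "norm (ucol s z powi m) = norm (ucol s z) ^ nat \<bar>m\<bar>" by (simp add: power_int_def norm_power)
      also have "\<dots> \<le> 36 ^ nat \<bar>m\<bar>" using uv(1) by (intro power_mono) auto
      finally show ?thesis .
    next
      case False
      then have "norm (ucol s z powi m) = norm (inverse (ucol s z)) ^ nat \<bar>m\<bar>" by (simp add: power_int_def norm_power)
      also have "\<dots> \<le> 36 ^ nat \<bar>m\<bar>" using iu by (intro power_mono) auto
      finally show ?thesis .
    qed
    then show ?thesis unfolding worbit_def norm_mult using E by (intro mult_mono) auto
  qed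
  moreover have "0 < exp (c * l) * 36 ^ nat \<bar>m\<bar>" by (intro mult_pos_pos) simp_all
  ultimately show ?thesis using that by blast
qed

text \<open>The derivative of \<open>worbit m \<mu> s z\<close> in \<open>s\<close> at 0.\<close>

definition weight_deriv :: "int \<Rightarrow> complex \<Rightarrow> complex \<Rightarrow> complex" where
  "weight_deriv m \<mu> z = lower m \<mu> * exp (- \<i> * of_int (m - 2) * z) + raise m \<mu> * exp (- \<i> * of_int (m + 2) * z)"

text \<open>Cauchy's estimate for the second derivative in \<open>s\<close> makes the error linear
  in \<open>s\<close>, with a constant uniform in \<mu> and \<open>z\<close>. Convergence of the
  derivatives in \<mu> and \<open>z\<close> is deduced from this bound.\<close>

lemma worbit_quotient_bound:
  obtains \<delta> C where "\<delta> > 0" "C > 0"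
    "\<And>s z. norm (s::complex) < \<delta> \<Longrightarrow> z \<in> zstrip \<Longrightarrow> Rcol s z \<notin> \<real>\<^sub>\<le>\<^sub>0"
    "\<And>\<mu> s z. \<mu> \<in> cball \<zeta> 1 \<Longrightarrow> norm (s::complex) < \<delta> \<Longrightarrow> s \<noteq> 0 \<Longrightarrow> z \<in> zstrip \<Longrightarrow>
      norm ((worbit m \<mu> s z - worbit m \<mu> 0 z) / s - weight_deriv m \<mu> z) \<le> C * norm s"
proof -
  obtain \<delta> where \<delta>: "0 < \<delta>" "\<delta> \<le> 1" "\<And>s z. norm s < \<delta> \<Longrightarrow> z \<in> zstrip \<Longrightarrow> norm (Rcol s z - 1) \<le> 1/2"
    using Rcol_near_1 by metis
  obtain B where B: "B > 0" "\<And>\<mu> s z. \<mu> \<in> cball \<zeta> 1 \<Longrightarrow> norm s < \<delta> \<Longrightarrow> z \<in> zstrip \<Longrightarrow> norm (worbit m \<mu> s z) \<le> B"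
    using worbit_bounded[OF \<delta>(2,3)] by metis
  have R: "Rcol s z \<notin> \<real>\<^sub>\<le>\<^sub>0" if "norm s < \<delta>" "z \<in> zstrip" for s z
    by (rule near_1_not_nonpos[OF \<delta>(3)[OF that]])
  show ?thesis
  proof (rule that[of "\<delta> / 2" "64 * B / \<delta>\<^sup>2"])
    fix \<mu> s z :: complex assume *: "\<mu> \<in> cball \<zeta> 1" "norm s < \<delta> / 2" "s \<noteq> 0" "z \<in> zstrip"
    have D: "((\<lambda>s. worbit m \<mu> s z) has_field_derivative lower m \<mu> * worbit (m - 2) \<mu> s z + raise m \<mu> * worbit (m + 2) \<mu> s z) (at s)" if "norm s < \<delta>" for s
      by (rule worbit_deriv[OF R[OF that *(4)]])
    have "(\<lambda>s. worbit m \<mu> s z) holomorphic_on ball 0 \<delta>"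
      by (rule holomorphic_onI, unfold field_differentiable_def, rule exI, rule has_field_derivative_at_within[OF D]) simp
    moreover have "deriv (\<lambda>s. worbit m \<mu> s z) 0 = weight_deriv m \<mu> z"
      using DERIV_imp_deriv[OF D[of 0]] \<delta>(1) by (simp add: weight_deriv_def worbit_0)
    ultimately show "norm ((worbit m \<mu> s z - worbit m \<mu> 0 z) / s - weight_deriv m \<mu> z) \<le> 64 * B / \<delta>\<^sup>2 * norm s"
      using difference_quotient_le[of "\<lambda>s. worbit m \<mu> s z" \<delta> B s] B * by auto
  qed (use \<delta>(1) B(1) R in auto)
qed

section \<open>Jets in the spectral parameter\<close>

lemma higher_deriv_worbit: "(deriv ^^ b) (\<lambda>\<mu>. worbit m \<mu> s z) = (\<lambda>\<mu>. (- Ln (Rcol s z)) ^ b * worbit m \<mu> s z)"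
proof (induction b)
  case (Suc b)
  have "((\<lambda>\<mu>. (- Ln (Rcol s z)) ^ b * worbit m \<mu> s z) has_field_derivative (- Ln (Rcol s z)) ^ Suc b * worbit m \<mu> s z) (at \<mu>)" for \<mu>
    unfolding worbit_def by (auto intro!: derivative_eq_intros)
  then show ?case by (simp add: Suc fun_eq_iff DERIV_imp_deriv)
qed simp

lemma higher_deriv_weight_deriv: "(deriv ^^ b) (\<lambda>\<mu>. weight_deriv m \<mu> z) =
  (\<lambda>\<mu>. if b = 0 then weight_deriv m \<mu> z else if b = 1 then exp (- \<i> * of_int (m - 2) * z) + exp (- \<i> * of_int (m + 2) * z) else 0)"
proof (induction b)
  case (Suc b)
  have "((\<lambda>\<mu>. weight_deriv m \<mu> z) has_field_derivative exp (- \<i> * of_int (m - 2) * z) + exp (- \<i> * of_int (m + 2) * z)) (at \<mu>)" for \<mu>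
    unfolding weight_deriv_def lower_def raise_def by (auto intro!: derivative_eq_intros)
  then show ?case by (auto simp: Suc fun_eq_iff intro!: DERIV_imp_deriv)
qed simp

lemma worbit_holomorphic_z:
  assumes "\<And>z. z \<in> zstrip \<Longrightarrow> Rcol s z \<notin> \<real>\<^sub>\<le>\<^sub>0"
  shows "(\<lambda>z. worbit m \<mu> s z) holomorphic_on zstrip" "(\<lambda>z. Ln (Rcol s z)) holomorphic_on zstrip"
proof -
  have u: "(\<lambda>z. ucol s z) holomorphic_on zstrip" "(\<lambda>z. vcol s z) holomorphic_on zstrip"
    unfolding ucol_def vcol_def by (intro holomorphic_intros)+
  then have "(\<lambda>z. Rcol s z) holomorphic_on zstrip" unfolding Rcol_def by (intro holomorphic_intros)
  then show L: "(\<lambda>z. Ln (Rcol s z)) holomorphic_on zstrip" using assms by (intro holomorphic_intros) auto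
  show "(\<lambda>z. worbit m \<mu> s z) holomorphic_on zstrip"
    unfolding worbit_def using Rcol_nonzero(1)[OF assms] by (intro holomorphic_intros L u) auto
qed

text \<open>The Taylor coefficient of order \<open>l\<close> at \<open>\<zeta>\<close> in the spectral parameter, up to the factor
  \<open>l!\<close>, with the angle \<open>z\<close> complexified.\<close>
definition jet_deriv :: "(complex \<Rightarrow> complex) \<Rightarrow> complex \<Rightarrow> nat \<Rightarrow> (complex \<Rightarrow> complex \<Rightarrow> complex) \<Rightarrow> complex \<Rightarrow> complex" where
  "jet_deriv t \<zeta> l f z = (\<Sum>i = 0..l. of_nat (l choose i) * (deriv ^^ i) t \<zeta> * (deriv ^^ (l - i)) (\<lambda>\<mu>. f \<mu> z) \<zeta>)"

lemma jet_deriv_eq: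
  assumes "t analytic_on {\<zeta>}" "(\<lambda>\<mu>. f \<mu> z) holomorphic_on UNIV"
  shows "(deriv ^^ l) (\<lambda>\<mu>. t \<mu> * f \<mu> z) \<zeta> = jet_deriv t \<zeta> l f z"
  unfolding jet_deriv_def using assms
  by (intro higher_deriv_mult_at) (auto simp: analytic_at)

definition weight_quot :: "int \<Rightarrow> complex \<Rightarrow> complex \<Rightarrow> complex \<Rightarrow> complex" where
  "weight_quot m s \<mu> z = (worbit m \<mu> s z - worbit m \<mu> 0 z) / s"

lemma holo_mu: "(\<lambda>\<mu>. weight_deriv m \<mu> z) holomorphic_on UNIV" "(\<lambda>\<mu>. weight_quot m s \<mu> z) holomorphic_on UNIV"
  unfolding weight_deriv_def lower_def raise_def weight_quot_def worbit_def by (intro holomorphic_intros; simp)+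

lemma holo_z:
  "(\<lambda>z. (deriv ^^ b) (\<lambda>\<mu>. weight_deriv m \<mu> z) \<zeta>) holomorphic_on zstrip"
  unfolding higher_deriv_weight_deriv
  by (cases "b = 0"; cases "b = 1") (auto simp: weight_deriv_def intro!: holomorphic_intros)

lemma higher_deriv_weight_quot:
  "(deriv ^^ b) (\<lambda>\<mu>. weight_quot m s \<mu> z) \<zeta> = ((- Ln (Rcol s z)) ^ b * worbit m \<zeta> s z - (- Ln (Rcol 0 z)) ^ b * worbit m \<zeta> 0 z) / s"
proof -
  have h: "(\<lambda>\<mu>. worbit m \<mu> s z) holomorphic_on UNIV" for s unfolding worbit_def by (intro holomorphic_intros)
  have "(deriv ^^ b) (\<lambda>\<mu>. weight_quot m s \<mu> z) \<zeta> = (deriv ^^ b) (\<lambda>\<mu>. (1 / s) * (worbit m \<mu> s z - worbit m \<mu> 0 z)) \<zeta>"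
    by (simp add: weight_quot_def)
  also have "\<dots> = (1 / s) * (deriv ^^ b) (\<lambda>\<mu>. worbit m \<mu> s z - worbit m \<mu> 0 z) \<zeta>"
    by (rule higher_deriv_cmult[of _ UNIV]) (auto intro!: holomorphic_intros h)
  also have "(deriv ^^ b) (\<lambda>\<mu>. worbit m \<mu> s z - worbit m \<mu> 0 z) \<zeta> = (deriv ^^ b) (\<lambda>\<mu>. worbit m \<mu> s z) \<zeta> - (deriv ^^ b) (\<lambda>\<mu>. worbit m \<mu> 0 z) \<zeta>"
    by (rule higher_deriv_diff[of _ UNIV]) (auto intro!: h)
  finally show ?thesis by (simp add: higher_deriv_worbit)
qed

lemma holo_z_q:
  assumes "\<And>z. z \<in> zstrip \<Longrightarrow> Rcol s z \<notin> \<real>\<^sub>\<le>\<^sub>0" "\<And>z. z \<in> zstrip \<Longrightarrow> Rcol 0 z \<notin> \<real>\<^sub>\<le>\<^sub>0"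
  shows "(\<lambda>z. (deriv ^^ b) (\<lambda>\<mu>. weight_quot m s \<mu> z) \<zeta>) holomorphic_on zstrip"
  unfolding higher_deriv_weight_quot divide_inverse
  by (intro holomorphic_intros worbit_holomorphic_z assms)

text \<open>Two further Cauchy estimates: on the unit disc around \<zeta> for the derivatives in the
  spectral parameter, and on discs of radius 1/2 around real angles for the derivative of order
  \<open>j\<close>.\<close>

lemma jet_deriv_limit:
  assumes t: "t analytic_on {\<zeta>}" and \<epsilon>: "\<epsilon> > 0"
  shows "\<forall>\<^sub>F s in at (0::real). jet_deriv t \<zeta> l (weight_quot m (of_real s)) holomorphic_on zstrip \<and>
    (\<forall>\<theta>. norm ((deriv ^^ j) (jet_deriv t \<zeta> l (weight_deriv m)) (of_real \<theta>) - (deriv ^^ j) (jet_deriv t \<zeta> l (weight_quot m (of_real s))) (of_real \<theta>)) < \<epsilon>)"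
proof -
  obtain \<delta> C where \<delta>: "\<delta> > 0" and C: "C > 0"
    and R: "\<And>s z. norm s < \<delta> \<Longrightarrow> z \<in> zstrip \<Longrightarrow> Rcol s z \<notin> \<real>\<^sub>\<le>\<^sub>0"
    and bound: "\<And>\<mu> s z. \<mu> \<in> cball \<zeta> 1 \<Longrightarrow> norm (s::complex) < \<delta> \<Longrightarrow> s \<noteq> 0 \<Longrightarrow> z \<in> zstrip \<Longrightarrow>
      norm ((worbit m \<mu> s z - worbit m \<mu> 0 z) / s - weight_deriv m \<mu> z) \<le> C * norm s"
    using worbit_quotient_bound[where \<zeta> = \<zeta> and m = m] by metis
  \<comment> \<open>Leibniz coefficients times Cauchy bounds; adding 1 keeps \<open>K\<close>
    positive even if the derivatives of \<open>t\<close> in the sum vanish.\<close>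
  define K where "K = (\<Sum>i = 0..l. norm (of_nat (l choose i) * (deriv ^^ i) t \<zeta>) * (fact (l - i) * (2 * C))) + 1"
  have K: "K > 0" unfolding K_def using C by (intro add_nonneg_pos sum_nonneg) auto
  \<comment> \<open>Cauchy's constant for order \<open>j\<close> at radius 1/2.\<close>
  define E where "E = fact j * (2 * K) * 2 ^ j"
  have E: "E > 0" using K by (simp add: E_def)
  have hd: "jet_deriv t \<zeta> l (weight_deriv m) holomorphic_on zstrip"
    unfolding jet_deriv_def[abs_def] by (intro holomorphic_intros holo_z)
  have main: "jet_deriv t \<zeta> l (weight_quot m (of_real s)) holomorphic_on zstrip \<and>
    (\<forall>\<theta>. norm ((deriv ^^ j) (jet_deriv t \<zeta> l (weight_deriv m)) (of_real \<theta>) - (deriv ^^ j) (jet_deriv t \<zeta> l (weight_quot m (of_real s))) (of_real \<theta>)) < \<epsilon>)"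
    if s: "s \<noteq> 0" "\<bar>s\<bar> < \<delta>" "E * \<bar>s\<bar> < \<epsilon>" for s
  proof (intro conjI allI)
    have ns: "norm (complex_of_real s) < \<delta>" using s by simp
    show hq: "jet_deriv t \<zeta> l (weight_quot m (of_real s)) holomorphic_on zstrip"
      unfolding jet_deriv_def[abs_def] using R[OF ns] R[of 0] \<delta> by (intro holomorphic_intros holo_z_q) auto
    fix \<theta>
    have le: "norm (jet_deriv t \<zeta> l (weight_deriv m) z - jet_deriv t \<zeta> l (weight_quot m (of_real s)) z) \<le> K * \<bar>s\<bar>" if z: "z \<in> zstrip" for z
    proof -
      have d: "norm ((deriv ^^ b) (\<lambda>\<mu>. weight_deriv m \<mu> z) \<zeta> - (deriv ^^ b) (\<lambda>\<mu>. weight_quot m (of_real s) \<mu> z) \<zeta>) \<le> fact b * (2 * C) * \<bar>s\<bar>" for b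
      proof -
        have "norm ((deriv ^^ b) (\<lambda>\<mu>. weight_deriv m \<mu> z - weight_quot m (of_real s) \<mu> z) \<zeta>) \<le> fact b * (2 * (C * \<bar>s\<bar>)) / 1 ^ b"
        proof (rule Cauchy_deriv_le[of _ UNIV])
          show "(\<lambda>\<mu>. weight_deriv m \<mu> z - weight_quot m (of_real s) \<mu> z) holomorphic_on UNIV" by (intro holomorphic_on_diff holo_mu)
          show "norm (weight_deriv m w z - weight_quot m (of_real s) w z) \<le> C * \<bar>s\<bar>" if "w \<in> cball \<zeta> 1" for w
            using bound[OF that ns _ z] s by (simp add: weight_quot_def norm_minus_commute)
        qed (use C s in auto)
        also have "(deriv ^^ b) (\<lambda>\<mu>. weight_deriv m \<mu> z - weight_quot m (of_real s) \<mu> z) \<zeta> = (deriv ^^ b) (\<lambda>\<mu>. weight_deriv m \<mu> z) \<zeta> - (deriv ^^ b) (\<lambda>\<mu>. weight_quot m (of_real s) \<mu> z) \<zeta>"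
          by (rule higher_deriv_diff[OF holo_mu]) auto
        finally show ?thesis by simp
      qed
      have eq: "jet_deriv t \<zeta> l (weight_deriv m) z - jet_deriv t \<zeta> l (weight_quot m (of_real s)) z =
          (\<Sum>i = 0..l. of_nat (l choose i) * (deriv ^^ i) t \<zeta> * ((deriv ^^ (l - i)) (\<lambda>\<mu>. weight_deriv m \<mu> z) \<zeta> - (deriv ^^ (l - i)) (\<lambda>\<mu>. weight_quot m (of_real s) \<mu> z) \<zeta>))"
        by (simp add: jet_deriv_def right_diff_distrib sum_subtractf)
      have "norm (jet_deriv t \<zeta> l (weight_deriv m) z - jet_deriv t \<zeta> l (weight_quot m (of_real s)) z) \<le>
          (\<Sum>i = 0..l. norm (of_nat (l choose i) * (deriv ^^ i) t \<zeta>) * (fact (l - i) * (2 * C) * \<bar>s\<bar>))"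
        unfolding eq by (rule sum_norm_le) (subst norm_mult, rule mult_left_mono[OF d], simp)
      also have "\<dots> = (K - 1) * \<bar>s\<bar>"
        unfolding K_def add_diff_cancel_right' sum_distrib_right mult.assoc ..
      also have "\<dots> \<le> K * \<bar>s\<bar>" by (rule mult_right_mono) simp_all
      finally show ?thesis .
    qed
    have deq: "(deriv ^^ j) (\<lambda>z. jet_deriv t \<zeta> l (weight_deriv m) z - jet_deriv t \<zeta> l (weight_quot m (of_real s)) z) (of_real \<theta>) =
        (deriv ^^ j) (jet_deriv t \<zeta> l (weight_deriv m)) (of_real \<theta>) - (deriv ^^ j) (jet_deriv t \<zeta> l (weight_quot m (of_real s))) (of_real \<theta>)"
      by (rule higher_deriv_diff[OF hd hq zstrip(1,2)])
    have "norm ((deriv ^^ j) (\<lambda>z. jet_deriv t \<zeta> l (weight_deriv m) z - jet_deriv t \<zeta> l (weight_quot m (of_real s)) z) (of_real \<theta>)) \<le> fact j * (2 * (K * \<bar>s\<bar>)) / (1/2) ^ j"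
    proof (rule Cauchy_deriv_le[OF holomorphic_on_diff[OF hd hq] zstrip(3)])
      show "0 < K * \<bar>s\<bar>" using K s(1) by simp
      show "norm (jet_deriv t \<zeta> l (weight_deriv m) w - jet_deriv t \<zeta> l (weight_quot m (of_real s)) w) \<le> K * \<bar>s\<bar>" if "w \<in> cball (of_real \<theta>) (1/2)" for w
        using le zstrip(3) that by blast
    qed simp
    also have "fact j * (2 * (K * \<bar>s\<bar>)) / (1/2) ^ j = E * \<bar>s\<bar>" by (simp add: E_def power_divide)
    finally show "norm ((deriv ^^ j) (jet_deriv t \<zeta> l (weight_deriv m)) (of_real \<theta>) - (deriv ^^ j) (jet_deriv t \<zeta> l (weight_quot m (of_real s))) (of_real \<theta>)) < \<epsilon>"
      unfolding deq using s(3) by (rule le_less_trans)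
  qed
  have "\<forall>\<^sub>F s in at (0::real). s \<noteq> 0 \<and> \<bar>s\<bar> < min \<delta> (\<epsilon> / E)"
    unfolding eventually_at using \<delta> \<epsilon> E by (intro exI[of _ "min \<delta> (\<epsilon> / E)"]) auto
  then show ?thesis
    by (rule eventually_mono) (rule main; use E in \<open>auto simp: field_simps\<close>)
qed

text \<open>The derivative of the orbit at \<open>s = 0\<close> as a sum of two Frobenius partners;
  the factors 1 match \<open>H_germ_lin\<close> and \<open>ps_act_lin\<close>.\<close>

definition deriv_family :: "int \<Rightarrow> complex \<Rightarrow> (complex \<Rightarrow> complex) \<Rightarrow> family" where
  "deriv_family m v t = (\<lambda>\<mu> k. 1 * frobenius (m - 2) v (\<lambda>\<mu>. t \<mu> * lower m \<mu>) \<mu> k + 1 * frobenius (m + 2) v (\<lambda>\<mu>. t \<mu> * raise m \<mu>) \<mu> k)"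

text \<open>The difference quotient is written as a linear combination of a translate and the family
  itself, so that it visibly stays in an invariant subspace.\<close>

definition quot_family :: "int \<Rightarrow> complex \<Rightarrow> (complex \<Rightarrow> complex) \<Rightarrow> real \<Rightarrow> family" where
  "quot_family m v t s = (\<lambda>\<mu> k. of_real (1 / s) * ps_act \<mu> (diagm s) (frobenius m v t \<mu>) k + of_real (- 1 / s) * frobenius m v t \<mu> k)"

lemma deriv_family_rot: "deriv_family m v t \<mu> (rot \<theta>) = (v * t \<mu>) * weight_deriv m \<mu> (of_real \<theta>)"
  by (simp add: deriv_family_def frobenius_rot weight_deriv_def cis_conv_exp algebra_simps)

lemma quot_family_rot: "quot_family m v t s \<mu> (rot \<theta>) = (v * t \<mu>) * weight_quot m (of_real s) \<mu> (of_real \<theta>)"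
proof -
  have "frobenius m v t \<mu> (rot \<theta>) = t \<mu> * v * worbit m \<mu> 0 (of_real \<theta>)"
    by (simp add: frobenius_rot worbit_0 cis_conv_exp algebra_simps)
  then show ?thesis
    by (simp add: quot_family_def ps_act_diagm weight_quot_def diff_divide_distrib algebra_simps)
qed

lemma quot_family_limit:
  assumes t: "t analytic_on {\<zeta>}" and \<epsilon>: "\<epsilon> > 0"
  shows "\<forall>\<^sub>F s in at 0. \<forall>\<theta>. norm (K_deriv j (taylor_coeff \<zeta> l (deriv_family m v t)) \<theta> - K_deriv j (taylor_coeff \<zeta> l (quot_family m v t s)) \<theta>) < \<epsilon>"
proof -
  \<comment> \<open>The normalisation of \<open>taylor_coeff\<close> and the vector \<open>v\<close>
    are absorbed into the coefficient function.\<close>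
  define c :: complex where "c = 1 / fact l"
  have t': "(\<lambda>\<mu>. c * (v * t \<mu>)) analytic_on {\<zeta>}" by (intro analytic_intros t)
  let ?t = "\<lambda>\<mu>. c * (v * t \<mu>)"
  have tc: "taylor_coeff \<zeta> l \<phi> (rot \<theta>) = jet_deriv ?t \<zeta> l f (of_real \<theta>)"
    if \<phi>: "\<And>\<mu>. \<phi> \<mu> (rot \<theta>) = (v * t \<mu>) * f \<mu> (of_real \<theta>)" and f: "\<And>z. (\<lambda>\<mu>. f \<mu> z) holomorphic_on UNIV" for \<phi> \<theta> f
  proof -
    have an: "(\<lambda>\<mu>. f \<mu> (of_real \<theta>)) analytic_on {\<zeta>}" using f by (auto simp: analytic_at)
    have "jet_deriv ?t \<zeta> l f (of_real \<theta>) = (deriv ^^ l) (\<lambda>\<mu>. ?t \<mu> * f \<mu> (of_real \<theta>)) \<zeta>"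
      by (rule jet_deriv_eq[symmetric, OF t' f])
    also have "\<dots> = (deriv ^^ l) (\<lambda>\<mu>. c * (v * t \<mu> * f \<mu> (of_real \<theta>))) \<zeta>" by (simp only: mult.assoc)
    also have "\<dots> = c * (deriv ^^ l) (\<lambda>\<mu>. v * t \<mu> * f \<mu> (of_real \<theta>)) \<zeta>"
      by (rule higher_deriv_cmult') (intro analytic_intros t an)
    finally show ?thesis by (simp add: taylor_coeff_def \<phi> c_def)
  qed
  have hd: "jet_deriv ?t \<zeta> l (weight_deriv m) holomorphic_on zstrip"
    unfolding jet_deriv_def[abs_def] by (intro holomorphic_intros holo_z)
  have Kd: "K_deriv j (taylor_coeff \<zeta> l (deriv_family m v t)) = (\<lambda>\<theta>. (deriv ^^ j) (jet_deriv ?t \<zeta> l (weight_deriv m)) (of_real \<theta>))"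
    unfolding K_deriv_eq tc[where \<phi> = "deriv_family m v t" and f = "weight_deriv m", OF deriv_family_rot holo_mu(1)] by (rule funpow_rderiv_of_real[OF hd zstrip(1,2)])
  show ?thesis using jet_deriv_limit[OF t' \<epsilon>, of l m j]
  proof (rule eventually_mono)
    fix s :: real
    assume *: "jet_deriv ?t \<zeta> l (weight_quot m (of_real s)) holomorphic_on zstrip \<and>
      (\<forall>\<theta>. norm ((deriv ^^ j) (jet_deriv ?t \<zeta> l (weight_deriv m)) (of_real \<theta>) - (deriv ^^ j) (jet_deriv ?t \<zeta> l (weight_quot m (of_real s))) (of_real \<theta>)) < \<epsilon>)"
    have Kq: "K_deriv j (taylor_coeff \<zeta> l (quot_family m v t s)) = (\<lambda>\<theta>. (deriv ^^ j) (jet_deriv ?t \<zeta> l (weight_quot m (of_real s))) (of_real \<theta>))"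
      unfolding K_deriv_eq tc[where \<phi> = "quot_family m v t s" and f = "weight_quot m (of_real s)", OF quot_family_rot holo_mu(2)] by (rule funpow_rderiv_of_real[OF conjunct1[OF *] zstrip(1,2)])
    show "\<forall>\<theta>. norm (K_deriv j (taylor_coeff \<zeta> l (deriv_family m v t)) \<theta> - K_deriv j (taylor_coeff \<zeta> l (quot_family m v t s)) \<theta>) < \<epsilon>"
      unfolding Kd Kq using * by blast
  qed
qed

section \<open>Sufficiency\<close>

lemma Hom_germ_mult:
  assumes "t \<in> Hom_germ m \<sigma> \<zeta>" "p holomorphic_on UNIV" "even (m - n)"
  shows "(\<lambda>\<mu>. t \<mu> * p \<mu>) \<in> Hom_germ n \<sigma> \<zeta>"
proof -
  have p: "p analytic_on {\<zeta>}" using assms(2) by (auto simp: analytic_at)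
  have "\<forall>\<^sub>F \<mu> in nhds \<zeta>. t \<mu> \<in> Hom_M (delta m) (Mchar \<sigma>)" using assms(1) by (simp add: Hom_germ_def)
  then have "\<forall>\<^sub>F \<mu> in nhds \<zeta>. t \<mu> * p \<mu> \<in> Hom_M (delta n) (Mchar \<sigma>)"
    unfolding Hom_M_parity[OF assms(3)] by (rule eventually_mono) (auto simp: Hom_M_iff)
  then show ?thesis using assms(1) p by (auto simp: Hom_germ_def intro!: analytic_intros)
qed

lemma Hom_germs_iff:
  "ts \<in> Hom_germs m \<xi> \<longleftrightarrow> length ts = length \<xi> \<and>
    (\<forall>i<length \<xi>. \<forall>\<sigma> \<zeta> d. \<xi> ! i = (\<sigma>, \<zeta>, d) \<longrightarrow> ts ! i \<in> Hom_germ m \<sigma> \<zeta>)"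
  unfolding Hom_germs_def list_all2_conv_all_nth by (auto split: prod.splits)

lemma germs_iff:
  "\<phi>s \<in> germs \<xi> \<longleftrightarrow> length \<phi>s = length \<xi> \<and>
    (\<forall>i<length \<xi>. \<forall>\<sigma> \<zeta> d. \<xi> ! i = (\<sigma>, \<zeta>, d) \<longrightarrow> \<phi>s ! i \<in> H_germ \<sigma> \<zeta>)"
  unfolding germs_def list_all2_conv_all_nth by (auto split: prod.splits)

lemma jet_class_nth:
  "\<xi> ! i = (\<sigma>, \<zeta>, d) \<Longrightarrow> i < length \<xi> \<Longrightarrow> length \<phi>s = length \<xi> \<Longrightarrow> jet_class \<xi> \<phi>s ! i = jet_rel \<sigma> \<zeta> d `` {\<phi>s ! i}"
  by (simp add: jet_class_def)

lemma length_jet_class: "length \<phi>s = length \<xi> \<Longrightarrow> length (jet_class \<xi> \<phi>s) = length \<xi>"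
  by (simp add: jet_class_def)

lemma jet_class_in_H_sum: "\<phi>s \<in> germs \<xi> \<Longrightarrow> jet_class \<xi> \<phi>s \<in> H_sum \<xi>"
  unfolding H_sum_def mem_Collect_eq list_all2_conv_all_nth
proof (intro conjI allI impI)
  assume \<phi>s: "\<phi>s \<in> germs \<xi>"
  then have len: "length \<phi>s = length \<xi>" by (simp add: germs_iff)
  then show "length \<xi> = length (jet_class \<xi> \<phi>s)" by (simp add: length_jet_class)
  fix i assume i: "i < length \<xi>"
  obtain \<sigma> \<zeta> d where x: "\<xi> ! i = (\<sigma>, \<zeta>, d)" by (metis prod_cases3)
  then have "\<phi>s ! i \<in> H_germ \<sigma> \<zeta>" using \<phi>s i by (simp add: germs_iff)
  then show "(case \<xi> ! i of (\<sigma>, \<zeta>, d) \<Rightarrow> \<lambda>X. X \<in> H_der \<sigma> \<zeta> d) (jet_class \<xi> \<phi>s ! i)"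
    unfolding jet_class_nth[OF x i len] x by (simp add: H_der_def quotientI)
qed

lemma jet_class_eqI:
  assumes "length \<phi>s = length \<xi>" "length \<psi>s = length \<xi>"
    "\<And>i \<sigma> \<zeta> d. i < length \<xi> \<Longrightarrow> \<xi> ! i = (\<sigma>, \<zeta>, d) \<Longrightarrow> (\<phi>s ! i, \<psi>s ! i) \<in> jet_rel \<sigma> \<zeta> d"
  shows "jet_class \<xi> \<phi>s = jet_class \<xi> \<psi>s"
proof (rule nth_equalityI)
  fix i assume "i < length (jet_class \<xi> \<phi>s)"
  then have i: "i < length \<xi>" using assms by (simp add: length_jet_class)
  obtain \<sigma> \<zeta> d where x: "\<xi> ! i = (\<sigma>, \<zeta>, d)" by (metis prod_cases3)
  show "jet_class \<xi> \<phi>s ! i = jet_class \<xi> \<psi>s ! i"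
    unfolding jet_class_nth[OF x i assms(1)] jet_class_nth[OF x i assms(2)]
    by (rule equiv_class_eq[OF equiv_jet_rel assms(3)[OF i x]])
qed (use assms in \<open>simp add: length_jet_class\<close>)

lemma map_germs:
  assumes "ts \<in> Hom_germs m \<xi>" "\<And>\<sigma> \<zeta> t. t \<in> Hom_germ m \<sigma> \<zeta> \<Longrightarrow> F t \<in> H_germ \<sigma> \<zeta>"
  shows "map F ts \<in> germs \<xi>"
  using assms by (auto simp: germs_iff Hom_germs_iff)

lemma map_Hom_germs:
  assumes "ts \<in> Hom_germs m \<xi>" "\<And>\<sigma> \<zeta> t. t \<in> Hom_germ m \<sigma> \<zeta> \<Longrightarrow> F t \<in> Hom_germ n \<sigma> \<zeta>"
  shows "map F ts \<in> Hom_germs n \<xi>"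
  using assms by (auto simp: Hom_germs_iff)

lemma subrep_lin_map:
  assumes W: "subrep \<xi> W" and ts: "ts \<in> Hom_germs m \<xi>"
    and F: "\<And>\<sigma> \<zeta> t. t \<in> Hom_germ m \<sigma> \<zeta> \<Longrightarrow> F t \<in> H_germ \<sigma> \<zeta>" "jet_class \<xi> (map F ts) \<in> W"
    and G: "\<And>\<sigma> \<zeta> t. t \<in> Hom_germ m \<sigma> \<zeta> \<Longrightarrow> G t \<in> H_germ \<sigma> \<zeta>" "jet_class \<xi> (map G ts) \<in> W"
  shows "jet_class \<xi> (map (\<lambda>t \<mu> k. a * F t \<mu> k + b * G t \<mu> k) ts) \<in> W"
proof -
  have lin: "\<forall>\<phi>s\<in>germs \<xi>. \<forall>\<psi>s\<in>germs \<xi>. \<forall>a b. jet_class \<xi> \<phi>s \<in> W \<longrightarrow> jet_class \<xi> \<psi>s \<in> W \<longrightarrow>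
      jet_class \<xi> (map2 (\<lambda>\<phi> \<psi> \<mu> k. a * \<phi> \<mu> k + b * \<psi> \<mu> k) \<phi>s \<psi>s) \<in> W"
    using W unfolding subrep_def by (elim conjE)
  have "jet_class \<xi> (map2 (\<lambda>\<phi> \<psi> \<mu> k. a * \<phi> \<mu> k + b * \<psi> \<mu> k) (map F ts) (map G ts)) \<in> W"
    by (rule lin[rule_format, OF map_germs[OF ts F(1)] map_germs[OF ts G(1)] F(2) G(2)])
  also have "map2 (\<lambda>\<phi> \<psi> \<mu> k. a * \<phi> \<mu> k + b * \<psi> \<mu> k) (map F ts) (map G ts) = map (\<lambda>t \<mu> k. a * F t \<mu> k + b * G t \<mu> k) ts"
    by (rule nth_equalityI) auto
  finally show ?thesis .
qed

lemma subrep_act_map: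
  assumes W: "subrep \<xi> W" and ts: "ts \<in> Hom_germs m \<xi>" and g: "g \<in> SL2"
    and F: "\<And>\<sigma> \<zeta> t. t \<in> Hom_germ m \<sigma> \<zeta> \<Longrightarrow> F t \<in> H_germ \<sigma> \<zeta>" "jet_class \<xi> (map F ts) \<in> W"
  shows "jet_class \<xi> (map (\<lambda>t \<mu>. ps_act \<mu> g (F t \<mu>)) ts) \<in> W"
proof -
  have act: "\<forall>\<phi>s\<in>germs \<xi>. \<forall>g\<in>SL2. jet_class \<xi> \<phi>s \<in> W \<longrightarrow>
      jet_class \<xi> (map (\<lambda>\<phi> \<mu>. ps_act \<mu> g (\<phi> \<mu>)) \<phi>s) \<in> W"
    using W unfolding subrep_def by (elim conjE)
  have "jet_class \<xi> (map (\<lambda>\<phi> \<mu>. ps_act \<mu> g (\<phi> \<mu>)) (map F ts)) \<in> W"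
    by (rule act[rule_format, OF map_germs[OF ts F(1)] g F(2)])
  then show ?thesis by (simp add: o_def)
qed

text \<open>Membership in \<open>D_space\<close> for given representatives instead of classes;
  \<open>jets_in_cong\<close> shows that congruent representatives are equivalent.\<close>

definition jets_in :: "datum \<Rightarrow> family set list set \<Rightarrow> int \<Rightarrow> (complex \<Rightarrow> complex) list \<Rightarrow> bool" where
  "jets_in \<xi> W m ts \<longleftrightarrow> ts \<in> Hom_germs m \<xi> \<and> (\<forall>v. jet_class \<xi> (map (frobenius m v) ts) \<in> W)"

lemma lower_holo: "lower m holomorphic_on UNIV" and raise_holo: "raise m holomorphic_on UNIV"
  unfolding lower_def[abs_def] raise_def[abs_def] by (intro holomorphic_intros; simp)+

lemma step_germs:
  assumes "t \<in> Hom_germ m \<sigma> \<zeta>"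
  shows "frobenius (m - 2) v (\<lambda>\<mu>. t \<mu> * lower m \<mu>) \<in> H_germ \<sigma> \<zeta>"
    "frobenius (m + 2) v (\<lambda>\<mu>. t \<mu> * raise m \<mu>) \<in> H_germ \<sigma> \<zeta>"
    "deriv_family m v t \<in> H_germ \<sigma> \<zeta>"
proof -
  show *: "frobenius (m - 2) v (\<lambda>\<mu>. t \<mu> * lower m \<mu>) \<in> H_germ \<sigma> \<zeta>"
    "frobenius (m + 2) v (\<lambda>\<mu>. t \<mu> * raise m \<mu>) \<in> H_germ \<sigma> \<zeta>"
    by (rule frobenius_germ, rule Hom_germ_mult[OF assms], rule lower_holo raise_holo, simp)+
  show "deriv_family m v t \<in> H_germ \<sigma> \<zeta>" unfolding deriv_family_def by (rule H_germ_lin[OF *])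
qed

text \<open>The difference quotients \<open>y s\<close> lie in \<open>W\<close>. If their limit did
  not, a basic neighbourhood of it would avoid \<open>W\<close>; but such a neighbourhood tests
  finitely many components, Taylor coefficients and angular orders, so \<open>y s\<close> enters it
  for some small \<open>s\<close>.\<close>

lemma deriv_family_in_W:
  assumes dat: "intertwining_datum \<xi> W" and ts: "jets_in \<xi> W m ts"
  shows "jet_class \<xi> (map (deriv_family m v) ts) \<in> W"
proof (rule ccontr)
  have W: "subrep \<xi> W" and cl: "closedin (H_topology \<xi>) W" using dat by (auto simp: intertwining_datum_def)
  have tsH: "ts \<in> Hom_germs m \<xi>" and tsW: "jet_class \<xi> (map (frobenius m v) ts) \<in> W" using ts by (auto simp: jets_in_def)
  have len: "length ts = length \<xi>" using tsH by (simp add: Hom_germs_iff)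
  define x where "x = jet_class \<xi> (map (deriv_family m v) ts)"
  define y where "y = (\<lambda>s. jet_class \<xi> (map (\<lambda>t. quot_family m v t s) ts))"
  assume "jet_class \<xi> (map (deriv_family m v) ts) \<notin> W"
  moreover have "x \<in> H_sum \<xi>" unfolding x_def by (rule jet_class_in_H_sum[OF map_germs[OF tsH step_germs(3)]])
  ultimately have "x \<in> H_sum \<xi> - W" by (simp add: x_def)
  moreover have "openin (H_topology \<xi>) (H_sum \<xi> - W)" using cl by (simp add: closedin_def topspace_H_topology)
  ultimately obtain N \<epsilon> where \<epsilon>: "\<epsilon> > 0" "H_nbhd \<xi> x N \<epsilon> \<subseteq> H_sum \<xi> - W"
    unfolding openin_H_topology by blast
  have yW: "y s \<in> W" for s
    unfolding y_def quot_family_def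
    by (rule subrep_lin_map[OF W tsH]) (intro ps_act_germ frobenius_germ diagm_in_SL2 tsW subrep_act_map[OF W tsH]; assumption)+
  have ev: "\<forall>\<^sub>F s in at (0::real). \<forall>i\<in>{..<length \<xi>}. \<forall>l\<in>{..snd (snd (\<xi> ! i))}. \<forall>j\<in>{..N}. \<forall>\<theta>.
      norm (K_deriv j (taylor_coeff (fst (snd (\<xi> ! i))) l (deriv_family m v (ts ! i))) \<theta> -
        K_deriv j (taylor_coeff (fst (snd (\<xi> ! i))) l (quot_family m v (ts ! i) s)) \<theta>) < \<epsilon>"
  proof (intro eventually_ball_finite finite_lessThan finite_atMost ballI)
    fix i l j assume "i \<in> {..<length \<xi>}"
    moreover obtain \<sigma> \<zeta> d where "\<xi> ! i = (\<sigma>, \<zeta>, d)" by (metis prod_cases3)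
    ultimately have "ts ! i analytic_on {fst (snd (\<xi> ! i))}" using tsH by (auto simp: Hom_germs_iff Hom_germ_def)
    then show "\<forall>\<^sub>F s in at 0. \<forall>\<theta>. norm (K_deriv j (taylor_coeff (fst (snd (\<xi> ! i))) l (deriv_family m v (ts ! i))) \<theta> -
        K_deriv j (taylor_coeff (fst (snd (\<xi> ! i))) l (quot_family m v (ts ! i) s)) \<theta>) < \<epsilon>"
      by (rule quot_family_limit[OF _ \<epsilon>(1)])
  qed
  then obtain s where s: "\<And>i l j \<theta>. i < length \<xi> \<Longrightarrow> l \<le> snd (snd (\<xi> ! i)) \<Longrightarrow> j \<le> N \<Longrightarrow>
      norm (K_deriv j (taylor_coeff (fst (snd (\<xi> ! i))) l (deriv_family m v (ts ! i))) \<theta> -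
        K_deriv j (taylor_coeff (fst (snd (\<xi> ! i))) l (quot_family m v (ts ! i) s)) \<theta>) < \<epsilon>"
    using eventually_happens'[OF at_neq_bot ev] by (meson atMost_iff lessThan_iff)
  have "y s \<in> H_nbhd \<xi> x N \<epsilon>"
    unfolding H_nbhd_def
  proof (intro CollectI conjI allI impI ballI)
    show "y s \<in> H_sum \<xi>" using yW W by (auto simp: subrep_def)
    fix i \<sigma> \<zeta> d \<phi> \<psi> l j \<theta>
    assume i: "i < length \<xi>" and xi: "\<xi> ! i = (\<sigma>, \<zeta>, d)" and \<phi>: "\<phi> \<in> x ! i" and \<psi>: "\<psi> \<in> y s ! i" and l: "l \<le> d" and j: "j \<le> N"
    have "(deriv_family m v (ts ! i), \<phi>) \<in> jet_rel \<sigma> \<zeta> d" "(quot_family m v (ts ! i) s, \<psi>) \<in> jet_rel \<sigma> \<zeta> d"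
      using \<phi> \<psi> i len by (auto simp: x_def y_def jet_class_nth[OF xi i])
    from this[THEN jet_rel_taylor, OF l] have "taylor_coeff \<zeta> l \<phi> = taylor_coeff \<zeta> l (deriv_family m v (ts ! i))"
      "taylor_coeff \<zeta> l \<psi> = taylor_coeff \<zeta> l (quot_family m v (ts ! i) s)" by simp_all
    then show "norm (K_deriv j (taylor_coeff \<zeta> l \<phi>) \<theta> - K_deriv j (taylor_coeff \<zeta> l \<psi>) \<theta>) < \<epsilon>"
      using s[OF i _ j, of l \<theta>] l by (simp add: xi)
  qed
  then show False using \<epsilon>(2) yW by blast
qed

lemma frobenius_scale: "frobenius m (c * v) t \<mu> k = c * frobenius m v t \<mu> k"
  by (simp add: frobenius_def)

text \<open>The weights \<open>m - 2\<close> and \<open>m + 2\<close> are separated by a rotation that acts on them by opposite scalars.\<close>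
lemma ps_act_rot_deriv_family:
  "ps_act \<mu> (rot (pi/4)) (deriv_family m v t \<mu>) k = cis (of_int m * (pi/4)) *
    (- \<i> * frobenius (m - 2) v (\<lambda>\<mu>. t \<mu> * lower m \<mu>) \<mu> k + \<i> * frobenius (m + 2) v (\<lambda>\<mu>. t \<mu> * raise m \<mu>) \<mu> k)"
proof -
  have c: "cis (of_int (m - 2) * (pi/4)) = cis (of_int m * (pi/4)) * (- \<i>)" "cis (of_int (m + 2) * (pi/4)) = cis (of_int m * (pi/4)) * \<i>"
  proof -
    have "of_int (m - 2) * (pi/4) = of_int m * (pi/4) + (- (pi/2))" "of_int (m + 2) * (pi/4) = of_int m * (pi/4) + pi/2"
      by (simp_all add: field_simps)
    then show "cis (of_int (m - 2) * (pi/4)) = cis (of_int m * (pi/4)) * (- \<i>)" "cis (of_int (m + 2) * (pi/4)) = cis (of_int m * (pi/4)) * \<i>"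
      by (simp_all only: cis_mult[symmetric]) (simp_all add: complex_eq_iff)
  qed
  show ?thesis
    unfolding deriv_family_def ps_act_lin ps_act_rot_frobenius mult.commute[of v] frobenius_scale c
    by (simp add: algebra_simps)
qed

text \<open>The derivative and its rotated copy are independent combinations of the lowered and the
  raised family. The coefficients \<open>1/2\<close> and \<open>i / (2 c)\<close> isolate the
  former, \<open>1/2\<close> and \<open>- i / (2 c)\<close> the latter.\<close>

lemma jets_in_lower_raise:
  assumes dat: "intertwining_datum \<xi> W" and ts: "jets_in \<xi> W m ts"
  shows "jets_in \<xi> W (m - 2) (map (\<lambda>t \<mu>. t \<mu> * lower m \<mu>) ts)" "jets_in \<xi> W (m + 2) (map (\<lambda>t \<mu>. t \<mu> * raise m \<mu>) ts)"
proof -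
  have W: "subrep \<xi> W" using dat by (auto simp: intertwining_datum_def)
  have tsH: "ts \<in> Hom_germs m \<xi>" using ts by (auto simp: jets_in_def)
  define c where "c = cis (of_int m * (pi/4))"
  have c: "c \<noteq> 0" by (simp add: c_def)
  have lin: "jet_class \<xi> (map (\<lambda>t \<mu> k. (1/2) * deriv_family m v t \<mu> k + b * ps_act \<mu> (rot (pi/4)) (deriv_family m v t \<mu>) k) ts) \<in> W" for b v
    by (rule subrep_lin_map[OF W tsH step_germs(3) deriv_family_in_W[OF dat ts] ps_act_germ[OF rot_in_SL2 step_germs(3)]
        subrep_act_map[OF W tsH rot_in_SL2 step_germs(3) deriv_family_in_W[OF dat ts]]])
  have 1: "(1/2) * deriv_family m v t \<mu> k + (\<i> / (2 * c)) * ps_act \<mu> (rot (pi/4)) (deriv_family m v t \<mu>) k = frobenius (m - 2) v (\<lambda>\<mu>. t \<mu> * lower m \<mu>) \<mu> k" for v t \<mu> k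
    unfolding ps_act_rot_deriv_family c_def[symmetric] using c by (simp add: deriv_family_def field_simps)
  have 2: "(1/2) * deriv_family m v t \<mu> k + (- \<i> / (2 * c)) * ps_act \<mu> (rot (pi/4)) (deriv_family m v t \<mu>) k = frobenius (m + 2) v (\<lambda>\<mu>. t \<mu> * raise m \<mu>) \<mu> k" for v t \<mu> k
    unfolding ps_act_rot_deriv_family c_def[symmetric] using c by (simp add: deriv_family_def field_simps)
  have 3: "jet_class \<xi> (map (\<lambda>t. frobenius (m - 2) v (\<lambda>\<mu>. t \<mu> * lower m \<mu>)) ts) \<in> W" for v
    using lin[of v "\<i> / (2 * c)"] unfolding 1 .
  have 4: "jet_class \<xi> (map (\<lambda>t. frobenius (m + 2) v (\<lambda>\<mu>. t \<mu> * raise m \<mu>)) ts) \<in> W" for v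
    using lin[of v "- \<i> / (2 * c)"] unfolding 2 .
  show "jets_in \<xi> W (m - 2) (map (\<lambda>t \<mu>. t \<mu> * lower m \<mu>) ts)"
    unfolding jets_in_def using 3 by (auto simp: o_def intro!: map_Hom_germs[OF tsH] Hom_germ_mult lower_holo)
  show "jets_in \<xi> W (m + 2) (map (\<lambda>t \<mu>. t \<mu> * raise m \<mu>) ts)"
    unfolding jets_in_def using 4 by (auto simp: o_def intro!: map_Hom_germs[OF tsH] Hom_germ_mult raise_holo)
qed

text \<open>The induction on the distance of the weights applies one ladder operator for each step
  of the shortest path.\<close>

lemma jets_in_ladder:
  assumes dat: "intertwining_datum \<xi> W" and "even (m - n)" "jets_in \<xi> W m ts"
  shows "jets_in \<xi> W n (map (\<lambda>t \<mu>. t \<mu> * ladder n m \<mu>) ts)"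
  using assms(2,3)
proof (induction "nat \<bar>m - n\<bar>" arbitrary: m ts rule: less_induct)
  case less
  consider "m = n" | "m < n" | "m > n" by linarith
  then show ?case
  proof cases
    case 1 then show ?thesis using less by simp
  next
    case 2
    have "m + 2 \<le> n" using 2 less.prems(1) by presburger
    then have "nat \<bar>m + 2 - n\<bar> < nat \<bar>m - n\<bar>" "even (m + 2 - n)" using less.prems(1) by auto
    from less.hyps[OF this jets_in_lower_raise(2)[OF dat less.prems(2)]]
    show ?thesis by (simp add: o_def ladder_up[OF less.prems(1) 2] mult.assoc)
  next
    case 3
    have "m - 2 \<ge> n" using 3 less.prems(1) by presburger
    then have "nat \<bar>m - 2 - n\<bar> < nat \<bar>m - n\<bar>" "even (m - 2 - n)" using less.prems(1) by auto
    from less.hyps[OF this jets_in_lower_raise(1)[OF dat less.prems(2)]]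
    show ?thesis by (simp add: o_def ladder_down[OF less.prems(1) 3] mult.assoc)
  qed
qed

lemma jets_in_lin:
  assumes W: "subrep \<xi> W" and ts: "jets_in \<xi> W m (map (\<lambda>t \<mu>. t \<mu> * p \<mu>) ts)" "jets_in \<xi> W m (map (\<lambda>t \<mu>. t \<mu> * q \<mu>) ts)"
    and H: "ts \<in> Hom_germs m \<xi>" "p holomorphic_on UNIV" "q holomorphic_on UNIV"
  shows "jets_in \<xi> W m (map (\<lambda>t \<mu>. t \<mu> * (a * p \<mu> + b * q \<mu>)) ts)"
proof -
  have g: "frobenius m v (\<lambda>\<mu>. t \<mu> * r \<mu>) \<in> H_germ \<sigma> \<zeta>" if "t \<in> Hom_germ m \<sigma> \<zeta>" "r holomorphic_on UNIV" for t \<sigma> \<zeta> v r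
    by (rule frobenius_germ[OF Hom_germ_mult[OF that]]) simp
  have "jet_class \<xi> (map (\<lambda>t \<mu> k. a * frobenius m v (\<lambda>\<mu>. t \<mu> * p \<mu>) \<mu> k + b * frobenius m v (\<lambda>\<mu>. t \<mu> * q \<mu>) \<mu> k) ts) \<in> W" for v
    using ts by (intro subrep_lin_map[OF W H(1)] g H) (auto simp: jets_in_def o_def)
  moreover have "a * frobenius m v (\<lambda>\<mu>. t \<mu> * p \<mu>) \<mu> k + b * frobenius m v (\<lambda>\<mu>. t \<mu> * q \<mu>) \<mu> k =
      frobenius m v (\<lambda>\<mu>. t \<mu> * (a * p \<mu> + b * q \<mu>)) \<mu> k" for v t \<mu> k
    by (simp add: frobenius_def algebra_simps)
  ultimately have "jet_class \<xi> (map (\<lambda>t. frobenius m v (\<lambda>\<mu>. t \<mu> * (a * p \<mu> + b * q \<mu>))) ts) \<in> W" for v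
    by simp
  then show ?thesis unfolding jets_in_def using H
    by (auto simp: o_def intro!: map_Hom_germs[OF H(1)] Hom_germ_mult holomorphic_intros)
qed

text \<open>Lowering after raising is the Casimir operator up to an additive constant.\<close>
lemma jets_in_square:
  assumes dat: "intertwining_datum \<xi> W" and ts: "jets_in \<xi> W m ts"
  shows "jets_in \<xi> W m (map (\<lambda>t \<mu>. t \<mu> * \<mu>\<^sup>2) ts)"
proof -
  have W: "subrep \<xi> W" and H: "ts \<in> Hom_germs m \<xi>" using dat ts by (auto simp: intertwining_datum_def jets_in_def)
  have "jets_in \<xi> W m (map (\<lambda>t \<mu>. t \<mu> * (lower (m + 2) \<mu> * raise m \<mu>)) ts)"
    using jets_in_lower_raise(1)[OF dat jets_in_lower_raise(2)[OF dat ts]] by (simp add: o_def mult.assoc mult.commute[of "raise m _"])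
  moreover have "jets_in \<xi> W m (map (\<lambda>t \<mu>. t \<mu> * 1) ts)" using ts by simp
  ultimately have "jets_in \<xi> W m (map (\<lambda>t \<mu>. t \<mu> * (1 * (lower (m + 2) \<mu> * raise m \<mu>) + ((of_int m + 1) / 2)\<^sup>2 * 1)) ts)"
    by (rule jets_in_lin[OF W _ _ H]) (intro holomorphic_intros lower_holo raise_holo)+
  then show ?thesis unfolding lower_raise by simp
qed

lemma jets_in_poly:
  assumes dat: "intertwining_datum \<xi> W" and ts: "jets_in \<xi> W m ts"
  shows "jets_in \<xi> W m (map (\<lambda>t \<mu>. t \<mu> * poly P (\<mu>\<^sup>2)) ts)"
proof (induction P)
  case 0
  have W: "subrep \<xi> W" and H: "ts \<in> Hom_germs m \<xi>" using dat ts by (auto simp: intertwining_datum_def jets_in_def)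
  have "jets_in \<xi> W m (map (\<lambda>t \<mu>. t \<mu> * (0 * 1 + 0 * 1)) ts)"
    by (rule jets_in_lin[OF W _ _ H]) (use ts in auto)
  then show ?case by simp
next
  case (pCons a P)
  have W: "subrep \<xi> W" and H: "ts \<in> Hom_germs m \<xi>" using dat ts by (auto simp: intertwining_datum_def jets_in_def)
  have "jets_in \<xi> W m (map (\<lambda>t \<mu>. t \<mu> * (poly P (\<mu>\<^sup>2) * \<mu>\<^sup>2)) ts)"
    using jets_in_square[OF dat pCons.IH] by (simp add: o_def mult.assoc)
  moreover have "jets_in \<xi> W m (map (\<lambda>t \<mu>. t \<mu> * 1) ts)" using ts by simp
  ultimately have "jets_in \<xi> W m (map (\<lambda>t \<mu>. t \<mu> * (1 * (poly P (\<mu>\<^sup>2) * \<mu>\<^sup>2) + a * 1)) ts)"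
    by (rule jets_in_lin[OF W _ _ H]) (intro holomorphic_intros)+
  then show ?case by (simp add: algebra_simps)
qed

text \<open>The Frobenius partner is linear in \<open>t\<close>, so the quotient \<open>w\<close> of
  a congruence of scalars yields the quotient of a congruence of families.\<close>

lemma jets_in_cong:
  assumes "jets_in \<xi> W m ts" "us \<in> Hom_germs m \<xi>"
    "\<And>i \<sigma> \<zeta> d. i < length \<xi> \<Longrightarrow> \<xi> ! i = (\<sigma>, \<zeta>, d) \<Longrightarrow> (us ! i, ts ! i) \<in> Hom_rel m \<sigma> \<zeta> d"
  shows "jets_in \<xi> W m us"
proof -
  have len: "length ts = length \<xi>" "length us = length \<xi>" using assms(1,2) by (auto simp: jets_in_def Hom_germs_iff)
  have "jet_class \<xi> (map (frobenius m v) us) = jet_class \<xi> (map (frobenius m v) ts)" for v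
  proof (rule jet_class_eqI)
    fix i \<sigma> \<zeta> d assume i: "i < length \<xi>" "\<xi> ! i = (\<sigma>, \<zeta>, d)"
    obtain w where w: "us ! i \<in> Hom_germ m \<sigma> \<zeta>" "ts ! i \<in> Hom_germ m \<sigma> \<zeta>" "w \<in> Hom_germ m \<sigma> \<zeta>"
      "\<forall>\<^sub>F \<mu> in nhds \<zeta>. (us ! i) \<mu> - (ts ! i) \<mu> = (\<mu> - \<zeta>) ^ (d + 1) * w \<mu>"
      using assms(3)[OF i] by (auto simp: Hom_rel_def)
    have "(frobenius m v (us ! i), frobenius m v (ts ! i)) \<in> jet_rel \<sigma> \<zeta> d"
    proof (rule jet_relI[OF w(1-3)[THEN frobenius_germ]])
      show "\<forall>\<^sub>F \<mu> in nhds \<zeta>. \<forall>k. frobenius m v (us ! i) \<mu> k - frobenius m v (ts ! i) \<mu> k = (\<mu> - \<zeta>) ^ (d + 1) * frobenius m v w \<mu> k"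
        using w(4)
      proof eventually_elim
        case (elim \<mu>)
        have "frobenius m v (us ! i) \<mu> k - frobenius m v (ts ! i) \<mu> k = (if k \<in> Kgrp then ((us ! i) \<mu> - (ts ! i) \<mu>) * (inverse (delta m k) * v) else 0)" for k
          by (simp add: frobenius_def left_diff_distrib)
        then show ?case unfolding elim by (simp add: frobenius_def mult.assoc)
      qed
    qed
    then show "(map (frobenius m v) us ! i, map (frobenius m v) ts ! i) \<in> jet_rel \<sigma> \<zeta> d"
      using i len by simp
  qed (use len in auto)
  then show ?thesis using assms(1,2) by (simp add: jets_in_def)
qed

lemma Hom_class_eqD:
  assumes "Hom_class m \<xi> ts = Hom_class m \<xi> us" "ts \<in> Hom_germs m \<xi>" "us \<in> Hom_germs m \<xi>"
    "i < length \<xi>" "\<xi> ! i = (\<sigma>, \<zeta>, d)"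
  shows "(ts ! i, us ! i) \<in> Hom_rel m \<sigma> \<zeta> d"
proof (rule Hom_rel_class_eqD)
  have len: "length ts = length \<xi>" "length us = length \<xi>" using assms by (auto simp: Hom_germs_iff)
  have "Hom_class m \<xi> ts ! i = Hom_class m \<xi> us ! i" using assms(1) by simp
  then show "Hom_rel m \<sigma> \<zeta> d `` {ts ! i} = Hom_rel m \<sigma> \<zeta> d `` {us ! i}"
    using len assms(4,5) by (simp add: Hom_class_def)
  show "us ! i \<in> Hom_germ m \<sigma> \<zeta>" using assms by (simp add: Hom_germs_iff)
qed

text \<open>Each \<zeta> of the datum serves as a node with multiplicity \<open>d + 1\<close>, so
  the interpolating polynomial agrees with \<open>h\<close> to the order that the classes
  see.\<close>

lemma jets_in_even:
  assumes dat: "intertwining_datum \<xi> W" and ts: "jets_in \<xi> W m ts"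
    and h: "h holomorphic_on UNIV" "\<And>z. h (- z) = h z"
  shows "jets_in \<xi> W m (map (\<lambda>t \<mu>. t \<mu> * h \<mu>) ts)"
proof -
  have tsH: "ts \<in> Hom_germs m \<xi>" and len: "length ts = length \<xi>" using ts by (auto simp: jets_in_def Hom_germs_iff)
  define cs where "cs = concat (map (\<lambda>(\<sigma>, \<zeta>, d). replicate (d + 1) \<zeta>) \<xi>)"
  obtain P g where P: "g holomorphic_on UNIV" "\<And>z. h z = poly P (z\<^sup>2) + (\<Prod>c\<leftarrow>cs. z\<^sup>2 - c\<^sup>2) * g z"
    using even_interpolation[OF h] by blast
  show ?thesis
  proof (rule jets_in_cong[OF jets_in_poly[OF dat ts, of P]])
    show "map (\<lambda>t \<mu>. t \<mu> * h \<mu>) ts \<in> Hom_germs m \<xi>"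
      by (rule map_Hom_germs[OF tsH Hom_germ_mult[OF _ h(1)]]) auto
    fix i \<sigma> \<zeta> d assume i: "i < length \<xi>" and xi: "\<xi> ! i = (\<sigma>, \<zeta>, d)"
    have ti: "ts ! i \<in> Hom_germ m \<sigma> \<zeta>" using tsH i xi by (simp add: Hom_germs_iff)
    define f where "f = (\<lambda>(\<sigma>::Mhat, \<zeta>, d::nat). replicate (d + 1) (\<zeta>::complex))"
    have "cs = concat (map f (take i \<xi>)) @ replicate (d + 1) \<zeta> @ concat (map f (drop (Suc i) \<xi>))"
      unfolding cs_def f_def[symmetric] by (subst id_take_nth_drop[OF i]) (simp add: xi f_def)
    then obtain as bs where cs: "cs = as @ replicate (d + 1) \<zeta> @ bs" by blast
    \<comment> \<open>The cofactor of \<open>(z - \<zeta>)^(d + 1)\<close>: the factors at -\<zeta>,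
      the other nodes and \<open>g\<close>.\<close>
    define w where "w = (\<lambda>z. (z + \<zeta>) ^ (d + 1) * ((\<Prod>c\<leftarrow>as. z\<^sup>2 - c\<^sup>2) * (\<Prod>c\<leftarrow>bs. z\<^sup>2 - c\<^sup>2) * g z))"
    have "(\<Prod>c\<leftarrow>cs. z\<^sup>2 - c\<^sup>2) * g z = (z - \<zeta>) ^ (d + 1) * w z" for z
    proof -
      have "(z\<^sup>2 - \<zeta>\<^sup>2) ^ (d + 1) = (z - \<zeta>) ^ (d + 1) * (z + \<zeta>) ^ (d + 1)"
        by (simp only: power_mult_distrib[symmetric] power2_eq_square square_diff_square_factored mult.commute)
      then show ?thesis by (simp add: cs w_def mult_ac prod_list_replicate del: power_Suc replicate_Suc)
    qed
    then have hP: "h z - poly P (z\<^sup>2) = (z - \<zeta>) ^ (d + 1) * w z" for z using P(2)[of z] by simp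
    have prod: "(\<lambda>z. \<Prod>c\<leftarrow>xs. z\<^sup>2 - c\<^sup>2 :: complex) holomorphic_on UNIV" for xs
      by (induction xs) (auto intro!: holomorphic_intros)
    have w: "w holomorphic_on UNIV" unfolding w_def by (intro holomorphic_intros prod P)
    have "(\<lambda>\<mu>. (ts ! i) \<mu> * h \<mu>, \<lambda>\<mu>. (ts ! i) \<mu> * poly P (\<mu>\<^sup>2)) \<in> Hom_rel m \<sigma> \<zeta> d"
      unfolding Hom_rel_def mem_Collect_eq case_prod_conv
    proof (intro conjI bexI[of _ "\<lambda>\<mu>. (ts ! i) \<mu> * w \<mu>"])
      show "(\<lambda>\<mu>. (ts ! i) \<mu> * h \<mu>) \<in> Hom_germ m \<sigma> \<zeta>" "(\<lambda>\<mu>. (ts ! i) \<mu> * w \<mu>) \<in> Hom_germ m \<sigma> \<zeta>"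
        by (rule Hom_germ_mult[OF ti]; simp add: h w)+
      show "(\<lambda>\<mu>. (ts ! i) \<mu> * poly P (\<mu>\<^sup>2)) \<in> Hom_germ m \<sigma> \<zeta>"
        by (rule Hom_germ_mult[OF ti]) (auto intro!: holomorphic_intros)
      have "(ts ! i) \<mu> * h \<mu> - (ts ! i) \<mu> * poly P (\<mu>\<^sup>2) = (\<mu> - \<zeta>) ^ (d + 1) * ((ts ! i) \<mu> * w \<mu>)" for \<mu>
        unfolding right_diff_distrib[symmetric] hP by (simp only: mult_ac)
      then show "\<forall>\<^sub>F \<mu> in nhds \<zeta>. (ts ! i) \<mu> * h \<mu> - (ts ! i) \<mu> * poly P (\<mu>\<^sup>2) = (\<mu> - \<zeta>) ^ (d + 1) * ((ts ! i) \<mu> * w \<mu>)"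
        by (intro always_eventually allI)
    qed
    then show "(map (\<lambda>t \<mu>. t \<mu> * h \<mu>) ts ! i, map (\<lambda>t \<mu>. t \<mu> * poly P (\<mu>\<^sup>2)) ts ! i) \<in> Hom_rel m \<sigma> \<zeta> d"
      using i len by simp
  qed
qed

lemma quotient_imp_D3:
  assumes par: "even (m - n)" and h: "h holomorphic_on UNIV" "\<And>z. h (- z) = h z"
    and \<phi>: "\<And>\<mu>. \<phi> \<mu> = h \<mu> * ladder n m \<mu>"
  shows "D3 n m \<phi>"
  unfolding D3_def
proof (intro allI impI ballI)
  fix \<xi> W ts
  assume dat: "intertwining_datum \<xi> W" and ts: "ts \<in> Hom_germs m \<xi>" and D: "Hom_class m \<xi> ts \<in> D_space \<xi> W m"
  obtain us where us: "Hom_class m \<xi> ts = Hom_class m \<xi> us" "jets_in \<xi> W m us"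
    using D by (auto simp: D_space_def jets_in_def)
  \<comment> \<open>\<open>D_space\<close> provides some representatives \<open>us\<close>;
    congruence transfers membership to the given \<open>ts\<close>. The even factor is then applied
    at weight \<open>m\<close>, before the ladder leads to \<open>n\<close>.\<close>
  have "jets_in \<xi> W m ts"
    by (rule jets_in_cong[OF us(2) ts Hom_class_eqD[OF us(1) ts]]) (use us(2) in \<open>auto simp: jets_in_def\<close>)
  from jets_in_ladder[OF dat par jets_in_even[OF dat this h]]
  have "jets_in \<xi> W n (map (\<lambda>t \<mu>. t \<mu> * \<phi> \<mu>) ts)" by (simp add: o_def \<phi> mult.assoc)
  then show "Hom_class n \<xi> (map (\<lambda>t \<mu>. t \<mu> * \<phi> \<mu>) ts) \<in> D_space \<xi> W n"
    unfolding D_space_def jets_in_def by blast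
qed

theorem theorem7:
  fixes n m :: int and \<phi> :: "complex \<Rightarrow> complex"
  assumes "[n = m] (mod 2)"
    and "\<phi> holomorphic_on UNIV"
    and "\<And>\<mu>. \<phi> \<mu> \<in> Hom_M (delta n) (delta m)"
  shows "D3 n m \<phi> \<longleftrightarrow>
    (\<exists>h. h holomorphic_on UNIV \<and> (\<forall>z. h (- z) = h z) \<and> (\<forall>\<mu>. \<phi> \<mu> = h \<mu> * qpoly n m \<mu>))"
proof -
  have "even (m - n)" using assms(1) by (metis cong_iff_dvd_diff cong_sym)
  then show ?thesis
    unfolding qpoly_eq_ladder[OF \<open>even (m - n)\<close>]
    using D3_imp_quotient assms(2) quotient_imp_D3 by blast
qed

end
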